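(* Let $d=2n$ be an even positive integer and let $F$ be a compactly supported distribution on $\mathbb{R}^d$. Let $\mathbf{H}_F$ be the matrix with entries $\langle F,f_\alpha\overline{f_\beta}\rangle$, where $(f_\alpha)$ runs over a system of harmonic polynomials on $\mathbb{R}^d$ spanning the space of all harmonic polynomials. Suppose $\mathbf{H}_F$ has rank $m<\infty$. Then $F=\sum_{q=1}^{m_0}L_q\delta(x-x_q)$ with $m_0\le m$, points $x_q\in\mathbb{R}^d$, and $L_q$ linear differential operators with constant coefficients on $\mathbb{R}^d$.
   Context: $\langle F,\phi\rangle$ denotes the action of $F$ on a smooth function $\phi$. The rank of $\mathbf{H}_F$ does not depend on the choice of the spanning system of harmonic polynomials. *)

theory Defs
  imports "HOL-Analysis.Analysis" "HOL-Library.Extended_Nat" "Jordan_Normal_Form.DL_Rank"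
begin

definition pdiff :: "'d::finite \<Rightarrow> (real^'d \<Rightarrow> complex) \<Rightarrow> (real^'d \<Rightarrow> complex)" where
  "pdiff i \<phi> = (\<lambda>x. vector_derivative (\<lambda>t. \<phi> (x + t *\<^sub>R axis i 1)) (at 0))"

fun pdiffs :: "'d::finite list \<Rightarrow> (real^'d \<Rightarrow> complex) \<Rightarrow> (real^'d \<Rightarrow> complex)" where
  "pdiffs [] \<phi> = \<phi>"
| "pdiffs (i # is) \<phi> = pdiff i (pdiffs is \<phi>)"

definition smooth :: "(real^'d::finite \<Rightarrow> complex) \<Rightarrow> bool" where
  "smooth \<phi> \<longleftrightarrow> (\<forall>is. continuous_on UNIV (pdiffs is \<phi>) \<and>
      (\<forall>i x. ((\<lambda>t. pdiffs is \<phi> (x + t *\<^sub>R axis i 1)) has_vector_derivative pdiffs (i # is) \<phi> x) (at 0)))"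

text \<open>Compactly supported distributions (the space E'(R^d)): linear functionals on the
  smooth functions, continuous for the C-infinity topology, i.e. bounded by a finite
  order seminorm on some compact set.\<close>
definition compact_distribution :: "((real^'d::finite \<Rightarrow> complex) \<Rightarrow> complex) \<Rightarrow> bool" where
  "compact_distribution F \<longleftrightarrow>
     (\<forall>\<phi> \<psi> a b. smooth \<phi> \<longrightarrow> smooth \<psi> \<longrightarrow> F (\<lambda>x. a * \<phi> x + b * \<psi> x) = a * F \<phi> + b * F \<psi>) \<and>
     (\<exists>K C N. compact K \<and> (\<forall>\<phi>. smooth \<phi> \<longrightarrow>
        norm (F \<phi>) \<le> C * (\<Sum>is\<in>{is::'d list. length is \<le> N}. SUP x\<in>K. norm (pdiffs is \<phi> x))))"

definition polynomial_fun :: "(real^'d::finite \<Rightarrow> complex) \<Rightarrow> bool" where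
  "polynomial_fun f \<longleftrightarrow> (\<exists>c :: ('d \<Rightarrow> nat) \<Rightarrow> complex. finite {a. c a \<noteq> 0} \<and>
      (\<forall>x. f x = (\<Sum>a\<in>{a. c a \<noteq> 0}. c a * (\<Prod>i\<in>UNIV. complex_of_real ((x $ i) ^ a i)))))"

definition harmonic_poly :: "(real^'d::finite \<Rightarrow> complex) \<Rightarrow> bool" where
  "harmonic_poly f \<longleftrightarrow> polynomial_fun f \<and> (\<forall>x. (\<Sum>i\<in>UNIV. pdiffs [i, i] f x) = 0)"

definition spans_harmonic :: "('i \<Rightarrow> (real^'d::finite \<Rightarrow> complex)) \<Rightarrow> bool" where
  "spans_harmonic f \<longleftrightarrow> (\<forall>a. harmonic_poly (f a)) \<and>
     (\<forall>g. harmonic_poly g \<longrightarrow> (\<exists>S c. finite S \<and> g = (\<lambda>x. \<Sum>a\<in>S. c a * f a x)))"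

definition H_sub :: "((real^'d::finite \<Rightarrow> complex) \<Rightarrow> complex) \<Rightarrow> ('i \<Rightarrow> (real^'d \<Rightarrow> complex))
    \<Rightarrow> 'i list \<Rightarrow> 'i list \<Rightarrow> complex mat" where
  "H_sub F f rs cs = mat (length rs) (length cs)
     (\<lambda>(j, k). F (\<lambda>x. f (rs ! j) x * cnj (f (cs ! k) x)))"

definition H_rank :: "((real^'d::finite \<Rightarrow> complex) \<Rightarrow> complex) \<Rightarrow> ('i \<Rightarrow> (real^'d \<Rightarrow> complex)) \<Rightarrow> enat" where
  "H_rank F f = (SUP (rs, cs)\<in>UNIV. enat (vec_space.rank (length rs) (H_sub F f rs cs)))"

end

theory Submission
  imports Defs "HOL-Complex_Analysis.Complex_Analysis"
begin

text \<open>Identify \<open>\<real>\<^sup>d\<close> with \<open>\<complex>\<^sup>n\<close>. Holomorphic polynomials are harmonic, so the function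
  \<open>G(k) = \<langle>F, exp (k \<cdot> x)\<rangle>\<close> has a finite rank factorisation \<open>G(l + u) = \<Sum> a\<^sub>k(l) b\<^sub>k(u)\<close> for
  \<open>l\<close>, \<open>u\<close> in the isotropic subspaces on which \<open>exp (l \<cdot> x)\<close> is holomorphic and
  \<open>exp (u \<cdot> x)\<close> antiholomorphic. By the Paley-Wiener bound and Liouville's theorem, determinants of
  translates of the \<open>a\<^sub>k\<close> are polynomials of bounded degree up to a common factor; hence the
  \<open>a\<^sub>k\<close> satisfy linear recurrences, which means that \<open>F\<close> is annihilated by a nonzero polynomial in
  \<open>exp (s z\<^sub>j)\<close> for each complex coordinate \<open>z\<^sub>j\<close>. So \<open>F\<close> lives on finitely many points, and
  interpolation by holomorphic polynomials bounds their number by the rank.\<close>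

section \<open>Smooth functions and exponentials\<close>

text \<open>The bound on \<open>G\<close> is polynomial only in directions where the exponent stays
  imaginary up to a bounded term. The direction formed by \<open>t *s vz a\<close> and
  \<open>cnj t *s (- vw a)\<close> has this property, but contains both \<open>t\<close> and
  \<open>cnj t\<close>, so \<open>G\<close> is not holomorphic along it. Determinants are the cure:
  once \<open>G(l + u)\<close> is factored, a determinant splits off the dependence on
  \<open>cnj t\<close> as one scalar factor, which a single value of \<open>G\<close> does not do,
  and a scalar factor can be conjugated without changing its modulus. Values on exponentials
  determine \<open>F\<close> only if sums of exponentials are dense together with all derivatives;
  uniform density is too weak for a distribution of positive order. The passage from annihilators to
  points avoids cutoff functions: if \<open>S\<close> is the sum of the squared moduli of the
  annihilators, \<open>F\<close> does not notice a factor \<open>(1 - S / c) ^ k\<close>, and these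
  factors send to zero every function that vanishes to high order at the common zeros. The
  recurrences do not control the number of points by \<open>m\<close>; that takes a second use of
  the vanishing minors.\<close>

lemma pdiff_eqI:
  assumes "\<And>x. ((\<lambda>t. \<phi> (x + t *\<^sub>R axis i 1)) has_vector_derivative g x) (at 0)"
  shows "pdiff i \<phi> = g"
  using vector_derivative_at[OF assms] by (auto simp: pdiff_def)

lemma pdiffs_append: "pdiffs (xs @ ys) \<phi> = pdiffs xs (pdiffs ys \<phi>)"
  by (induction xs) auto

lemma smooth_pdiffs: "smooth \<phi> \<Longrightarrow> smooth (pdiffs is \<phi>)"
  unfolding smooth_def by (metis append_Cons pdiffs_append)

lemma smooth_pdiff: "smooth \<phi> \<Longrightarrow> smooth (pdiff i \<phi>)"
  using smooth_pdiffs[of \<phi> "[i]"] by simp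

lemma smooth_continuous_on: "smooth \<phi> \<Longrightarrow> continuous_on S \<phi>"
  unfolding smooth_def using continuous_on_subset[of UNIV \<phi> S] by (metis pdiffs.simps(1) subset_UNIV)

lemma smooth_has_vector_derivative:
  assumes "smooth \<phi>"
  shows "((\<lambda>t. \<phi> (x + t *\<^sub>R axis i 1)) has_vector_derivative pdiff i \<phi> (x + s *\<^sub>R axis i 1)) (at s)"
proof -
  have "((\<lambda>t. \<phi> ((x + s *\<^sub>R axis i 1) + t *\<^sub>R axis i 1)) has_vector_derivative
      pdiff i \<phi> (x + s *\<^sub>R axis i 1)) (at (s - s))"
    using assms unfolding smooth_def by (metis diff_self pdiffs.simps)
  moreover have "((\<lambda>t. t - s) has_vector_derivative 1) (at s)"
    by (auto intro!: derivative_eq_intros)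
  ultimately have "((\<lambda>t. \<phi> ((x + s *\<^sub>R axis i 1) + t *\<^sub>R axis i 1)) \<circ> (\<lambda>t. t - s)
      has_vector_derivative 1 *\<^sub>R pdiff i \<phi> (x + s *\<^sub>R axis i 1)) (at s)"
    by (intro vector_diff_chain_at)
  moreover have "((\<lambda>t. \<phi> ((x + s *\<^sub>R axis i 1) + t *\<^sub>R axis i 1)) \<circ> (\<lambda>t. t - s))
      = (\<lambda>t. \<phi> (x + t *\<^sub>R axis i 1))"
    by (auto simp: fun_eq_iff algebra_simps)
  ultimately show ?thesis by simp
qed

lemma smooth_has_vector_derivative_0:
  assumes "smooth \<phi>"
  shows "((\<lambda>t. \<phi> (x + t *\<^sub>R axis i 1)) has_vector_derivative pdiff i \<phi> x) (at 0)"
  using smooth_has_vector_derivative[OF assms, of x i 0] by simp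

text \<open>A set of continuous functions that is closed under partial derivatives contains all
  iterated partials of its members. This replaces inductions over index lists for products,
  conjugates and constants.\<close>

lemma smooth_coinduct:
  assumes "\<phi> \<in> \<S>"
    and cont: "\<And>\<phi>. \<phi> \<in> \<S> \<Longrightarrow> continuous_on UNIV \<phi>"
    and deriv: "\<And>\<phi> i. \<phi> \<in> \<S> \<Longrightarrow> \<exists>\<psi>\<in>\<S>. \<forall>x.
        ((\<lambda>t. \<phi> (x + t *\<^sub>R axis i 1)) has_vector_derivative \<psi> x) (at 0)"
  shows "smooth \<phi>"
proof -
  have deriv': "pdiff i \<phi> \<in> \<S> \<and> (\<forall>x. ((\<lambda>t. \<phi> (x + t *\<^sub>R axis i 1)) has_vector_derivative pdiff i \<phi> x) (at 0))"
    if "\<phi> \<in> \<S>" for \<phi> i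
    using deriv[OF that] pdiff_eqI by metis
  have "pdiffs is \<phi> \<in> \<S>" for "is"
    by (induction "is") (use assms(1) deriv' in auto)
  then show ?thesis
    unfolding smooth_def using cont deriv' by auto
qed

lemma pdiff_add:
  assumes "smooth \<phi>" "smooth \<psi>"
  shows "pdiff i (\<lambda>x. \<phi> x + \<psi> x) = (\<lambda>x. pdiff i \<phi> x + pdiff i \<psi> x)"
  by (intro pdiff_eqI has_vector_derivative_add smooth_has_vector_derivative_0 assms)

lemma pdiff_mult:
  assumes "smooth \<phi>" "smooth \<psi>"
  shows "pdiff i (\<lambda>x. \<phi> x * \<psi> x) = (\<lambda>x. pdiff i \<phi> x * \<psi> x + \<phi> x * pdiff i \<psi> x)"
proof (intro pdiff_eqI)
  fix x
  show "((\<lambda>t. \<phi> (x + t *\<^sub>R axis i 1) * \<psi> (x + t *\<^sub>R axis i 1)) has_vector_derivative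
      pdiff i \<phi> x * \<psi> x + \<phi> x * pdiff i \<psi> x) (at 0)"
    using has_vector_derivative_mult[OF smooth_has_vector_derivative_0[OF assms(1), of x i]
      smooth_has_vector_derivative_0[OF assms(2), of x i]] by (simp add: add.commute)
qed

text \<open>Products alone are not closed under differentiation, but finite sums of products are;
  this is the set to which \<open>smooth_coinduct\<close> applies.\<close>

inductive_set smooth_products :: "(real^'d::finite \<Rightarrow> complex) set" where
  mult: "smooth \<phi> \<Longrightarrow> smooth \<psi> \<Longrightarrow> (\<lambda>x. \<phi> x * \<psi> x) \<in> smooth_products"
| add: "\<phi> \<in> smooth_products \<Longrightarrow> \<psi> \<in> smooth_products \<Longrightarrow> (\<lambda>x. \<phi> x + \<psi> x) \<in> smooth_products"

lemma smooth_products_smooth: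
  assumes "\<phi> \<in> smooth_products"
  shows "smooth \<phi>"
proof (rule smooth_coinduct[OF assms])
  fix \<phi> :: "real^'d \<Rightarrow> complex" assume "\<phi> \<in> smooth_products"
  then show "continuous_on UNIV \<phi>"
    by induction (auto intro: continuous_on_mult continuous_on_add smooth_continuous_on)
next
  fix \<phi> :: "real^'d \<Rightarrow> complex" and i assume "\<phi> \<in> smooth_products"
  then show "\<exists>\<psi>\<in>smooth_products. \<forall>x. ((\<lambda>t. \<phi> (x + t *\<^sub>R axis i 1)) has_vector_derivative \<psi> x) (at 0)"
  proof induction
    case (mult \<phi> \<psi>)
    have "((\<lambda>t. \<phi> (x + t *\<^sub>R axis i 1) * \<psi> (x + t *\<^sub>R axis i 1)) has_vector_derivative
      pdiff i \<phi> x * \<psi> x + \<phi> x * pdiff i \<psi> x) (at 0)" for x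
      using has_vector_derivative_mult[OF smooth_has_vector_derivative_0[OF mult(1), of x i]
        smooth_has_vector_derivative_0[OF mult(2), of x i]] by (simp add: add.commute)
    moreover have "(\<lambda>x. pdiff i \<phi> x * \<psi> x + \<phi> x * pdiff i \<psi> x) \<in> smooth_products"
      by (intro smooth_products.intros mult smooth_pdiff)
    ultimately show ?case by (intro bexI) auto
  next
    case (add \<phi> \<psi>)
    then obtain f g where "f \<in> smooth_products" "g \<in> smooth_products"
      "\<And>x. ((\<lambda>t. \<phi> (x + t *\<^sub>R axis i 1)) has_vector_derivative f x) (at 0)"
      "\<And>x. ((\<lambda>t. \<psi> (x + t *\<^sub>R axis i 1)) has_vector_derivative g x) (at 0)" by auto
    then show ?case
      by (intro bexI[of _ "\<lambda>x. f x + g x"]) (auto intro: smooth_products.intros has_vector_derivative_add)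
  qed
qed

lemma smooth_mult: "smooth \<phi> \<Longrightarrow> smooth \<psi> \<Longrightarrow> smooth (\<lambda>x. \<phi> x * \<psi> x)"
  by (rule smooth_products_smooth[OF smooth_products.mult])

section \<open>Complex linear forms, exponentials and truncated exponentials as test
  functions\<close>

definition lin :: "complex^'d::finite \<Rightarrow> real^'d \<Rightarrow> complex" where
  "lin k x = (\<Sum>i\<in>UNIV. (k $ i) * complex_of_real (x $ i))"

lemma lin_add: "lin (k + l) x = lin k x + lin l x"
  by (simp add: lin_def algebra_simps sum.distrib)

lemma lin_smult: "lin (c *s k) x = c * lin k x"
  by (simp add: lin_def algebra_simps sum_distrib_left)

lemma lin_zero [simp]: "lin 0 x = 0"
  by (simp add: lin_def)

lemma lin_add_right: "lin k (x + y) = lin k x + lin k y"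
  by (simp add: lin_def algebra_simps sum.distrib)

lemma lin_axis_right: "lin k (t *\<^sub>R axis i 1) = of_real t * k $ i"
proof -
  have "lin k (t *\<^sub>R axis i 1) = (\<Sum>j\<in>UNIV. if j = i then of_real t * k $ i else 0)"
    unfolding lin_def by (intro sum.cong) (auto simp: axis_def)
  then show ?thesis by simp
qed

lemma lin_axis: "lin (axis i c) x = c * complex_of_real (x $ i)"
proof -
  have "lin (axis i c) x = (\<Sum>j\<in>UNIV. if j = i then c * complex_of_real (x $ i) else 0)"
    unfolding lin_def by (intro sum.cong) (auto simp: axis_def)
  then show ?thesis by simp
qed

lemma continuous_on_lin [continuous_intros]: "continuous_on S (lin k)"
  unfolding lin_def by (intro continuous_intros)

lemma has_vector_derivative_lin:
  assumes "(u has_field_derivative u') (at (lin k x))"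
  shows "((\<lambda>t. u (lin k (x + t *\<^sub>R axis i 1))) has_vector_derivative k $ i * u') (at 0)"
proof -
  have "((\<lambda>t. lin k x + of_real t * k $ i) has_vector_derivative k $ i) (at 0)"
    by (auto intro!: derivative_eq_intros simp: has_real_derivative_iff_has_vector_derivative[symmetric])
  then have "(u \<circ> (\<lambda>t. lin k x + of_real t * k $ i) has_vector_derivative k $ i * u') (at 0)"
    using assms by (intro field_vector_diff_chain_at) auto
  then show ?thesis
    by (simp add: o_def lin_add_right lin_axis_right)
qed

text \<open>Each partial derivative brings out one factor \<open>k $ i\<close> and moves one step
  along the sequence \<open>u\<close> of complex derivatives. This treats \<open>E\<close>,
  \<open>exp_upto\<close> and \<open>lin\<close> at once.\<close>

lemma profile_smooth_pdiffs:
  assumes "\<And>n z. (u n has_field_derivative u (Suc n) z) (at z)"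
  shows smooth_profile: "smooth (\<lambda>x. u 0 (lin k x))"
    and pdiffs_profile: "pdiffs is (\<lambda>x. u 0 (lin k x)) =
      (\<lambda>x. prod_list (map (($) k) is) * u (length is) (lin k x))"
proof -
  have cont: "continuous_on UNIV (u n)" for n
    using assms by (meson DERIV_continuous continuous_at_imp_continuous_on)
  have eq: "pdiffs is (\<lambda>x. u 0 (lin k x)) =
      (\<lambda>x. prod_list (map (($) k) is) * u (length is) (lin k x))" for "is"
  proof (induction "is")
    case (Cons i "is")
    have "pdiff i (\<lambda>x. prod_list (map (($) k) is) * u (length is) (lin k x)) =
      (\<lambda>x. prod_list (map (($) k) is) * (k $ i * u (Suc (length is)) (lin k x)))"
      by (intro pdiff_eqI has_vector_derivative_mult_right has_vector_derivative_lin assms)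
    then show ?case by (simp only: pdiffs.simps Cons.IH) (simp add: mult_ac)
  qed simp
  then show "pdiffs is (\<lambda>x. u 0 (lin k x)) =
      (\<lambda>x. prod_list (map (($) k) is) * u (length is) (lin k x))" .
  show "smooth (\<lambda>x. u 0 (lin k x))"
    unfolding smooth_def eq
  proof (intro allI conjI)
    fix "is" i and x :: "real^'a"
    show "continuous_on UNIV (\<lambda>x. prod_list (map (($) k) is) * u (length is) (lin k x))"
      by (intro continuous_intros continuous_on_compose2[OF cont]) auto
    show "((\<lambda>t. prod_list (map (($) k) is) * u (length is) (lin k (x + t *\<^sub>R axis i 1)))
      has_vector_derivative prod_list (map (($) k) (i # is)) * u (length (i # is)) (lin k x)) (at 0)"
      using has_vector_derivative_mult_right[OF has_vector_derivative_lin[OF assms[of "length is"], of k x i], of "prod_list (map (($) k) is)"]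
      by (simp add: mult_ac)
  qed
qed

lemma smooth_const: "smooth (\<lambda>x. c)"
  by (rule smooth_coinduct[where \<S> = "range (\<lambda>c x. c)"]) (auto intro!: derivative_eq_intros)

lemma pdiff_const: "pdiff i (\<lambda>x. c) = (\<lambda>x. 0)"
  by (intro pdiff_eqI) (auto intro!: derivative_eq_intros)

lemma smooth_add:
  assumes "smooth \<phi>" "smooth \<psi>" shows "smooth (\<lambda>x. \<phi> x + \<psi> x)"
  using smooth_products_smooth[OF smooth_products.add[OF smooth_products.mult smooth_products.mult, OF assms(1) smooth_const[of 1] assms(2) smooth_const[of 1]]]
  by simp

lemma smooth_cmult: "smooth \<phi> \<Longrightarrow> smooth (\<lambda>x. c * \<phi> x)"
  by (intro smooth_mult smooth_const)

lemma smooth_diff: "smooth \<phi> \<Longrightarrow> smooth \<psi> \<Longrightarrow> smooth (\<lambda>x. \<phi> x - \<psi> x)"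
  using smooth_add[of \<phi> "\<lambda>x. -1 * \<psi> x"] smooth_cmult[of \<psi> "-1"] by simp

lemma smooth_sum: "(\<And>j. j \<in> J \<Longrightarrow> smooth (\<phi> j)) \<Longrightarrow> smooth (\<lambda>x. \<Sum>j\<in>J. \<phi> j x)"
  by (induction J rule: infinite_finite_induct) (auto intro: smooth_const smooth_add)

lemma smooth_prod: "(\<And>j. j \<in> J \<Longrightarrow> smooth (\<phi> j)) \<Longrightarrow> smooth (\<lambda>x. \<Prod>j\<in>J. \<phi> j x)"
  by (induction J rule: infinite_finite_induct) (auto intro: smooth_const smooth_mult)

lemma smooth_power: "smooth \<phi> \<Longrightarrow> smooth (\<lambda>x. \<phi> x ^ n)"
  by (induction n) (auto intro: smooth_const smooth_mult)

lemma pdiffs_add: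
  assumes "smooth \<phi>" "smooth \<psi>"
  shows "pdiffs is (\<lambda>x. \<phi> x + \<psi> x) = (\<lambda>x. pdiffs is \<phi> x + pdiffs is \<psi> x)"
  by (induction "is") (simp_all add: pdiff_add smooth_pdiffs assms)

lemma pdiff_cmult:
  assumes "smooth \<phi>" shows "pdiff i (\<lambda>x. c * \<phi> x) = (\<lambda>x. c * pdiff i \<phi> x)"
  using pdiff_mult[OF smooth_const[of c] assms] by (simp add: pdiff_const)

lemma pdiffs_cmult:
  assumes "smooth \<phi>" shows "pdiffs is (\<lambda>x. c * \<phi> x) = (\<lambda>x. c * pdiffs is \<phi> x)"
  by (induction "is") (simp_all add: pdiff_cmult smooth_pdiffs assms)

lemma pdiffs_diff:
  assumes "smooth \<phi>" "smooth \<psi>"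
  shows "pdiffs is (\<lambda>x. \<phi> x - \<psi> x) = (\<lambda>x. pdiffs is \<phi> x - pdiffs is \<psi> x)"
  using pdiffs_add[OF assms(1) smooth_cmult[OF assms(2), of "-1"], of "is"] pdiffs_cmult[OF assms(2), of "is" "-1"]
  by simp

lemma smooth_cnj_pdiff:
  assumes "smooth \<phi>"
  shows smooth_cnj: "smooth (\<lambda>x. cnj (\<phi> x))"
    and pdiff_cnj: "pdiff i (\<lambda>x. cnj (\<phi> x)) = (\<lambda>x. cnj (pdiff i \<phi> x))"
proof -
  have d: "((\<lambda>t. cnj (\<phi> (x + t *\<^sub>R axis i 1))) has_vector_derivative cnj (pdiff i \<phi> x)) (at 0)"
    if "smooth \<phi>" for \<phi> :: "real^'a \<Rightarrow> complex" and x i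
    using smooth_has_vector_derivative_0[OF that]
    by (rule bounded_linear.has_vector_derivative[OF bounded_linear_cnj])
  show "pdiff i (\<lambda>x. cnj (\<phi> x)) = (\<lambda>x. cnj (pdiff i \<phi> x))"
    by (intro pdiff_eqI d assms)
  show "smooth (\<lambda>x. cnj (\<phi> x))"
  proof (rule smooth_coinduct[where \<S> = "(\<lambda>\<phi> x. cnj (\<phi> x)) ` {\<phi>. smooth \<phi>}"])
    fix \<psi> :: "real^'a \<Rightarrow> complex" and i assume "\<psi> \<in> (\<lambda>\<phi> x. cnj (\<phi> x)) ` {\<phi>. smooth \<phi>}"
    then obtain \<phi> where "smooth \<phi>" "\<psi> = (\<lambda>x. cnj (\<phi> x))" by auto
    then show "\<exists>\<psi>'\<in>(\<lambda>\<phi> x. cnj (\<phi> x)) ` {\<phi>. smooth \<phi>}.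
        \<forall>x. ((\<lambda>t. \<psi> (x + t *\<^sub>R axis i 1)) has_vector_derivative \<psi>' x) (at 0)"
      using d by (intro bexI[of _ "\<lambda>x. cnj (pdiff i \<phi> x)"] imageI) (auto intro: smooth_pdiff)
  qed (use assms in \<open>auto intro: continuous_on_cnj smooth_continuous_on\<close>)
qed

text \<open>Truncated exponentials are polynomials, hence accessible to the harmonic matrix, while
  \<open>E k\<close> is not. Summing over \<open>j < n\<close> makes differentiation lower
  \<open>n\<close> by one, also at \<open>n = 0\<close> with truncated subtraction.\<close>

definition exp_upto :: "nat \<Rightarrow> complex \<Rightarrow> complex" where
  "exp_upto n z = (\<Sum>j<n. z ^ j / fact j)"

lemma has_field_derivative_exp_upto:
  "(exp_upto n has_field_derivative exp_upto (n - 1) z) (at z)"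
proof (cases n)
  case 0 then show ?thesis by (simp add: exp_upto_def[abs_def])
next
  case (Suc m)
  have "(exp_upto (Suc m) has_field_derivative exp_upto m z) (at z)"
  proof (induction m)
    case 0 then show ?case by (simp add: exp_upto_def[abs_def])
  next
    case (Suc m)
    have *: "exp_upto (Suc (Suc m)) = (\<lambda>z. exp_upto (Suc m) z + z ^ Suc m / fact (Suc m))"
      by (simp add: exp_upto_def[abs_def])
    have "((\<lambda>z::complex. z ^ Suc m / fact (Suc m)) has_field_derivative (of_nat (Suc m) * z ^ m) / fact (Suc m)) (at z)"
      by (rule DERIV_cong[OF DERIV_cdivide[OF DERIV_power_Suc[OF DERIV_ident]]]) simp
    also have "(of_nat (Suc m) * z ^ m) / fact (Suc m) = z ^ m / fact m"
      by (metis fact_Suc mult_divide_mult_cancel_left of_nat_eq_0_iff old.nat.distinct(1))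
    finally show ?case
      unfolding * using DERIV_add[OF Suc] by (simp add: exp_upto_def)
  qed
  then show ?thesis using Suc by simp
qed

definition E :: "complex^'d::finite \<Rightarrow> real^'d \<Rightarrow> complex" where
  "E k x = exp (lin k x)"

lemma smooth_E: "smooth (E k)"
  and pdiffs_E: "pdiffs is (E k) = (\<lambda>x. prod_list (map (($) k) is) * E k x)"
  using smooth_profile[of "\<lambda>_. exp" k] pdiffs_profile[of "\<lambda>_. exp" "is" k]
  by (auto simp: E_def[abs_def])

lemma E_add: "E (k + l) x = E k x * E l x"
  by (simp add: E_def lin_add exp_add)

lemma E_zero [simp]: "E 0 x = 1"
  by (simp add: E_def)

lemma smooth_exp_upto: "smooth (\<lambda>x. exp_upto n (lin k x))"
  and pdiffs_exp_upto: "pdiffs is (\<lambda>x. exp_upto n (lin k x)) =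
    (\<lambda>x. prod_list (map (($) k) is) * exp_upto (n - length is) (lin k x))"
  using smooth_profile[of "\<lambda>j. exp_upto (n - j)" k] pdiffs_profile[of "\<lambda>j. exp_upto (n - j)" "is" k]
    has_field_derivative_exp_upto[of "n - _"] by auto

lemma smooth_lin: "smooth (lin k)"
  and pdiff_lin: "pdiff i (lin k) = (\<lambda>x. k $ i)"
proof -
  define u :: "nat \<Rightarrow> complex \<Rightarrow> complex" where "u n = (if n = 0 then id else if n = 1 then (\<lambda>_. 1) else (\<lambda>_. 0))" for n
  have "(u n has_field_derivative u (Suc n) z) (at z)" for n z
    by (auto simp: u_def id_def intro!: derivative_eq_intros)
  from smooth_profile[of u k, OF this] pdiffs_profile[of u "[i]" k, OF this]
  show "smooth (lin k)" "pdiff i (lin k) = (\<lambda>x. k $ i)" by (auto simp: u_def)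
qed

section \<open>Commuting partial derivatives and flat functions\<close>

text \<open>The mean value inequality for \<open>f\<close> minus the linear function of slope
  \<open>c\<close>.\<close>

lemma vector_mean_value_bound:
  fixes f :: "real \<Rightarrow> 'a::real_normed_vector"
  assumes "\<And>t. t \<in> closed_segment a b \<Longrightarrow> (f has_vector_derivative f' t) (at t)"
    and "\<And>t. t \<in> closed_segment a b \<Longrightarrow> norm (f' t - c) \<le> e"
  shows "norm (f b - f a - (b - a) *\<^sub>R c) \<le> e * \<bar>b - a\<bar>"
proof -
  have "norm ((f b - b *\<^sub>R c) - (f a - a *\<^sub>R c)) \<le> e * norm (b - a)"
  proof (rule differentiable_bound[where S = "closed_segment a b" and f' = "\<lambda>t h. h *\<^sub>R (f' t - c)"])
    fix t assume t: "t \<in> closed_segment a b"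
    have "((\<lambda>t. f t - t *\<^sub>R c) has_vector_derivative (f' t - c)) (at t)"
      using assms(1)[OF t] by (auto intro!: derivative_eq_intros)
    then show "((\<lambda>t. f t - t *\<^sub>R c) has_derivative (\<lambda>h. h *\<^sub>R (f' t - c))) (at t within closed_segment a b)"
      unfolding has_vector_derivative_def by (rule has_derivative_at_withinI)
    show "onorm (\<lambda>h. h *\<^sub>R (f' t - c)) \<le> e"
    proof (rule onorm_le)
      show "norm (h *\<^sub>R (f' t - c)) \<le> e * norm h" for h
        using mult_right_mono[OF assms(2)[OF t], of "\<bar>h\<bar>"] by (simp add: mult_ac)
    qed
  qed auto
  then show ?thesis by (simp add: algebra_simps)
qed

text \<open>Two mean value estimates: the outer one in direction \<open>j\<close> for the increment
  of \<open>\<phi>\<close> in direction \<open>i\<close>, the inner one in direction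
  \<open>i\<close> for \<open>pdiff j \<phi>\<close>. Continuity makes the mixed derivative constant
  up to \<open>e\<close> near \<open>x\<close>.\<close>

lemma double_difference_bound:
  fixes \<phi> :: "real^'d::finite \<Rightarrow> complex"
  assumes \<phi>: "smooth \<phi>" and "0 < e"
  shows "\<exists>d>0. \<forall>s. 0 < s \<longrightarrow> s < d \<longrightarrow>
    norm (\<phi> (x + s *\<^sub>R axis i 1 + s *\<^sub>R axis j 1) - \<phi> (x + s *\<^sub>R axis i 1) - \<phi> (x + s *\<^sub>R axis j 1) + \<phi> x
      - (s * s) *\<^sub>R pdiff i (pdiff j \<phi>) x) \<le> e * s * s"
proof -
  let ?a = "axis i 1 :: real^'d" and ?b = "axis j 1 :: real^'d"
  let ?\<psi> = "pdiff i (pdiff j \<phi>)"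
  have "continuous_on UNIV ?\<psi>"
    by (intro smooth_continuous_on smooth_pdiff \<phi>)
  then obtain d where d: "d > 0" "\<And>y. dist y x < d \<Longrightarrow> dist (?\<psi> y) (?\<psi> x) < e"
    using \<open>0 < e\<close> unfolding continuous_on_iff by (metis UNIV_I)
  have near: "norm (?\<psi> (x + v *\<^sub>R ?b + u *\<^sub>R ?a) - ?\<psi> x) \<le> e"
    if "0 \<le> u" "u \<le> s" "0 \<le> v" "v \<le> s" "s < d/2" for u v s
  proof -
    have "norm (v *\<^sub>R ?b + u *\<^sub>R ?a) \<le> norm (v *\<^sub>R ?b) + norm (u *\<^sub>R ?a)"
      by (rule norm_triangle_ineq)
    also have "\<dots> < d" using that by simp
    finally have "dist (x + v *\<^sub>R ?b + u *\<^sub>R ?a) x < d" by (simp add: dist_norm algebra_simps)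
    from d(2)[OF this] show ?thesis by (simp add: dist_norm)
  qed
  have "norm (\<phi> (x + s *\<^sub>R ?a + s *\<^sub>R ?b) - \<phi> (x + s *\<^sub>R ?a) - \<phi> (x + s *\<^sub>R ?b) + \<phi> x
      - (s * s) *\<^sub>R ?\<psi> x) \<le> e * s * s" if s: "0 < s" "s < d/2" for s
  proof -
    have inner: "norm (pdiff j \<phi> (x + s *\<^sub>R ?a + v *\<^sub>R ?b) - pdiff j \<phi> (x + v *\<^sub>R ?b) - s *\<^sub>R ?\<psi> x) \<le> e * s"
      if v: "v \<in> closed_segment 0 s" for v
    proof -
      have v: "0 \<le> v" "v \<le> s" using v s by (auto simp: closed_segment_eq_real_ivl)
      have "norm (pdiff j \<phi> (x + v *\<^sub>R ?b + s *\<^sub>R ?a) - pdiff j \<phi> (x + v *\<^sub>R ?b + 0 *\<^sub>R ?a) - (s - 0) *\<^sub>R ?\<psi> x) \<le> e * \<bar>s - 0\<bar>"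
        by (rule vector_mean_value_bound[where f' = "\<lambda>u. ?\<psi> (x + v *\<^sub>R ?b + u *\<^sub>R ?a)"])
          (use s v near[of _ s v] in \<open>auto intro: smooth_has_vector_derivative smooth_pdiff \<phi> simp: closed_segment_eq_real_ivl\<close>)
      then show ?thesis using s by (simp add: algebra_simps)
    qed
    have "norm ((\<phi> (x + s *\<^sub>R ?a + s *\<^sub>R ?b) - \<phi> (x + s *\<^sub>R ?b)) - (\<phi> (x + s *\<^sub>R ?a + 0 *\<^sub>R ?b) - \<phi> (x + 0 *\<^sub>R ?b))
        - (s - 0) *\<^sub>R (s *\<^sub>R ?\<psi> x)) \<le> (e * s) * \<bar>s - 0\<bar>"
    proof (rule vector_mean_value_bound[where f = "\<lambda>v. \<phi> (x + s *\<^sub>R ?a + v *\<^sub>R ?b) - \<phi> (x + v *\<^sub>R ?b)"])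
      show "((\<lambda>v. \<phi> (x + s *\<^sub>R ?a + v *\<^sub>R ?b) - \<phi> (x + v *\<^sub>R ?b)) has_vector_derivative
          pdiff j \<phi> (x + s *\<^sub>R ?a + t *\<^sub>R ?b) - pdiff j \<phi> (x + t *\<^sub>R ?b)) (at t)" for t
        by (rule has_vector_derivative_diff; rule smooth_has_vector_derivative[OF \<phi>])
    qed (rule inner)
    then show ?thesis using s by (simp add: algebra_simps)
  qed
  then show ?thesis using d(1) by (intro exI[of _ "d/2"]) auto
qed

text \<open>The second difference is symmetric in \<open>i\<close> and \<open>j\<close>, and both
  mixed derivatives are its limit after division by \<open>s * s\<close>.\<close>

lemma pdiff_commute:
  assumes "smooth \<phi>"
  shows "pdiff i (pdiff j \<phi>) = pdiff j (pdiff i \<phi>)"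
proof
  fix x
  let ?A = "pdiff i (pdiff j \<phi>) x" and ?B = "pdiff j (pdiff i \<phi>) x"
  have "norm (?A - ?B) \<le> e" if "e > 0" for e
  proof -
    have e: "e/2 > 0" using that by simp
    from double_difference_bound[OF assms this, of x i j] double_difference_bound[OF assms e, of x j i]
    obtain d1 d2 where d: "d1 > 0" "d2 > 0" and
      1: "\<And>s. 0 < s \<Longrightarrow> s < d1 \<Longrightarrow> norm (\<phi> (x + s *\<^sub>R axis i 1 + s *\<^sub>R axis j 1) - \<phi> (x + s *\<^sub>R axis i 1) - \<phi> (x + s *\<^sub>R axis j 1) + \<phi> x - (s * s) *\<^sub>R ?A) \<le> e/2 * s * s" and
      2: "\<And>s. 0 < s \<Longrightarrow> s < d2 \<Longrightarrow> norm (\<phi> (x + s *\<^sub>R axis j 1 + s *\<^sub>R axis i 1) - \<phi> (x + s *\<^sub>R axis j 1) - \<phi> (x + s *\<^sub>R axis i 1) + \<phi> x - (s * s) *\<^sub>R ?B) \<le> e/2 * s * s"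
      by blast
    define s where "s = min d1 d2 / 2"
    define \<Delta> where "\<Delta> = \<phi> (x + s *\<^sub>R axis i 1 + s *\<^sub>R axis j 1) - \<phi> (x + s *\<^sub>R axis i 1) - \<phi> (x + s *\<^sub>R axis j 1) + \<phi> x"
    have s: "0 < s" "s < d1" "s < d2" using d by (auto simp: s_def)
    have "norm (\<Delta> - (s * s) *\<^sub>R ?A) \<le> e/2 * s * s"
      using 1[of s] s by (simp add: \<Delta>_def)
    moreover have "norm (\<Delta> - (s * s) *\<^sub>R ?B) \<le> e/2 * s * s"
      using 2[of s] s by (simp add: \<Delta>_def algebra_simps)
    moreover have "(s * s) *\<^sub>R (?A - ?B) = (\<Delta> - (s * s) *\<^sub>R ?B) - (\<Delta> - (s * s) *\<^sub>R ?A)"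
      by (simp add: algebra_simps)
    ultimately have "norm ((s * s) *\<^sub>R (?A - ?B)) \<le> e/2 * s * s + e/2 * s * s"
      by (metis add_mono norm_triangle_le_diff)
    moreover have "norm ((s * s) *\<^sub>R (?A - ?B)) = (s * s) * norm (?A - ?B)"
      by (simp only: norm_scaleR) simp
    ultimately have "(s * s) * norm (?A - ?B) \<le> (s * s) * e" by (simp add: algebra_simps)
    then show ?thesis using s by simp
  qed
  then have "norm (?A - ?B) \<le> 0" by (rule field_le_epsilon) simp
  then show "?A = ?B" by simp
qed

lemma pdiffs_pdiff:
  assumes "smooth \<phi>"
  shows "pdiffs is (pdiff i \<phi>) = pdiff i (pdiffs is \<phi>)"
  by (induction "is") (simp_all add: pdiff_commute smooth_pdiffs assms)

lemma pdiffs_cong_mset: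
  assumes "smooth \<phi>" "mset xs = mset ys"
  shows "pdiffs xs \<phi> = pdiffs ys \<phi>"
  using assms(2)
proof (induction xs arbitrary: ys)
  case (Cons i xs)
  then obtain ys1 ys2 where ys: "ys = ys1 @ i # ys2"
    by (metis list.set_intros(1) set_mset_mset split_list)
  then have "pdiffs xs \<phi> = pdiffs (ys1 @ ys2) \<phi>"
    using Cons by auto
  then show ?case
    by (simp add: ys pdiffs_append pdiffs_pdiff[symmetric] smooth_pdiffs assms(1))
qed simp

section \<open>Functions vanishing to order \<open>M\<close> at a point\<close>

definition flat :: "nat \<Rightarrow> real^'d::finite \<Rightarrow> (real^'d \<Rightarrow> complex) \<Rightarrow> bool" where
  "flat M y \<phi> \<longleftrightarrow> (\<forall>is. length is < M \<longrightarrow> pdiffs is \<phi> y = 0)"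

lemma flat_0 [simp]: "flat 0 y \<phi>"
  by (simp add: flat_def)

lemma flat_Suc: "flat (Suc M) y \<phi> \<longleftrightarrow> \<phi> y = 0 \<and> (\<forall>i. flat M y (pdiff i \<phi>))"
proof safe
  assume f: "flat (Suc M) y \<phi>"
  show "\<phi> y = 0" using f[unfolded flat_def, rule_format, of "[]"] by simp
  show "flat M y (pdiff i \<phi>)" for i
    unfolding flat_def using f[unfolded flat_def, rule_format, of "_ @ [i]"] by (simp add: pdiffs_append)
next
  assume *: "\<phi> y = 0" "\<forall>i. flat M y (pdiff i \<phi>)"
  show "flat (Suc M) y \<phi>"
    unfolding flat_def
  proof (intro allI impI)
    fix "is" :: "'a list" assume "length is < Suc M"
    then show "pdiffs is \<phi> y = 0"
      using * by (cases "is" rule: rev_cases) (auto simp: pdiffs_append flat_def)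
  qed
qed

lemma flat_mono: "flat M y \<phi> \<Longrightarrow> N \<le> M \<Longrightarrow> flat N y \<phi>"
  by (auto simp: flat_def)

lemma flat_add: "smooth \<phi> \<Longrightarrow> smooth \<psi> \<Longrightarrow> flat M y \<phi> \<Longrightarrow> flat M y \<psi> \<Longrightarrow> flat M y (\<lambda>x. \<phi> x + \<psi> x)"
  by (auto simp: flat_def pdiffs_add)

lemma flat_mult:
  "smooth \<phi> \<Longrightarrow> smooth \<psi> \<Longrightarrow> flat M y \<phi> \<Longrightarrow> flat M y (\<lambda>x. \<phi> x * \<psi> x)"
proof (induction M arbitrary: \<phi> \<psi>)
  case (Suc M)
  have "flat M y (pdiff i (\<lambda>x. \<phi> x * \<psi> x))" for i
    unfolding pdiff_mult[OF Suc.prems(1,2)]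
    using Suc.prems flat_mono[OF Suc.prems(3), of M]
    by (intro flat_add smooth_mult smooth_pdiff Suc.IH) (auto simp: flat_Suc)
  then show ?case using Suc.prems by (simp add: flat_Suc)
qed simp

lemma flat_mult2:
  "smooth \<phi> \<Longrightarrow> smooth \<psi> \<Longrightarrow> flat M y \<psi> \<Longrightarrow> flat M y (\<lambda>x. \<phi> x * \<psi> x)"
  using flat_mult[of \<psi> \<phi> M y] by (simp add: mult.commute)

lemma flat_cnj: "smooth \<phi> \<Longrightarrow> flat M y \<phi> \<Longrightarrow> flat M y (\<lambda>x. cnj (\<phi> x))"
proof (induction M arbitrary: \<phi>)
  case (Suc M)
  then show ?case by (simp add: flat_Suc pdiff_cnj smooth_pdiff)
qed simp

text \<open>A factor vanishing at \<open>y\<close> raises the order by one: in the product rule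
  either \<open>\<psi>\<close> keeps its full order, or \<open>\<phi>\<close> survives and the
  induction hypothesis applies to \<open>pdiff i \<psi>\<close>.\<close>

lemma flat_Suc_mult:
  "smooth \<phi> \<Longrightarrow> smooth \<psi> \<Longrightarrow> \<phi> y = 0 \<Longrightarrow> flat M y \<psi> \<Longrightarrow> flat (Suc M) y (\<lambda>x. \<phi> x * \<psi> x)"
proof (induction M arbitrary: \<psi>)
  case 0
  then show ?case by (simp add: flat_Suc)
next
  case (Suc M)
  have "flat (Suc M) y (pdiff i (\<lambda>x. \<phi> x * \<psi> x))" for i
    unfolding pdiff_mult[OF Suc.prems(1,2)]
  proof (intro flat_add smooth_mult smooth_pdiff)
    show "flat (Suc M) y (\<lambda>x. pdiff i \<phi> x * \<psi> x)"
      using Suc.prems by (intro flat_mult2 smooth_pdiff)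
    show "flat (Suc M) y (\<lambda>x. \<phi> x * pdiff i \<psi> x)"
      using Suc.prems by (intro Suc.IH smooth_pdiff) (auto simp: flat_Suc)
  qed (use Suc.prems in auto)
  then show ?case using Suc.prems by (subst flat_Suc) auto
qed

lemma flat_power:
  assumes "smooth \<phi>" "\<phi> y = 0"
  shows "flat M y (\<lambda>x. \<phi> x ^ M)"
proof (induction M)
  case (Suc M)
  then show ?case using assms by (simp add: flat_Suc_mult smooth_power)
qed simp

text \<open>The path from \<open>y\<close> to \<open>x\<close> changes one coordinate at a time,
  since smoothness is given by partial derivatives. It stays in the box around \<open>y\<close>
  whose half-widths are the coordinate distances to \<open>x\<close>; hence the range of
  \<open>w\<close> in the hypothesis.\<close>

lemma dist_le_of_partials:
  fixes \<psi> :: "real^'d::finite \<Rightarrow> complex"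
  assumes \<psi>: "smooth \<psi>"
    and B: "\<And>w i. (\<And>j. \<bar>w $ j - y $ j\<bar> \<le> \<bar>x $ j - y $ j\<bar>) \<Longrightarrow> norm (pdiff i \<psi> w) \<le> B"
  shows "norm (\<psi> x - \<psi> y) \<le> B * (\<Sum>j\<in>UNIV. \<bar>x $ j - y $ j\<bar>)"
proof -
  define p where "p J = (\<chi> j. if j \<in> J then x $ j else y $ j)" for J
  have "norm (\<psi> (p J) - \<psi> y) \<le> B * (\<Sum>j\<in>J. \<bar>x $ j - y $ j\<bar>)" for J :: "'d set"
    using finite[of J]
  proof (induction J rule: finite_induct)
    case empty
    have "p {} = y" by (simp add: p_def vec_eq_iff)
    then show ?case by simp
  next
    case (insert i J)
    define s where "s = x $ i - y $ i"
    have p: "p (insert i J) = p J + s *\<^sub>R axis i 1"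
      using insert.hyps by (auto simp: p_def s_def Finite_Cartesian_Product.vec_eq_iff axis_def)
    have "norm (\<psi> (p J + s *\<^sub>R axis i 1) - \<psi> (p J + 0 *\<^sub>R axis i 1) - (s - 0) *\<^sub>R 0) \<le> B * \<bar>s - 0\<bar>"
    proof (rule vector_mean_value_bound[where f' = "\<lambda>t. pdiff i \<psi> (p J + t *\<^sub>R axis i 1)"])
      fix t assume "t \<in> closed_segment 0 s"
      then have "\<bar>t\<bar> \<le> \<bar>s\<bar>" by (auto simp: closed_segment_eq_real_ivl split: if_splits)
      then show "norm (pdiff i \<psi> (p J + t *\<^sub>R axis i 1) - 0) \<le> B"
        using insert.hyps by simp (rule B, auto simp: p_def s_def axis_def)
    qed (intro smooth_has_vector_derivative \<psi>)
    then have "norm (\<psi> (p (insert i J)) - \<psi> (p J)) \<le> B * \<bar>s\<bar>" by (simp add: p)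
    then have "norm (\<psi> (p (insert i J)) - \<psi> y) \<le> B * \<bar>s\<bar> + B * (\<Sum>j\<in>J. \<bar>x $ j - y $ j\<bar>)"
      using insert.IH norm_triangle_ineq[of "\<psi> (p (insert i J)) - \<psi> (p J)" "\<psi> (p J) - \<psi> y"] by simp
    then show ?case using insert.hyps by (simp add: s_def algebra_simps)
  qed
  from this[of UNIV] show ?thesis by (simp add: p_def)
qed

text \<open>A Taylor estimate by induction: a bound of order \<open>M\<close> on the partial
  derivatives integrates to one of order \<open>Suc M\<close>. The sum of coordinate distances fits
  the coordinatewise mean value step.\<close>

lemma flat_bound:
  fixes \<psi> :: "real^'d::finite \<Rightarrow> complex"
  assumes "smooth \<psi>" "flat M y \<psi>"
  shows "\<exists>C\<ge>0. \<forall>x. (\<forall>j. \<bar>x $ j - y $ j\<bar> \<le> 1) \<longrightarrow> norm (\<psi> x) \<le> C * (\<Sum>j\<in>UNIV. \<bar>x $ j - y $ j\<bar>) ^ M"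
  using assms
proof (induction M arbitrary: \<psi>)
  case 0
  have "compact (\<psi> ` cbox (y - 1) (y + 1))"
    by (intro compact_continuous_image smooth_continuous_on 0 compact_cbox)
  then obtain C where C: "\<And>x. x \<in> cbox (y - 1) (y + 1) \<Longrightarrow> norm (\<psi> x) \<le> C"
    using compact_imp_bounded bounded_iff by (metis imageI)
  have "norm (\<psi> x) \<le> max C 0 * (\<Sum>j\<in>UNIV. \<bar>x $ j - y $ j\<bar>) ^ 0" if "\<forall>j. \<bar>x $ j - y $ j\<bar> \<le> 1" for x
  proof -
    have "x \<in> cbox (y - 1) (y + 1)"
      using that by (auto simp: mem_box_cart abs_le_iff algebra_simps)
    from C[OF this] show ?thesis by simp
  qed
  then show ?case by (intro exI[of _ "max C 0"]) auto
next
  case (Suc M)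
  define \<rho> where "\<rho> x = (\<Sum>j\<in>UNIV. \<bar>x $ j - y $ j\<bar>)" for x
  have "\<exists>C\<ge>0. \<forall>x. (\<forall>j. \<bar>x $ j - y $ j\<bar> \<le> 1) \<longrightarrow> norm (pdiff i \<psi> x) \<le> C * \<rho> x ^ M" for i
    unfolding \<rho>_def using Suc.prems by (intro Suc.IH smooth_pdiff) (auto simp: flat_Suc)
  then obtain C where C: "\<And>i. C i \<ge> 0"
    "\<And>i x. (\<forall>j. \<bar>x $ j - y $ j\<bar> \<le> 1) \<Longrightarrow> norm (pdiff i \<psi> x) \<le> C i * \<rho> x ^ M" by metis
  have "norm (\<psi> x) \<le> (\<Sum>i\<in>UNIV. C i) * \<rho> x ^ Suc M" if x: "\<forall>j. \<bar>x $ j - y $ j\<bar> \<le> 1" for x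
  proof -
    have "norm (\<psi> x - \<psi> y) \<le> ((\<Sum>i\<in>UNIV. C i) * \<rho> x ^ M) * (\<Sum>j\<in>UNIV. \<bar>x $ j - y $ j\<bar>)"
    proof (rule dist_le_of_partials[OF Suc.prems(1)])
      fix w i assume w: "\<And>j. \<bar>w $ j - y $ j\<bar> \<le> \<bar>x $ j - y $ j\<bar>"
      then have "norm (pdiff i \<psi> w) \<le> C i * \<rho> w ^ M"
        using x by (intro C) (meson order_trans)
      also have "\<dots> \<le> (\<Sum>i\<in>UNIV. C i) * \<rho> x ^ M"
        using w C(1) by (intro mult_mono power_mono member_le_sum) (auto simp: \<rho>_def intro!: sum_mono sum_nonneg)
      finally show "norm (pdiff i \<psi> w) \<le> (\<Sum>i\<in>UNIV. C i) * \<rho> x ^ M" .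
    qed
    then show ?thesis using Suc.prems(2) by (simp add: flat_Suc \<rho>_def mult_ac)
  qed
  then show ?case using C(1)
    by (intro exI[of _ "\<Sum>i\<in>UNIV. C i"]) (auto simp: \<rho>_def intro: sum_nonneg)
qed

section \<open>Continuous functionals and density of exponentials\<close>

text \<open>Sequential convergence in the smooth topology over \<open>K\<close>. The resulting
  continuity of functionals survives multiplication by a smooth function with no order or constant
  to track.\<close>

definition Cconv :: "(real^'d::finite) set \<Rightarrow> (nat \<Rightarrow> real^'d \<Rightarrow> complex) \<Rightarrow> (real^'d \<Rightarrow> complex) \<Rightarrow> bool" where
  "Cconv K \<phi>s \<phi> \<longleftrightarrow> (\<forall>k. smooth (\<phi>s k)) \<and> smooth \<phi> \<and>
     (\<forall>is. uniform_limit K (\<lambda>k. pdiffs is (\<phi>s k)) (pdiffs is \<phi>) sequentially)"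

lemma Cconv_smooth:
  assumes "Cconv K \<phi>s \<phi>" shows "smooth (\<phi>s k)" "smooth \<phi>"
  using assms by (auto simp: Cconv_def)

lemma Cconv_pdiff: "Cconv K \<phi>s \<phi> \<Longrightarrow> Cconv K (\<lambda>k. pdiff i (\<phi>s k)) (pdiff i \<phi>)"
  unfolding Cconv_def
proof (intro conjI allI)
  fix "is"
  assume "(\<forall>k. smooth (\<phi>s k)) \<and> smooth \<phi> \<and> (\<forall>is. uniform_limit K (\<lambda>k. pdiffs is (\<phi>s k)) (pdiffs is \<phi>) sequentially)"
  then have "uniform_limit K (\<lambda>k. pdiffs (is @ [i]) (\<phi>s k)) (pdiffs (is @ [i]) \<phi>) sequentially" by blast
  then show "uniform_limit K (\<lambda>k. pdiffs is (pdiff i (\<phi>s k))) (pdiffs is (pdiff i \<phi>)) sequentially"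
    by (simp add: pdiffs_append)
qed (auto intro: smooth_pdiff)

lemma Cconv_uniform_limit:
  "Cconv K \<phi>s \<phi> \<Longrightarrow> uniform_limit K (\<lambda>k. pdiffs is (\<phi>s k)) (pdiffs is \<phi>) sequentially"
  by (simp add: Cconv_def)

lemma Cconv_const: "smooth \<phi> \<Longrightarrow> Cconv K (\<lambda>k. \<phi>) \<phi>"
  by (auto simp: Cconv_def intro: uniform_limit_const)

lemma uniform_limit_pdiffs_mult:
  assumes "compact K" "Cconv K \<phi>s \<phi>" "Cconv K \<psi>s \<psi>"
  shows "uniform_limit K (\<lambda>k. pdiffs is (\<lambda>x. \<phi>s k x * \<psi>s k x)) (pdiffs is (\<lambda>x. \<phi> x * \<psi> x)) sequentially"
  using assms(2,3)
proof (induction "is" arbitrary: \<phi>s \<phi> \<psi>s \<psi> rule: rev_induct)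
  case Nil
  have "uniform_limit K \<phi>s \<phi> sequentially" "uniform_limit K \<psi>s \<psi> sequentially"
    using Nil[THEN Cconv_uniform_limit, of "[]"] by simp_all
  moreover have "bounded (\<phi> ` K)" "bounded (\<psi> ` K)"
    using Nil by (auto intro!: compact_imp_bounded compact_continuous_image smooth_continuous_on assms(1) simp: Cconv_def)
  ultimately show ?case by (simp add: uniform_lim_mult)
next
  case (snoc i "is")
  note s = Cconv_smooth[OF snoc.prems(1)] Cconv_smooth[OF snoc.prems(2)]
  have "uniform_limit K (\<lambda>k x. pdiffs is (\<lambda>x. pdiff i (\<phi>s k) x * \<psi>s k x) x + pdiffs is (\<lambda>x. \<phi>s k x * pdiff i (\<psi>s k) x) x)
     (\<lambda>x. pdiffs is (\<lambda>x. pdiff i \<phi> x * \<psi> x) x + pdiffs is (\<lambda>x. \<phi> x * pdiff i \<psi> x) x) sequentially"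
    by (intro uniform_limit_add snoc.IH Cconv_pdiff snoc.prems)
  then show ?case
    by (simp add: pdiffs_append pdiff_mult pdiffs_add smooth_mult smooth_pdiff s)
qed

lemma Cconv_mult:
  "compact K \<Longrightarrow> Cconv K \<phi>s \<phi> \<Longrightarrow> Cconv K \<psi>s \<psi> \<Longrightarrow> Cconv K (\<lambda>k x. \<phi>s k x * \<psi>s k x) (\<lambda>x. \<phi> x * \<psi> x)"
  unfolding Cconv_def[of _ "\<lambda>k x. \<phi>s k x * \<psi>s k x"]
  by (auto intro: smooth_mult uniform_limit_pdiffs_mult simp: Cconv_smooth)

lemma uniform_limit_exp_upto: "uniform_limit (cball 0 R) exp_upto exp sequentially"
proof -
  have "uniform_limit (cball 0 R) (\<lambda>n z. \<Sum>j<n. z ^ j / fact j) (\<lambda>z. \<Sum>j. z ^ j / fact j :: complex) sequentially"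
  proof (rule Weierstrass_m_test)
    show "norm (z ^ n / fact n) \<le> \<bar>R\<bar> ^ n / fact n" if "z \<in> cball 0 R" for n and z :: complex
      using that by (auto simp: norm_divide norm_power intro!: divide_right_mono power_mono)
    show "summable (\<lambda>n. \<bar>R\<bar> ^ n / fact n)"
      using summable_exp[of "\<bar>R\<bar>"] by (simp add: field_simps)
  qed
  then show ?thesis
    by (simp add: exp_upto_def[abs_def] exp_def scaleR_conv_of_real field_simps)
qed

lemma bounded_lin:
  assumes "compact K" obtains R where "\<And>x. x \<in> K \<Longrightarrow> norm (lin k x) \<le> R"
proof -
  have "compact (lin k ` K)"
    by (intro compact_continuous_image continuous_on_lin assms)
  then show ?thesis
    using that compact_imp_bounded bounded_iff by (metis imageI)
qed

lemma Cconv_exp_upto: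
  assumes "compact K"
  shows "Cconv K (\<lambda>n x. exp_upto n (lin k x)) (E k)"
proof -
  obtain R where R: "\<And>x. x \<in> K \<Longrightarrow> norm (lin k x) \<le> R"
    using bounded_lin[OF assms] by blast
  have lim: "uniform_limit K (\<lambda>n x. exp_upto n (lin k x)) (E k) sequentially"
    unfolding E_def[abs_def]
    by (rule uniform_limit_compose'[OF uniform_limit_exp_upto[of R]]) (use R in auto)
  have "uniform_limit K (\<lambda>n x. exp_upto (n - l) (lin k x)) (E k) sequentially" for l
    using filterlim_compose[OF lim filterlim_minus_const_nat_at_top[of l]] by simp
  then show ?thesis
    unfolding Cconv_def pdiffs_exp_upto pdiffs_E
    by (auto intro: smooth_exp_upto smooth_E bounded_linear.uniform_limit[OF bounded_linear_mult_right])
qed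

definition cont_functional :: "(real^'d::finite) set \<Rightarrow> ((real^'d \<Rightarrow> complex) \<Rightarrow> complex) \<Rightarrow> bool" where
  "cont_functional K F \<longleftrightarrow>
    (\<forall>\<phi> \<psi>. smooth \<phi> \<longrightarrow> smooth \<psi> \<longrightarrow> F (\<lambda>x. \<phi> x + \<psi> x) = F \<phi> + F \<psi>) \<and>
    (\<forall>c \<phi>. smooth \<phi> \<longrightarrow> F (\<lambda>x. c * \<phi> x) = c * F \<phi>) \<and>
    (\<forall>\<phi>s \<phi>. Cconv K \<phi>s \<phi> \<longrightarrow> (\<lambda>k. F (\<phi>s k)) \<longlonglongrightarrow> F \<phi>)"

lemma cont_functional_add:
  "cont_functional K F \<Longrightarrow> smooth \<phi> \<Longrightarrow> smooth \<psi> \<Longrightarrow> F (\<lambda>x. \<phi> x + \<psi> x) = F \<phi> + F \<psi>"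
  and cont_functional_cmult: "cont_functional K F \<Longrightarrow> smooth \<phi> \<Longrightarrow> F (\<lambda>x. c * \<phi> x) = c * F \<phi>"
  and cont_functional_lim: "cont_functional K F \<Longrightarrow> Cconv K \<phi>s \<phi> \<Longrightarrow> (\<lambda>k. F (\<phi>s k)) \<longlonglongrightarrow> F \<phi>"
  by (auto simp: cont_functional_def)

lemma cont_functional_zero: "cont_functional K F \<Longrightarrow> F (\<lambda>x. 0) = 0"
  using cont_functional_cmult[of K F "\<lambda>_. 0" 0] smooth_const[of 0] by simp

lemma cont_functional_sum:
  assumes "cont_functional K F"
  shows "(\<And>j. j \<in> J \<Longrightarrow> smooth (\<phi> j)) \<Longrightarrow> F (\<lambda>x. \<Sum>j\<in>J. c j * \<phi> j x) = (\<Sum>j\<in>J. c j * F (\<phi> j))"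
proof (induction J rule: infinite_finite_induct)
  case (insert i J)
  then show ?case
    using cont_functional_add[OF assms, of "\<lambda>x. c i * \<phi> i x" "\<lambda>x. \<Sum>j\<in>J. c j * \<phi> j x"]
    by (simp add: smooth_cmult smooth_sum cont_functional_cmult[OF assms])
qed (auto simp: cont_functional_zero[OF assms])

lemma cont_functional_mult:
  assumes "compact K" "cont_functional K F" "smooth \<eta>"
  shows "cont_functional K (\<lambda>\<phi>. F (\<lambda>x. \<eta> x * \<phi> x))"
  unfolding cont_functional_def
proof (intro conjI allI impI)
  fix \<phi> \<psi> :: "real^'a \<Rightarrow> complex" assume "smooth \<phi>" "smooth \<psi>"
  then show "F (\<lambda>x. \<eta> x * (\<phi> x + \<psi> x)) = F (\<lambda>x. \<eta> x * \<phi> x) + F (\<lambda>x. \<eta> x * \<psi> x)"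
    using cont_functional_add[OF assms(2), of "\<lambda>x. \<eta> x * \<phi> x" "\<lambda>x. \<eta> x * \<psi> x"] assms(3)
    by (simp add: algebra_simps smooth_mult)
next
  fix c and \<phi> :: "real^'a \<Rightarrow> complex" assume "smooth \<phi>"
  then show "F (\<lambda>x. \<eta> x * (c * \<phi> x)) = c * F (\<lambda>x. \<eta> x * \<phi> x)"
    using cont_functional_cmult[OF assms(2), of "\<lambda>x. \<eta> x * \<phi> x" c] assms(3)
    by (simp add: mult.left_commute smooth_mult)
next
  fix \<phi>s and \<phi> :: "real^'a \<Rightarrow> complex" assume "Cconv K \<phi>s \<phi>"
  then show "(\<lambda>k. F (\<lambda>x. \<eta> x * \<phi>s k x)) \<longlonglongrightarrow> F (\<lambda>x. \<eta> x * \<phi> x)"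
    by (intro cont_functional_lim[OF assms(2)] Cconv_mult assms Cconv_const)
qed

text \<open>The lower bound on the real parts of the exponents keeps \<open>pdiff i\<close> plus
  \<open>c + 1\<close> from annihilating any exponential that occurs. For \<open>c = 0\<close> the
  class is also closed under products, as Stone-Weierstrass demands.\<close>

inductive_set esums :: "real \<Rightarrow> (real^'d::finite \<Rightarrow> complex) set" for c where
  E: "(\<And>i. - c \<le> Re (k $ i)) \<Longrightarrow> (\<lambda>x. a * E k x) \<in> esums c"
| add: "\<phi> \<in> esums c \<Longrightarrow> \<psi> \<in> esums c \<Longrightarrow> (\<lambda>x. \<phi> x + \<psi> x) \<in> esums c"

lemma smooth_esums: "\<phi> \<in> esums c \<Longrightarrow> smooth \<phi>"
  by (induction rule: esums.induct) (auto intro: smooth_add smooth_cmult smooth_E)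

lemma esums_mono: "\<phi> \<in> esums c \<Longrightarrow> c \<le> d \<Longrightarrow> \<phi> \<in> esums d"
proof (induction rule: esums.induct)
  case (E k a)
  then show ?case by (intro esums.E) (meson neg_le_iff_le order_trans)
qed (auto intro: esums.add)

lemma esums_cmult: "\<phi> \<in> esums c \<Longrightarrow> (\<lambda>x. b * \<phi> x) \<in> esums c"
proof (induction rule: esums.induct)
  case (E k a)
  then show ?case using esums.E[of c k "b * a"] by (simp add: mult_ac)
next
  case (add \<phi> \<psi>)
  then show ?case using esums.add by (simp add: distrib_left)
qed

lemma esums_mult:
  assumes "\<phi> \<in> esums 0" "\<psi> \<in> esums 0"
  shows "(\<lambda>x. \<phi> x * \<psi> x) \<in> esums 0"
  using assms(1)
proof (induction rule: esums.induct)
  case (E k a)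
  note k = E
  show ?case using assms(2)
  proof (induction rule: esums.induct)
    case (E l b)
    have "- 0 \<le> Re ((k + l) $ i)" for i
      using E[of i] k[of i] by simp
    from esums.E[of 0, OF this, of "a * b"] show ?case by (simp add: E_add mult_ac)
  next
    case (add \<phi> \<psi>)
    then show ?case using esums.add by (simp add: distrib_left)
  qed
next
  case (add \<phi> \<psi>)
  then show ?case using esums.add by (simp add: distrib_right)
qed

lemma cont_functional_esums_eq_0:
  assumes "cont_functional K F" "\<And>k. F (E k) = 0" "\<phi> \<in> esums c"
  shows "F \<phi> = 0"
  using assms(3)
  by (induction rule: esums.induct)
    (simp_all add: cont_functional_cmult[OF assms(1)] cont_functional_add[OF assms(1)] assms(2) smooth_E smooth_esums)

abbreviation cube :: "real \<Rightarrow> (real^'d::finite) set" where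
  "cube R \<equiv> {x. \<forall>j. \<bar>x $ j\<bar> \<le> R}"

lemma compact_cube: "compact (cube R :: (real^'d::finite) set)"
proof -
  have "cube R = (cbox (\<chi> j. - R) (\<chi> j. R) :: (real^'d) set)"
    by (auto simp: mem_box_cart abs_le_iff) (metis minus_le_iff)+
  then show ?thesis by (simp add: compact_cbox)
qed

text \<open>Stone-Weierstrass for the real functions that lie in \<open>esums 0\<close> when read as
  complex ones; the functions \<open>exp (x $ i)\<close> separate points.\<close>

lemma esums_dense_C0_real:
  fixes f :: "real^'d::finite \<Rightarrow> real"
  assumes "continuous_on (cube R) f" "0 < e"
  shows "\<exists>g. (\<lambda>x. complex_of_real (g x)) \<in> esums 0 \<and> (\<forall>x\<in>cube R. \<bar>f x - g x\<bar> < e)"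
proof -
  interpret function_ring_on "{g :: real^'d \<Rightarrow> real. (\<lambda>x. complex_of_real (g x)) \<in> esums 0}" "cube R"
  proof
    fix g :: "real^'d \<Rightarrow> real" assume "g \<in> {g. (\<lambda>x. complex_of_real (g x)) \<in> esums 0}"
    then have "continuous_on (cube R) (\<lambda>x. Re (complex_of_real (g x)))"
      by (intro continuous_on_Re smooth_continuous_on) (auto intro: smooth_esums)
    then show "continuous_on (cube R) g" by simp
  next
    fix c
    show "(\<lambda>_. c) \<in> {g. (\<lambda>x. complex_of_real (g x)) \<in> esums 0}"
      using esums.E[of 0 0 "of_real c"] by simp
  next
    fix x y :: "real^'d" assume "x \<noteq> y"
    then obtain i where i: "x $ i \<noteq> y $ i" by (auto simp: Finite_Cartesian_Product.vec_eq_iff)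
    have "(\<lambda>x. 1 * E (axis i 1) x) \<in> esums 0"
      by (rule esums.E) (auto simp: axis_def)
    then have "(\<lambda>x. complex_of_real (exp (x $ i))) \<in> esums 0"
      by (simp add: E_def lin_axis exp_of_real)
    with i show "\<exists>f\<in>{g. (\<lambda>x. complex_of_real (g x)) \<in> esums 0}. f x \<noteq> f y"
      by (intro bexI[of _ "\<lambda>x. exp (x $ i)"]) auto
  qed (auto intro: compact_cube esums.add esums_mult)
  from Stone_Weierstrass_basic[OF assms] show ?thesis by auto
qed

lemma esums_dense_C0:
  fixes f :: "real^'d::finite \<Rightarrow> complex"
  assumes "continuous_on (cube R) f" "0 < e"
  shows "\<exists>g\<in>esums 0. \<forall>x\<in>cube R. norm (f x - g x) < e"
proof -
  obtain g h where gh: "(\<lambda>x. complex_of_real (g x)) \<in> esums 0" "(\<lambda>x. complex_of_real (h x)) \<in> esums 0"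
    "\<forall>x\<in>cube R. \<bar>Re (f x) - g x\<bar> < e/2" "\<forall>x\<in>cube R. \<bar>Im (f x) - h x\<bar> < e/2"
    using esums_dense_C0_real[OF continuous_on_Re[OF assms(1)], of "e/2"]
      esums_dense_C0_real[OF continuous_on_Im[OF assms(1)], of "e/2"] assms(2) by auto
  have "norm (f x - (g x + \<i> * h x)) < e" if "x \<in> cube R" for x
  proof -
    have "norm (f x - (g x + \<i> * h x)) \<le> \<bar>Re (f x) - g x\<bar> + \<bar>Im (f x) - h x\<bar>"
      using cmod_le[of "f x - (g x + \<i> * h x)"] by simp
    then show ?thesis using gh(3,4) that by fastforce
  qed
  then show ?thesis
    by (intro bexI[OF _ esums.add[OF gh(1) esums_cmult[OF gh(2), of \<i>]]]) simp
qed

text \<open>Projection onto the hyperplane \<open>x $ i = 0\<close>, on which initial values for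
  differential equations in direction \<open>i\<close> are prescribed.\<close>

definition proj0 :: "'d::finite \<Rightarrow> real^'d \<Rightarrow> real^'d" where
  "proj0 i x = (\<chi> j. if j = i then 0 else x $ j)"

lemma proj0_add_axis: "proj0 i x + (x $ i) *\<^sub>R axis i 1 = x"
  by (auto simp: proj0_def axis_def Finite_Cartesian_Product.vec_eq_iff)

lemma proj0_line: "j \<noteq> i \<Longrightarrow> proj0 i (proj0 i x + t *\<^sub>R axis j 1) = proj0 i x + t *\<^sub>R axis j 1"
  by (auto simp: proj0_def axis_def Finite_Cartesian_Product.vec_eq_iff)

lemma pdiffs_proj0_cong:
  assumes "\<And>x. \<phi> (proj0 i x) = \<psi> (proj0 i x)" "i \<notin> set is"
  shows "pdiffs is \<phi> (proj0 i x) = pdiffs is \<psi> (proj0 i x)"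
  using assms(2)
proof (induction "is" arbitrary: x)
  case (Cons j "is")
  have "pdiffs is \<phi> (proj0 i x + t *\<^sub>R axis j 1) = pdiffs is \<psi> (proj0 i x + t *\<^sub>R axis j 1)" for t
    using Cons.IH[of "proj0 i x + t *\<^sub>R axis j 1"] Cons.prems proj0_line[of j i x t] by auto
  then show ?case by (simp add: pdiff_def)
qed (simp add: assms)

text \<open>The constant \<open>c + 1\<close> is chosen so that \<open>\<partial>\<^sub>i + c + 1\<close> is invertible on \<open>esums c\<close>.\<close>
lemma esums_solve:
  assumes "p \<in> esums c" "q \<in> esums c" "0 \<le> c"
  shows "\<exists>u\<in>esums (c + 1). (\<forall>x. pdiff i u x + of_real (c + 1) * u x = p x) \<and> (\<forall>x. u (proj0 i x) = q (proj0 i x))"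
proof -
  have "\<exists>w\<in>esums c. \<forall>x. pdiff i w x + of_real (c + 1) * w x = p x"
    using assms(1)
  proof (induction rule: esums.induct)
    case (E k a)
    define b where "b = k $ i + of_real (c + 1)"
    have b: "b \<noteq> 0"
      using E[of i] by (auto simp: complex_eq_iff b_def)
    have "pdiff i (\<lambda>x. a / b * E k x) = (\<lambda>x. a / b * (k $ i * E k x))"
      using pdiffs_E[of "[i]" k] by (subst pdiff_cmult) (auto simp: smooth_E)
    moreover have "a / b * (k $ i * E k x) + of_real (c + 1) * (a / b * E k x) = a * E k x" for x
    proof -
      have b': "a / b * (b * e) = a * e" for e using b by simp
      have "d * (k $ i * e) + (b - k $ i) * (d * e) = d * (b * e)" for d e :: complex
        by (simp add: algebra_simps)
      from this[of "a / b" "E k x"] show ?thesis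
        unfolding b' unfolding b_def add_diff_cancel_left' .
    qed
    ultimately show ?case
      using esums.E[of c k "a / b", OF E] by (intro bexI[of _ "\<lambda>x. a / b * E k x"]) (simp_all only:, simp)
  next
    case (add \<phi> \<psi>)
    then obtain v w where vw: "v \<in> esums c" "w \<in> esums c"
      "\<forall>x. pdiff i v x + of_real (c + 1) * v x = \<phi> x" "\<forall>x. pdiff i w x + of_real (c + 1) * w x = \<psi> x" by auto
    then show ?case
    proof (intro bexI[OF _ esums.add[of v c w]] allI)
      fix x
      have "(pdiff i v x + pdiff i w x) + C * (v x + w x) = (pdiff i v x + C * v x) + (pdiff i w x + C * w x)" for C
        by (simp add: algebra_simps)
      then show "pdiff i (\<lambda>x. v x + w x) x + of_real (c + 1) * (v x + w x) = \<phi> x + \<psi> x"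
        using vw by (simp only: pdiff_add smooth_esums)
    qed (use vw in auto)
  qed
  then obtain w where w: "w \<in> esums c" "\<And>x. pdiff i w x + of_real (c + 1) * w x = p x" by auto
  have hom: "\<exists>h\<in>esums (c + 1). (\<forall>x. pdiff i h x + of_real (c + 1) * h x = 0) \<and> (\<forall>x. h (proj0 i x) = g (proj0 i x))"
    if "g \<in> esums c" for g using that
  proof (induction rule: esums.induct)
    case (E k a)
    \<comment> \<open>Replacing the \<open>i\<close>-th exponent by \<open>- (c + 1)\<close> solves
      the homogeneous equation and does not change the values on \<open>x $ i = 0\<close>. This
      exponent is the reason why the solution lies only in \<open>esums (c + 1)\<close>.\<close>
    define k' where "k' = (\<chi> j. if j = i then - of_real (c + 1) else k $ j)"
    have "- (c + 1) \<le> Re (k' $ j)" for j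
      using E[of j] assms(3) by (auto simp: k'_def)
    then have *: "(\<lambda>x. a * E k' x) \<in> esums (c + 1)" by (rule esums.E)
    have "pdiff i (\<lambda>x. a * E k' x) = (\<lambda>x. a * (k' $ i * E k' x))"
      using pdiffs_E[of "[i]" k'] by (subst pdiff_cmult) (auto simp: smooth_E)
    moreover have "k' $ i = - of_real (c + 1)" by (simp add: k'_def)
    ultimately have "pdiff i (\<lambda>x. a * E k' x) x + of_real (c + 1) * (a * E k' x) = 0" for x
      by (simp add: algebra_simps)
    moreover have "E k' (proj0 i x) = E k (proj0 i x)" for x
      unfolding E_def lin_def by (intro arg_cong[where f = exp] sum.cong) (auto simp: k'_def proj0_def)
    ultimately show ?case using * by (intro bexI[of _ "\<lambda>x. a * E k' x"]) auto
  next
    case (add \<phi> \<psi>)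
    then obtain v w where "v \<in> esums (c+1)" "w \<in> esums (c+1)"
      "\<forall>x. pdiff i v x + of_real (c + 1) * v x = 0" "\<forall>x. pdiff i w x + of_real (c + 1) * w x = 0"
      "\<forall>x. v (proj0 i x) = \<phi> (proj0 i x)" "\<forall>x. w (proj0 i x) = \<psi> (proj0 i x)" by auto
    then show ?case
      by (intro bexI[OF _ esums.add[of v _ w]]) (auto simp: pdiff_add smooth_esums distrib_left add_eq_0_iff)
  qed
  have "(\<lambda>x. q x + (- 1) * w x) \<in> esums c"
    using assms(2) w(1) by (intro esums.add esums_cmult)
  from hom[OF this] obtain h where h: "h \<in> esums (c + 1)" "\<And>x. pdiff i h x + of_real (c + 1) * h x = 0"
    "\<And>x. h (proj0 i x) = q (proj0 i x) - w (proj0 i x)" by auto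
  have w': "w \<in> esums (c + 1)" using w(1) by (rule esums_mono) simp
  have "pdiff i (\<lambda>x. w x + h x) x + of_real (c + 1) * (w x + h x) = p x" for x
  proof -
    have "pdiff i (\<lambda>x. w x + h x) x + of_real (c + 1) * (w x + h x)
      = (pdiff i w x + of_real (c + 1) * w x) + (pdiff i h x + of_real (c + 1) * h x)"
      using w' h(1) by (simp add: pdiff_add smooth_esums algebra_simps)
    then show ?thesis by (simp only: w(2) h(2)) simp
  qed
  then show ?thesis using h(3)
    by (intro bexI[OF _ esums.add[OF w' h(1)]]) auto
qed

text \<open>The integrating factor \<open>exp (c * t)\<close> turns \<open>y' + c * y\<close> into a
  derivative, to which the mean value inequality applies.\<close>

lemma linear_ode_bound:
  fixes y :: "real \<Rightarrow> complex"
  assumes "\<And>t. t \<in> closed_segment 0 s \<Longrightarrow> (y has_vector_derivative y' t) (at t)"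
    and "\<And>t. t \<in> closed_segment 0 s \<Longrightarrow> norm (y' t + of_real c * y t) \<le> e"
    and "norm (y 0) \<le> e" "\<bar>s\<bar> \<le> R" "0 \<le> c"
  shows "norm (y s) \<le> exp (c * R) * (1 + exp (c * R) * R) * e"
proof -
  have e: "0 \<le> e" using assms(3) norm_ge_zero order_trans by blast
  have R: "0 \<le> R" using assms(4) by simp
  have ts: "\<bar>t\<bar> \<le> R" if "t \<in> closed_segment 0 s" for t
    using that assms(4) by (auto simp: closed_segment_eq_real_ivl split: if_splits)
  have "norm (exp (c * s) *\<^sub>R y s - exp (c * 0) *\<^sub>R y 0 - (s - 0) *\<^sub>R 0) \<le> (exp (c * R) * e) * \<bar>s - 0\<bar>"
  proof (rule vector_mean_value_bound)
    fix t assume t: "t \<in> closed_segment 0 s"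
    have "((\<lambda>t. exp (c * t)) has_real_derivative exp (c * t) * c) (at t)"
      by (auto intro!: derivative_eq_intros)
    from has_vector_derivative_scaleR[OF this assms(1)[OF t]]
    show "((\<lambda>t. exp (c * t) *\<^sub>R y t) has_vector_derivative exp (c * t) *\<^sub>R (y' t + of_real c * y t)) (at t)"
      by (simp add: scaleR_conv_of_real algebra_simps)
    have "c * t \<le> c * R" using ts[OF t] assms(5) by (intro mult_left_mono) auto
    then show "norm (exp (c * t) *\<^sub>R (y' t + of_real c * y t) - 0) \<le> exp (c * R) * e"
      using assms(2)[OF t] by (simp add: mult_mono)
  qed
  then have *: "norm (exp (c * s) *\<^sub>R y s - y 0) \<le> exp (c * R) * e * \<bar>s\<bar>" by simp
  have "exp (c * s) * norm (y s) = norm ((exp (c * s) *\<^sub>R y s - y 0) + y 0)" by simp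
  also have "\<dots> \<le> exp (c * R) * e * \<bar>s\<bar> + e"
    using * assms(3) norm_triangle_ineq by (meson add_mono order_trans)
  also have "\<dots> \<le> exp (c * R) * e * R + e"
    using assms(4) e by (simp add: mult_left_mono)
  finally have "exp (c * s) * norm (y s) \<le> (1 + exp (c * R) * R) * e" by (simp add: algebra_simps)
  then have "exp (- (c * s)) * (exp (c * s) * norm (y s)) \<le> exp (- (c * s)) * ((1 + exp (c * R) * R) * e)"
    by (rule mult_left_mono) simp
  then have "norm (y s) \<le> exp (- (c * s)) * ((1 + exp (c * R) * R) * e)"
    by (simp only: mult.assoc[symmetric] mult_exp_exp) simp
  also have "\<dots> \<le> exp (c * R) * ((1 + exp (c * R) * R) * e)"
  proof (rule mult_right_mono)
    have "c * (- s) \<le> c * R" using assms(4,5) by (intro mult_left_mono) auto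
    then show "exp (- (c * s)) \<le> exp (c * R)" by simp
  qed (use e R in simp)
  finally show ?thesis by (simp add: mult.assoc)
qed

lemma uniform_limit_ode:
  fixes \<psi> :: "nat \<Rightarrow> real^'d::finite \<Rightarrow> complex"
  assumes "\<And>k. smooth (\<psi> k)" "0 \<le> c"
    and "uniform_limit (cube R) (\<lambda>k x. pdiff i (\<psi> k) x + of_real c * \<psi> k x) (\<lambda>_. 0) sequentially"
    and "uniform_limit (cube R) (\<lambda>k x. \<psi> k (proj0 i x)) (\<lambda>_. 0) sequentially"
  shows "uniform_limit (cube R) \<psi> (\<lambda>_. 0) sequentially"
proof (rule uniform_limitI)
  fix e :: real assume "0 < e"
  define B where "B = exp (c * \<bar>R\<bar>) * (1 + exp (c * \<bar>R\<bar>) * \<bar>R\<bar>)"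
  have B: "0 < B" unfolding B_def by (intro mult_pos_pos add_pos_nonneg) auto
  define e' where "e' = e / (2 * B)"
  have e': "0 < e'" "B * e' < e" using \<open>0 < e\<close> B by (auto simp: e'_def)
  show "\<forall>\<^sub>F k in sequentially. \<forall>x\<in>cube R. dist (\<psi> k x) 0 < e"
    using uniform_limitD[OF assms(3) e'(1)] uniform_limitD[OF assms(4) e'(1)]
  proof eventually_elim
    case (elim k)
    show ?case
    proof
      fix x :: "real^'d" assume x: "x \<in> cube R"
      define y where "y t = \<psi> k (proj0 i x + t *\<^sub>R axis i 1)" for t
      have "norm (y (x $ i)) \<le> exp (c * \<bar>R\<bar>) * (1 + exp (c * \<bar>R\<bar>) * \<bar>R\<bar>) * e'"
      proof (rule linear_ode_bound[where y' = "\<lambda>t. pdiff i (\<psi> k) (proj0 i x + t *\<^sub>R axis i 1)"])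
        show "(y has_vector_derivative pdiff i (\<psi> k) (proj0 i x + t *\<^sub>R axis i 1)) (at t)" for t
          unfolding y_def by (rule smooth_has_vector_derivative[OF assms(1)])
        fix t assume "t \<in> closed_segment 0 (x $ i)"
        then have "\<bar>t\<bar> \<le> R"
          using x[simplified, rule_format, of i] by (auto simp: closed_segment_eq_real_ivl split: if_splits)
        then have "proj0 i x + t *\<^sub>R axis i 1 \<in> cube R"
          using x by (auto simp: proj0_def axis_def)
        then show "norm (pdiff i (\<psi> k) (proj0 i x + t *\<^sub>R axis i 1) + of_real c * y t) \<le> e'"
          using elim(1) by (auto simp: y_def intro: less_imp_le)
      next
        show "norm (y 0) \<le> e'"
          using elim(2) x by (auto simp: y_def intro: less_imp_le)
        show "\<bar>x $ i\<bar> \<le> \<bar>R\<bar>" using x[simplified, rule_format, of i] by simp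
      qed (rule assms(2))
      then show "dist (\<psi> k x) 0 < e"
        using e'(2) by (simp add: y_def proj0_add_axis B_def)
    qed
  qed
qed

lemma uniform_limit_diff_0:
  fixes f :: "nat \<Rightarrow> 'a \<Rightarrow> complex"
  shows "uniform_limit K f g sequentially \<longleftrightarrow> uniform_limit K (\<lambda>k x. g x - f k x) (\<lambda>_. 0) sequentially"
  by (simp add: uniform_limit_iff dist_norm norm_minus_commute)

text \<open>Uniform approximation says nothing about derivatives, so these are gained by
  integration. For \<open>i\<close> in \<open>A\<close>, approximate \<open>D \<phi>\<close> (the
  derivative in direction \<open>i\<close> plus \<open>c + 1\<close> times \<open>\<phi>\<close>)
  with one \<open>i\<close> fewer, and the values on \<open>x $ i = 0\<close> with no
  \<open>i\<close> at all; then solve \<open>D u = p\<close> with initial values \<open>q\<close>.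
  The size of \<open>A\<close> pays for the growth of the exponent bound.\<close>

lemma esums_dense_Ck:
  fixes \<phi> :: "real^'d::finite \<Rightarrow> complex"
  assumes "smooth \<phi>"
  shows "\<exists>u. (\<forall>k. u k \<in> esums (size A)) \<and> (\<forall>is. mset is \<subseteq># A \<longrightarrow>
      uniform_limit (cube R) (\<lambda>k. pdiffs is (u k)) (pdiffs is \<phi>) sequentially)"
  using assms
proof (induction "size A" arbitrary: A \<phi> rule: less_induct)
  case less
  show ?case
  proof (cases "A = {#}")
    case True
    have "\<exists>g\<in>esums 0. \<forall>x\<in>cube R. norm (\<phi> x - g x) < 1 / real (Suc k)" for k
      by (intro esums_dense_C0 smooth_continuous_on less.prems) simp
    then obtain u where u: "\<And>k. u k \<in> esums 0" "\<And>k x. x \<in> cube R \<Longrightarrow> norm (\<phi> x - u k x) < 1 / real (Suc k)"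
      by metis
    have "uniform_limit (cube R) u \<phi> sequentially"
    proof (rule uniform_limitI)
      fix e :: real assume "0 < e"
      from eventually_sequentially_Suc order_tendstoD(2)[OF LIMSEQ_inverse_real_of_nat this]
      have "\<forall>\<^sub>F k in sequentially. 1 / real (Suc k) < e" by (simp add: field_simps)
      then show "\<forall>\<^sub>F k in sequentially. \<forall>x\<in>cube R. dist (u k x) (\<phi> x) < e"
        by eventually_elim (use u(2) in \<open>force simp: dist_norm norm_minus_commute intro: less_trans\<close>)
    qed
    then show ?thesis using True u(1) by auto
  next
    case False
    then obtain i where i: "i \<in># A" by auto
    define A1 where "A1 = A - {#i#}"
    define A2 where "A2 = filter_mset (\<lambda>j. j \<noteq> i) A"
    define c where "c = real (size A1)"
    have A: "A = add_mset i A1" using i by (simp add: A1_def)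
    have sA: "real (size A) = c + 1" by (simp add: A c_def)
    have A2: "A2 \<subseteq># A1" by (auto simp: A2_def A)
    define D where "D \<phi> = (\<lambda>x. pdiff i \<phi> x + of_real (c + 1) * \<phi> x)" for \<phi> :: "real^'d \<Rightarrow> complex"
    have smooth_D: "smooth (D \<phi>)" if "smooth \<phi>" for \<phi> unfolding D_def
      using that by (intro smooth_add smooth_cmult smooth_pdiff)
    obtain p where p: "\<And>k. p k \<in> esums c"
      "\<And>is. mset is \<subseteq># A1 \<Longrightarrow> uniform_limit (cube R) (\<lambda>k. pdiffs is (p k)) (pdiffs is (D \<phi>)) sequentially"
      using less.hyps[of A1 "D \<phi>"] smooth_D[OF less.prems] by (auto simp: A c_def)
    obtain q where q: "\<And>k. q k \<in> esums (size A2)"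
      "\<And>is. mset is \<subseteq># A2 \<Longrightarrow> uniform_limit (cube R) (\<lambda>k. pdiffs is (q k)) (pdiffs is \<phi>) sequentially"
      using less.hyps[of A2 \<phi>] less.prems size_mset_mono[OF A2] by (auto simp: A)
    have q': "q k \<in> esums c" for k
      using q(1) by (rule esums_mono) (use size_mset_mono[OF A2] in \<open>simp add: c_def\<close>)
    have "\<exists>u. \<forall>k. u k \<in> esums (c + 1) \<and> D (u k) = p k \<and> (\<forall>x. u k (proj0 i x) = q k (proj0 i x))"
      using esums_solve[OF p(1) q'] unfolding D_def c_def by (intro choice allI) (auto simp: fun_eq_iff Bex_def)
    then obtain u where u: "\<And>k. u k \<in> esums (c + 1)" "\<And>k. D (u k) = p k" "\<And>k x. u k (proj0 i x) = q k (proj0 i x)"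
      by blast
    define \<psi> where "\<psi> k = (\<lambda>x. \<phi> x - u k x)" for k
    have s: "smooth (\<psi> k)" "smooth (u k)" "smooth (q k)" "smooth (p k)" for k
      using u(1) q(1) p(1) less.prems by (auto simp: \<psi>_def intro: smooth_diff smooth_esums)
    have D\<psi>: "D (\<psi> k) = (\<lambda>x. D \<phi> x - p k x)" for k
      unfolding u(2)[symmetric]
      using pdiffs_diff[of \<phi> "u k" "[i]"] less.prems s(2)[of k] by (auto simp: D_def \<psi>_def algebra_simps)
    have D_comm: "D (pdiffs js \<theta>) = pdiffs js (D \<theta>)" if "smooth \<theta>" for js \<theta>
      using that unfolding D_def
      by (simp add: pdiffs_add pdiffs_cmult smooth_pdiff smooth_cmult pdiffs_pdiff)
    have lim_D: "uniform_limit (cube R) (\<lambda>k. D (pdiffs js (\<psi> k))) (\<lambda>_. 0) sequentially" if "mset js \<subseteq># A1" for js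
      using p(2)[OF that] unfolding uniform_limit_diff_0[where f = "\<lambda>k. pdiffs js (p k)"]
      by (simp add: D_comm s D\<psi> pdiffs_diff smooth_D less.prems)
    \<comment> \<open>With no derivative in direction \<open>i\<close>, smallness comes from the
      linear differential equation; each further one is recovered from
      \<open>pdiff i = D - (c + 1)\<close>.\<close>
    have lim: "uniform_limit (cube R) (\<lambda>k. pdiffs (replicate n i @ js) (\<psi> k)) (\<lambda>_. 0) sequentially"
      if "i \<notin> set js" "mset (replicate n i @ js) \<subseteq># A" for n js
      using that(2)
    proof (induction n)
      case 0
      have js: "mset js \<subseteq># A1"
      proof (rule mset_subset_eqI)
        show "count (mset js) j \<le> count A1 j" for j
          using mset_subset_eq_count[OF 0, of j] that(1) by (cases "j = i") (auto simp: A1_def count_eq_zero_iff[THEN iffD2])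
      qed
      have js2: "mset js \<subseteq># A2"
        using 0 that(1) by (auto simp: A2_def subseteq_mset_def)
      show ?case
      proof (simp, rule uniform_limit_ode[where c = "c + 1" and i = i])
        show "uniform_limit (cube R) (\<lambda>k x. pdiff i (pdiffs js (\<psi> k)) x + of_real (c + 1) * pdiffs js (\<psi> k) x) (\<lambda>_. 0) sequentially"
          using lim_D[OF js] by (simp add: D_def)
        have "pdiffs js (\<psi> k) (proj0 i x) = pdiffs js \<phi> (proj0 i x) - pdiffs js (q k) (proj0 i x)" for k x
          using pdiffs_proj0_cong[of "\<psi> k" i "\<lambda>x. \<phi> x - q k x" js x] that(1) s less.prems
          by (simp add: \<psi>_def u(3) pdiffs_diff)
        moreover have "uniform_limit (cube R) (\<lambda>k x. pdiffs js \<phi> (proj0 i x) - pdiffs js (q k) (proj0 i x)) (\<lambda>_. 0) sequentially"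
        proof (rule uniform_limit_compose'[where h = "proj0 i" and A = "cube R" and f = "\<lambda>k x. pdiffs js \<phi> x - pdiffs js (q k) x"])
          show "uniform_limit (cube R) (\<lambda>k x. pdiffs js \<phi> x - pdiffs js (q k) x) (\<lambda>_. 0) sequentially"
            by (rule iffD1[OF uniform_limit_diff_0 q(2)[OF js2]])
          show "proj0 i \<in> cube R \<rightarrow> cube R"
            by (auto simp: proj0_def) (meson abs_ge_zero order_trans)
        qed
        ultimately show "uniform_limit (cube R) (\<lambda>k x. pdiffs js (\<psi> k) (proj0 i x)) (\<lambda>_. 0) sequentially"
          by simp
      qed (auto simp: c_def intro: smooth_pdiffs s)
    next
      case (Suc n)
      have "mset (replicate n i @ js) \<subseteq># A1"
        using Suc.prems by (simp add: A)
      from lim_D[OF this] have "uniform_limit (cube R) (\<lambda>k x. D (pdiffs (replicate n i @ js) (\<psi> k)) x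
          - of_real (c + 1) * pdiffs (replicate n i @ js) (\<psi> k) x) (\<lambda>x. 0 - of_real (c + 1) * 0) sequentially"
        using Suc.prems by (intro uniform_limit_minus bounded_linear.uniform_limit[OF bounded_linear_mult_right] Suc.IH)
          (auto dest: mset_subset_eq_insertD simp: subset_mset.less_imp_le)
      then show ?case by (simp add: D_def)
    qed
    have "uniform_limit (cube R) (\<lambda>k. pdiffs is (u k)) (pdiffs is \<phi>) sequentially" if "mset is \<subseteq># A" for "is"
    proof -
      define js where "js = filter (\<lambda>j. j \<noteq> i) is"
      define n where "n = count (mset is) i"
      have eq: "mset is = mset (replicate n i @ js)"
        by (rule multiset_eqI) (auto simp: js_def n_def)
      have "uniform_limit (cube R) (\<lambda>k. pdiffs (replicate n i @ js) (\<psi> k)) (\<lambda>_. 0) sequentially"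
      proof (rule lim)
        show "i \<notin> set js" by (simp add: js_def)
        show "mset (replicate n i @ js) \<subseteq># A" using that unfolding eq .
      qed
      then show ?thesis
        unfolding uniform_limit_diff_0[where f = "\<lambda>k. pdiffs is (u k)"]
        using pdiffs_cong_mset[OF s(1) eq] pdiffs_diff[OF less.prems s(2)] by (simp add: \<psi>_def)
    qed
    then show ?thesis using u(1) by (intro exI[of _ u]) (auto simp: sA)
  qed
qed

lemma esums_dense_Cinf:
  fixes \<phi> :: "real^'d::finite \<Rightarrow> complex"
  assumes "compact K" "smooth \<phi>"
  shows "\<exists>u. (\<forall>k. \<exists>c. u k \<in> esums c) \<and> Cconv K u \<phi>"
proof -
  obtain R where R: "\<And>x. x \<in> K \<Longrightarrow> norm x \<le> R"
    using compact_imp_bounded[OF assms(1)] bounded_iff by blast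
  then have K: "K \<subseteq> cube R" using component_le_norm_cart order_trans by blast
  have "\<exists>g c. g \<in> esums c \<and> (\<forall>is. length is \<le> n \<longrightarrow> (\<forall>x\<in>K. dist (pdiffs is g x) (pdiffs is \<phi> x) < inverse (real (Suc n))))" for n
  proof -
    \<comment> \<open>With \<open>n\<close> copies of every index, all lists of length at most
      \<open>n\<close> are covered, so a single exponential sum approximates all these
      derivatives.\<close>
    define A where "A = (\<Sum>i\<in>(UNIV :: 'd set). replicate_mset n i)"
    have sub: "mset is \<subseteq># A" if "length is \<le> n" for "is"
    proof (rule mset_subset_eqI)
      fix i
      have "count A i = (\<Sum>j\<in>UNIV. if i = j then n else 0)"
        unfolding A_def count_sum by (intro sum.cong) auto
      then have "count A i = n" by simp
      then show "count (mset is) i \<le> count A i"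
        using that count_le_size[of "mset is" i] by simp
    qed
    obtain u where u: "\<And>k. u k \<in> esums (size A)" "\<And>is. mset is \<subseteq># A \<Longrightarrow>
        uniform_limit (cube R) (\<lambda>k. pdiffs is (u k)) (pdiffs is \<phi>) sequentially"
      using esums_dense_Ck[OF assms(2), of A R] by blast
    have fin: "finite {is :: 'd list. length is \<le> n}"
      using finite_lists_length_le[of "UNIV :: 'd set" n] by simp
    have "\<forall>\<^sub>F k in sequentially. \<forall>is\<in>{is. length is \<le> n}. \<forall>x\<in>cube R. dist (pdiffs is (u k) x) (pdiffs is \<phi> x) < inverse (real (Suc n))"
    proof (rule eventually_ball_finite[OF fin], rule ballI)
      fix "is" :: "'d list" assume "is \<in> {is. length is \<le> n}"
      then show "\<forall>\<^sub>F k in sequentially. \<forall>x\<in>cube R. dist (pdiffs is (u k) x) (pdiffs is \<phi> x) < inverse (real (Suc n))"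
        using uniform_limitD[OF u(2)[OF sub]] by simp
    qed
    then obtain k where "\<forall>is\<in>{is. length is \<le> n}. \<forall>x\<in>cube R. dist (pdiffs is (u k) x) (pdiffs is \<phi> x) < inverse (real (Suc n))"
      using eventually_happens'[OF sequentially_bot] by blast
    then show ?thesis using u(1)[of k] subsetD[OF K] by (intro exI[of _ "u k"]) auto
  qed
  then obtain g where g: "\<And>n. \<exists>c. g n \<in> esums c"
    "\<And>n is x. length is \<le> n \<Longrightarrow> x \<in> K \<Longrightarrow> dist (pdiffs is (g n) x) (pdiffs is \<phi> x) < inverse (real (Suc n))"
    by metis
  have "uniform_limit K (\<lambda>n. pdiffs is (g n)) (pdiffs is \<phi>) sequentially" for "is"
  proof (rule uniform_limitI)
    fix e :: real assume "0 < e"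
    from order_tendstoD(2)[OF LIMSEQ_inverse_real_of_nat this] eventually_ge_at_top[of "length is"]
    show "\<forall>\<^sub>F n in sequentially. \<forall>x\<in>K. dist (pdiffs is (g n) x) (pdiffs is \<phi> x) < e"
      by eventually_elim (use g(2) less_trans in blast)
  qed
  then show ?thesis using g(1) smooth_esums assms(2) unfolding Cconv_def by blast
qed

text \<open>Uniqueness for the Fourier-Laplace transform, from density. It is applied to
  \<open>F\<close> times an annihilator and to single jets.\<close>

lemma cont_functional_eq_0:
  assumes "compact K" "cont_functional K F" "\<And>k. F (E k) = 0" "smooth \<phi>"
  shows "F \<phi> = 0"
proof -
  obtain u where u: "\<forall>k. \<exists>c. u k \<in> esums c" "Cconv K u \<phi>"
    using esums_dense_Cinf[OF assms(1,4)] by blast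
  have "F (u k) = 0" for k
    using u(1) cont_functional_esums_eq_0[OF assms(2,3)] by blast
  then show ?thesis
    using cont_functional_lim[OF assms(2) u(2)] LIMSEQ_unique by (simp add: LIMSEQ_const_iff)
qed

section \<open>Determinants and kernels of finite rank\<close>

text \<open>A determinant taken directly of an entry function, so that entries can be rewritten by
  \<open>kdet_cong\<close> without carrier conditions.\<close>

definition kdet :: "nat \<Rightarrow> (nat \<Rightarrow> nat \<Rightarrow> 'a::field) \<Rightarrow> 'a" where
  "kdet n A = Determinant.det (Matrix.mat n n (\<lambda>(i, j). A i j))"

lemma kdet_cong: "(\<And>i j. i < n \<Longrightarrow> j < n \<Longrightarrow> A i j = B i j) \<Longrightarrow> kdet n A = kdet n B"
  unfolding kdet_def by (intro arg_cong[where f = Determinant.det] eq_matI) auto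

lemma kdet_eq_sum: "kdet n A = (\<Sum>p | p permutes {0..<n}. of_int (sign p) * (\<Prod>i = 0..<n. A i (p i)))"
  unfolding kdet_def by (subst det_def'[of _ n]) (auto intro!: sum.cong prod.cong simp: permutes_in_image)

lemma kdet_0 [simp]: "kdet 0 A = 1"
  by (simp add: kdet_def)

lemma kdet_transpose: "kdet n (\<lambda>i j. A j i) = kdet n A"
proof -
  have "Matrix.mat n n (\<lambda>(i, j). A j i) = transpose_mat (Matrix.mat n n (\<lambda>(i, j). A i j))"
    by (intro eq_matI) auto
  then show ?thesis unfolding kdet_def by (simp add: det_transpose[of _ n])
qed

lemma kdet_mult: "kdet n (\<lambda>i j. \<Sum>k<n. A i k * B k j) = kdet n A * kdet n B"
proof -
  have "Matrix.mat n n (\<lambda>(i, j). \<Sum>k<n. A i k * B k j)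
    = Matrix.mat n n (\<lambda>(i, j). A i j) * Matrix.mat n n (\<lambda>(i, j). B i j)"
    by (intro eq_matI) (auto simp: scalar_prod_def atLeast0LessThan)
  then show ?thesis unfolding kdet_def by (simp add: Determinant.det_mult[of _ n])
qed

lemma kdet_row_linear:
  assumes "k < n"
  shows "\<exists>c. \<forall>y. kdet n (\<lambda>i j. if i = k then y j else R i j) = (\<Sum>j<n. y j * c j)"
proof (intro exI allI)
  fix y
  let ?A = "\<lambda>y. Matrix.mat n n (\<lambda>(i, j). if i = k then y j else R i j)"
  have "mat_delete (?A y) k j = mat_delete (?A (\<lambda>_. 0)) k j" for j
    unfolding mat_delete_def by (intro eq_matI) auto
  then have "cofactor (?A y) k j = cofactor (?A (\<lambda>_. 0)) k j" for j
    by (simp add: cofactor_def)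
  then show "kdet n (\<lambda>i j. if i = k then y j else R i j) = (\<Sum>j<n. y j * cofactor (?A (\<lambda>_. 0)) k j)"
    unfolding kdet_def using assms
    by (subst laplace_expansion_row[of _ n k]) (auto intro!: sum.cong)
qed

text \<open>Linearity in row \<open>k\<close> leaves only unit vectors to test; for these the matrix
  is the identity or has two equal rows.\<close>

lemma kdet_unit_rows:
  fixes y :: "nat \<Rightarrow> 'a::field"
  assumes "k < n"
  shows "kdet n (\<lambda>i j. if i = k then y j else of_bool (i = j)) = y k"
proof -
  obtain c where c: "\<And>y :: nat \<Rightarrow> 'a. kdet n (\<lambda>i j. if i = k then y j else of_bool (i = j)) = (\<Sum>j<n. y j * c j)"
    using kdet_row_linear[OF assms, of "\<lambda>i j. of_bool (i = j)"] by blast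
  have "c l = of_bool (l = k)" if l: "l < n" for l
  proof -
    have "c l = (\<Sum>j<n. of_bool (l = j) * c j)"
      using l by (simp add: of_bool_def if_distrib[of "\<lambda>x. x * _"] sum.delta cong: if_cong)
    also have "\<dots> = kdet n (\<lambda>i j. if i = k then of_bool (l = j) else of_bool (i = j))"
      by (rule c[symmetric])
    also have "\<dots> = of_bool (l = k)"
    proof (cases "l = k")
      case True
      then have "kdet n (\<lambda>i j. if i = k then of_bool (l = j) else of_bool (i = j)) = Determinant.det (1\<^sub>m n)"
        unfolding kdet_def by (intro arg_cong[where f = Determinant.det] eq_matI) auto
      then show ?thesis using True by simp
    next
      case False
      let ?A = "Matrix.mat n n (\<lambda>(i, j). if i = k then of_bool (l = j) else of_bool (i = j)) :: 'a mat"
      have "Matrix.row ?A k = Matrix.row ?A l"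
        using assms l False by (intro eq_vecI) auto
      then have "Determinant.det ?A = 0"
        using assms l False by (intro Determinant.det_identical_rows[of _ n k l]) auto
      then have "kdet n (\<lambda>i j. if i = k then of_bool (l = j) else of_bool (i = j)) = (0 :: 'a)"
        unfolding kdet_def .
      then show ?thesis using False by simp
    qed
    finally show ?thesis .
  qed
  then have "(\<Sum>j<n. y j * c j) = (\<Sum>j<n. if j = k then y k else 0)"
    by (intro sum.cong) auto
  then show ?thesis using assms by (simp add: c)
qed

text \<open>Laplace expansion in which only the corner cofactor is identified; about the others it
  matters only that they do not depend on the last column.\<close>

lemma kdet_last_column:
  "\<exists>c. \<forall>y. kdet (Suc n) (\<lambda>i j. if j = n then y i else R i j) = (\<Sum>i<n. y i * c i) + y n * kdet n R"
proof (intro exI allI)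
  fix y
  let ?A = "\<lambda>y. Matrix.mat (Suc n) (Suc n) (\<lambda>(i, j). if j = n then y i else R i j)"
  have "mat_delete (?A y) i n = mat_delete (?A (\<lambda>_. 0)) i n" for i
    unfolding mat_delete_def by (intro eq_matI) auto
  then have cof: "cofactor (?A y) i n = cofactor (?A (\<lambda>_. 0)) i n" for i
    by (simp add: cofactor_def)
  have "mat_delete (?A y) n n = Matrix.mat n n (\<lambda>(i, j). R i j)"
    unfolding mat_delete_def by (intro eq_matI) auto
  then have "cofactor (?A y) n n = kdet n R" by (simp add: cofactor_def kdet_def)
  then show "kdet (Suc n) (\<lambda>i j. if j = n then y i else R i j)
      = (\<Sum>i<n. y i * cofactor (?A (\<lambda>_. 0)) i n) + y n * kdet n R"
    unfolding kdet_def[of "Suc n"] using cof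
    by (subst laplace_expansion_column[of _ "Suc n" n]) (auto intro!: sum.cong)
qed

lemma kdet_diagonal:
  assumes "\<And>i j. i < n \<Longrightarrow> j < n \<Longrightarrow> i \<noteq> j \<Longrightarrow> A i j = 0"
  shows "kdet n A = (\<Prod>i<n. A i i)"
  unfolding kdet_def
  by (subst det_upper_triangular[of _ n]) (auto simp: assms diag_mat_def prod.list_conv_set_nth atLeast0LessThan)

text \<open>Multiplying \<open>A * M = M\<close> by the adjugate of \<open>M\<close> on the right
  gives \<open>A\<close> times the nonzero scalar \<open>det M\<close> on one side and that scalar
  times the identity on the other.\<close>

lemma kdet_inverse_unique:
  assumes "kdet n M \<noteq> 0" "\<And>i j. i < n \<Longrightarrow> j < n \<Longrightarrow> (\<Sum>k<n. A i k * M k j) = M i j" "i < n" "k < n"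
  shows "A i k = of_bool (i = k)"
proof -
  let ?A = "Matrix.mat n n (\<lambda>(i, j). A i j)" and ?M = "Matrix.mat n n (\<lambda>(i, j). M i j)"
  have AM: "?A * ?M = ?M"
    by (intro eq_matI) (auto simp: scalar_prod_def atLeast0LessThan assms(2))
  have "?A * (Determinant.det ?M \<cdot>\<^sub>m 1\<^sub>m n) = ?A * (?M * adj_mat ?M)"
    by (simp add: adj_mat(2)[of _ n])
  also have "\<dots> = ?M * adj_mat ?M"
    using assoc_mult_mat[of ?A n n ?M n "adj_mat ?M" n] adj_mat(1)[of ?M n] AM by simp
  also have "\<dots> = Determinant.det ?M \<cdot>\<^sub>m 1\<^sub>m n"
    by (simp add: adj_mat(2)[of _ n])
  finally have "(?A * (Determinant.det ?M \<cdot>\<^sub>m 1\<^sub>m n)) $$ (i, k) = (Determinant.det ?M \<cdot>\<^sub>m 1\<^sub>m n) $$ (i, k)" by simp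
  then have "kdet n M * A i k = kdet n M * of_bool (i = k)"
    using assms(3,4) by (cases "i = k") (auto simp: kdet_def mult_smult_distrib[of _ n n _ n])
  then show ?thesis using assms(1) by simp
qed

text \<open>Multilinearity: the induction on \<open>s\<close> admits rows from \<open>X'\<close> in
  the first \<open>s\<close> places, each new one being expanded into rows from
  \<open>X\<close>.\<close>

lemma kdet_span_rows:
  assumes "\<And>p. (\<And>i. i < N \<Longrightarrow> p i \<in> X) \<Longrightarrow> kdet N (\<lambda>i j. B (p i) j) = 0"
    and "\<And>x. x \<in> X' \<Longrightarrow> \<exists>(S :: 's set) e c. e ` S \<subseteq> X \<and> (\<forall>j<N. B x j = (\<Sum>a\<in>S. c a * B (e a) j))"
    and "\<And>i. i < N \<Longrightarrow> p i \<in> X'"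
  shows "kdet N (\<lambda>i j. B (p i) j) = 0"
proof -
  have "kdet N (\<lambda>i j. B (p i) j) = 0"
    if "\<And>i. i < N \<Longrightarrow> p i \<in> (if i < s then X' else X)" "s \<le> N" for s p
    using that
  proof (induction s arbitrary: p)
    case (Suc s)
    obtain c where c: "\<And>y. kdet N (\<lambda>i j. if i = s then y j else B (p i) j) = (\<Sum>j<N. y j * c j)"
      using kdet_row_linear[of s N "\<lambda>i j. B (p i) j"] Suc.prems by auto
    obtain S :: "'s set" and e d where Sd: "e ` S \<subseteq> X" "\<forall>j<N. B (p s) j = (\<Sum>a\<in>S. d a * B (e a) j)"
    proof -
      have "p s \<in> X'" using Suc.prems(1)[of s] Suc.prems(2) by simp
      from assms(2)[OF this] show ?thesis using that by blast
    qed
    have "(\<Sum>j<N. B (e a) j * c j) = 0" if "a \<in> S" for a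
    proof -
      have "kdet N (\<lambda>i j. B ((p(s := e a)) i) j) = 0"
      proof (rule Suc.IH)
        show "(p(s := e a)) i \<in> (if i < s then X' else X)" if "i < N" for i
          using Suc.prems(1)[OF that] Sd(1) \<open>a \<in> S\<close> by (auto split: if_splits)
      qed (use Suc.prems(2) in simp)
      moreover have "kdet N (\<lambda>i j. B ((p(s := e a)) i) j) = kdet N (\<lambda>i j. if i = s then B (e a) j else B (p i) j)"
        by (intro kdet_cong) auto
      ultimately show ?thesis by (simp add: c)
    qed
    then have "(\<Sum>a\<in>S. d a * (\<Sum>j<N. B (e a) j * c j)) = 0" by simp
    moreover have "(\<Sum>a\<in>S. d a * (\<Sum>j<N. B (e a) j * c j)) = (\<Sum>j<N. (\<Sum>a\<in>S. d a * B (e a) j) * c j)"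
    proof -
      have "(\<Sum>a\<in>S. d a * (\<Sum>j<N. B (e a) j * c j)) = (\<Sum>a\<in>S. \<Sum>j<N. d a * B (e a) j * c j)"
        by (simp add: sum_distrib_left mult.assoc)
      also have "\<dots> = (\<Sum>j<N. \<Sum>a\<in>S. d a * B (e a) j * c j)" by (rule sum.swap)
      finally show ?thesis by (simp add: sum_distrib_right)
    qed
    moreover have "\<dots> = (\<Sum>j<N. B (p s) j * c j)" using Sd(2) by (intro sum.cong) auto
    moreover have "kdet N (\<lambda>i j. B (p i) j) = kdet N (\<lambda>i j. if i = s then B (p s) j else B (p i) j)"
      by (intro kdet_cong) auto
    ultimately show ?case by (simp add: c)
  qed (use assms(1) in auto)
  from this[of p N] show ?thesis using assms(3) by simp
qed

text \<open>Take \<open>r\<close> with some nonzero minor of size \<open>r\<close> and none of size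
  \<open>Suc r\<close>. Border the nonzero minor by \<open>l\<close> and \<open>u\<close> and expand
  along the column of \<open>u\<close>: the cofactors depend on \<open>l\<close> only, and the
  corner cofactor is the nonzero minor.\<close>

lemma finite_rank_kernel:
  fixes B :: "'l \<Rightarrow> 'u \<Rightarrow> 'a::field"
  assumes "\<And>l u. (\<And>i. i < Suc m \<Longrightarrow> l i \<in> L \<and> u i \<in> U) \<Longrightarrow> kdet (Suc m) (\<lambda>i j. B (l i) (u j)) = 0"
  obtains r l0 u0 a where "\<And>i. i < r \<Longrightarrow> l0 i \<in> L" "\<And>i. i < r \<Longrightarrow> u0 i \<in> U"
    "kdet r (\<lambda>i j. B (l0 i) (u0 j)) \<noteq> 0"
    "\<And>l u. l \<in> L \<Longrightarrow> u \<in> U \<Longrightarrow> B l u = (\<Sum>k<r. a k l * B (l0 k) u)"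
proof -
  define P where "P r \<longleftrightarrow> (\<exists>l u. (\<forall>i<r. l i \<in> L \<and> u i \<in> U) \<and> kdet r (\<lambda>i j. B (l i) (u j)) \<noteq> 0)" for r
  have "P 0" by (simp add: P_def)
  moreover have "\<not> P (Suc m)" using assms unfolding P_def by blast
  moreover have "P n" if "P 0" "\<And>r. P r \<Longrightarrow> P (Suc r)" for n
    by (induction n) (use that in auto)
  ultimately obtain r where r: "P r" "\<not> P (Suc r)"
    by blast
  then obtain l0 u0 where l0: "\<forall>i<r. l0 i \<in> L \<and> u0 i \<in> U" "kdet r (\<lambda>i j. B (l0 i) (u0 j)) \<noteq> 0"
    unfolding P_def by blast
  define d where "d = kdet r (\<lambda>i j. B (l0 i) (u0 j))"
  have "\<exists>a. \<forall>u\<in>U. B l u = (\<Sum>k<r. a k * B (l0 k) u)" if l: "l \<in> L" for l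
  proof -
    define l1 where "l1 = l0(r := l)"
    have "\<exists>c. \<forall>y. kdet (Suc r) (\<lambda>i j. if j = r then y i else B (l1 i) (u0 j))
        = (\<Sum>i<r. y i * c i) + y r * kdet r (\<lambda>i j. B (l1 i) (u0 j))"
      by (rule kdet_last_column)
    then obtain c where c: "\<And>y. kdet (Suc r) (\<lambda>i j. if j = r then y i else B (l1 i) (u0 j))
        = (\<Sum>i<r. y i * c i) + y r * kdet r (\<lambda>i j. B (l1 i) (u0 j))"
      by blast
    have d: "kdet r (\<lambda>i j. B (l1 i) (u0 j)) = d"
      unfolding d_def by (intro kdet_cong) (auto simp: l1_def)
    have "B l u = (\<Sum>k<r. (- c k / d) * B (l0 k) u)" if u: "u \<in> U" for u
    proof -
      have "\<forall>i<Suc r. l1 i \<in> L \<and> (u0(r := u)) i \<in> U"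
        using l0(1) l u by (auto simp: l1_def less_Suc_eq)
      then have "kdet (Suc r) (\<lambda>i j. B (l1 i) ((u0(r := u)) j)) = 0"
        using r(2) unfolding P_def by blast
      moreover have "kdet (Suc r) (\<lambda>i j. B (l1 i) ((u0(r := u)) j))
          = kdet (Suc r) (\<lambda>i j. if j = r then B (l1 i) u else B (l1 i) (u0 j))"
        by (intro kdet_cong) auto
      ultimately have "(\<Sum>i<r. B (l1 i) u * c i) + B (l1 r) u * d = 0"
        using c[of "\<lambda>i. B (l1 i) u"] d by simp
      then have "B l u * d = - (\<Sum>i<r. B (l1 i) u * c i)"
        by (simp add: l1_def eq_neg_iff_add_eq_0 add.commute)
      also have "(\<Sum>i<r. B (l1 i) u * c i) = (\<Sum>i<r. c i * B (l0 i) u)"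
        by (intro sum.cong) (auto simp: l1_def)
      finally have "B l u = - (\<Sum>i<r. c i * B (l0 i) u) / d"
        using l0(2) by (simp add: d_def field_simps)
      then show ?thesis by (simp add: sum_divide_distrib sum_negf)
    qed
    then show ?thesis by (intro exI[of _ "\<lambda>k. - c k / d"] ballI)
  qed
  then have "\<forall>l\<in>L. \<exists>a. \<forall>u\<in>U. B l u = (\<Sum>k<r. a k * B (l0 k) u)" by (rule ballI)
  from bchoice[OF this] have "\<exists>a. \<forall>l\<in>L. \<forall>u\<in>U. B l u = (\<Sum>k<r. a l k * B (l0 k) u)" .
  then obtain a where a: "\<forall>l\<in>L. \<forall>u\<in>U. B l u = (\<Sum>k<r. a l k * B (l0 k) u)" by (rule exE)
  show ?thesis
  proof (rule that[of r l0 u0 "\<lambda>k l. a l k"])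
    show "B l u = (\<Sum>k<r. a l k * B (l0 k) u)" if "l \<in> L" "u \<in> U" for l u
      using a that by blast
  qed (use l0 in auto)
qed

text \<open>There is one unknown more than there are equations; a zero row makes the coefficient
  matrix square and singular.\<close>

lemma homogeneous_system_nontrivial:
  fixes c :: "nat \<Rightarrow> 'i \<Rightarrow> 'a::field"
  assumes "finite I"
  shows "\<exists>p. (\<exists>n\<le>card I. p n \<noteq> 0) \<and> (\<forall>i\<in>I. (\<Sum>n\<le>card I. p n * c n i) = 0)"
proof -
  define Q where "Q = card I"
  obtain g where g: "bij_betw g {0..<Q} I"
    using ex_bij_betw_nat_finite[OF assms] by (auto simp: Q_def)
  let ?A = "Matrix.mat (Suc Q) (Suc Q) (\<lambda>(i, n). if i = Q then 0 else c n (g i))"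
  have "kdet (Suc Q) (\<lambda>i n. if i = Q then 0 else c n (g i)) = 0"
    using kdet_row_linear[of Q "Suc Q" "\<lambda>i n. c n (g i)"] by (force dest: spec[of _ "\<lambda>_. 0"])
  then obtain v where v: "v \<in> carrier_vec (Suc Q)" "v \<noteq> 0\<^sub>v (Suc Q)" "?A *\<^sub>v v = 0\<^sub>v (Suc Q)"
    using det_0_iff_vec_prod_zero[of ?A "Suc Q"] by (auto simp: kdet_def)
  have "\<exists>n\<le>Q. vec_index v n \<noteq> 0"
    using v(1,2) by (metis eq_vecI carrier_vecD index_zero_vec(1,2) less_Suc_eq_le)
  moreover have "(\<Sum>n\<le>Q. vec_index v n * c n i) = 0" if i: "i \<in> I" for i
  proof -
    obtain j where j: "j < Q" "g j = i"
    proof -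
      have "i \<in> g ` {0..<Q}" using g i by (simp add: bij_betw_def)
      then show ?thesis using that by auto
    qed
    have "vec_index (?A *\<^sub>v v) j = 0" using v(3) j(1) by simp
    then have "(\<Sum>n<Suc Q. c n i * vec_index v n) = 0"
      using j v(1) by (simp add: scalar_prod_def atLeast0LessThan carrier_vecD)
    then show ?thesis by (simp add: lessThan_Suc_atMost mult.commute)
  qed
  ultimately show ?thesis unfolding Q_def by blast
qed

section \<open>The linear recurrence\<close>

lemma pcompose_shift_degree:
  fixes p :: "complex poly"
  assumes "degree p < Suc N"
  shows "pcompose p [:s, 1:] - p = 0 \<or> degree (pcompose p [:s, 1:] - p) < N"
proof -
  let ?h = "pcompose p [:s, 1:] - p"
  have deg: "degree (pcompose p [:s, 1:]) = degree p" by (simp add: degree_pcompose)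
  then have le: "degree ?h \<le> degree p" by (intro degree_diff_le) auto
  have "lead_coeff (pcompose p [:s, 1:]) = lead_coeff p"
    by (subst lead_coeff_comp) auto
  then have "coeff ?h (degree p) = 0" using deg by simp
  then have "?h = 0 \<or> degree ?h \<noteq> degree p"
    using leading_coeff_0_iff by metis
  then show ?thesis using le assms by linarith
qed

text \<open>\<open>c\<close> holds the coefficients of the \<open>N\<close>-th forward difference
  with step \<open>s\<close>. The normalisation \<open>c N = 1\<close> lets a recurrence be solved
  for its last term; the zero polynomial is listed separately for the case
  \<open>N = 0\<close>.\<close>

lemma finite_difference_annihilates:
  fixes s :: complex
  shows "\<exists>c. c N = 1 \<and> (\<forall>p. p = 0 \<or> degree p < N \<longrightarrow> (\<Sum>n\<le>N. c n * poly p (of_nat n * s)) = 0)"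
proof (induction N)
  case 0
  then show ?case by (intro exI[of _ "\<lambda>_. 1"]) auto
next
  case (Suc N)
  then obtain c where c: "c N = 1"
    "\<And>p. p = 0 \<or> degree p < N \<Longrightarrow> (\<Sum>n\<le>N. c n * poly p (of_nat n * s)) = 0" by blast
  define c' where "c' n = (if n = 0 then 0 else c (n - 1)) - (if n \<le> N then c n else 0)" for n
  have "(\<Sum>n\<le>Suc N. c' n * poly p (of_nat n * s)) = 0" if p: "p = 0 \<or> degree p < Suc N" for p
  proof -
    have "(\<Sum>n\<le>Suc N. c' n * poly p (of_nat n * s))
      = (\<Sum>n\<le>Suc N. (if n = 0 then 0 else c (n - 1)) * poly p (of_nat n * s))
       - (\<Sum>n\<le>Suc N. (if n \<le> N then c n else 0) * poly p (of_nat n * s))"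
      by (simp only: c'_def left_diff_distrib sum_subtractf)
    also have "(\<Sum>n\<le>Suc N. (if n = 0 then 0 else c (n - 1)) * poly p (of_nat n * s))
      = (\<Sum>n\<le>N. c n * poly p (of_nat (Suc n) * s))"
      by (subst sum.atMost_Suc_shift) simp
    also have "(\<Sum>n\<le>Suc N. (if n \<le> N then c n else 0) * poly p (of_nat n * s))
      = (\<Sum>n\<le>N. c n * poly p (of_nat n * s))" by simp
    also have "(\<Sum>n\<le>N. c n * poly p (of_nat (Suc n) * s)) - (\<Sum>n\<le>N. c n * poly p (of_nat n * s))
      = (\<Sum>n\<le>N. c n * poly (pcompose p [:s, 1:] - p) (of_nat n * s))"
      by (simp add: poly_pcompose algebra_simps sum_subtractf)
    also have "\<dots> = 0"
      using p pcompose_shift_degree[of p N s] by (intro c(2)) (auto simp: pcompose_0)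
    finally show ?thesis .
  qed
  then show ?case using c(1) by (intro exI[of _ c']) (auto simp: c'_def)
qed

lemma norm_kdet_le:
  fixes A :: "nat \<Rightarrow> nat \<Rightarrow> complex"
  assumes "\<And>i j. i < n \<Longrightarrow> j < n \<Longrightarrow> norm (A i j) \<le> C"
  shows "norm (kdet n A) \<le> fact n * C ^ n"
proof -
  have "norm (kdet n A) \<le> (\<Sum>p | p permutes {0..<n}. C ^ n)"
    unfolding kdet_eq_sum
  proof (intro order.trans[OF norm_sum] sum_mono)
    fix p assume "p \<in> {p. p permutes {0..<n}}"
    then have "norm (A i (p i)) \<le> C" if "i < n" for i
      using that assms permutes_in_image[of p "{0..<n}" i] by auto
    then have "(\<Prod>i = 0..<n. norm (A i (p i))) \<le> (\<Prod>i = 0..<n. C)"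
      by (intro prod_mono) auto
    moreover have "norm (of_int (sign p) :: complex) = 1"
      by (simp add: sign_def)
    ultimately show "norm (of_int (sign p) * (\<Prod>i = 0..<n. A i (p i))) \<le> C ^ n"
      by (simp add: norm_mult prod_norm[symmetric])
  qed
  also have "\<dots> = fact n * C ^ n"
    by (simp add: card_permutations[of "{0..<n}" n])
  finally show ?thesis .
qed

lemma holomorphic_on_kdet:
  assumes "\<And>i j. i < n \<Longrightarrow> j < n \<Longrightarrow> (\<lambda>t. A t i j) holomorphic_on S"
  shows "(\<lambda>t. kdet n (A t)) holomorphic_on S"
  unfolding kdet_eq_sum
  by (intro holomorphic_on_sum holomorphic_on_mult holomorphic_on_const holomorphic_on_prod assms)
    (auto simp: permutes_in_image)

lemma polynomial_growth_imp_poly: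
  assumes "q holomorphic_on UNIV" "\<And>z. norm (q z) \<le> B * (1 + norm z) ^ D"
  shows "\<exists>P. degree P \<le> D \<and> (\<forall>z. q z = poly P z)"
proof -
  have B: "0 \<le> B" using assms(2)[of 0] by (simp add: order_trans[OF norm_ge_zero])
  have "norm (q z) \<le> (B * 2 ^ D) * norm z ^ D" if "1 \<le> norm z" for z
  proof -
    have "(1 + norm z) ^ D \<le> (2 * norm z) ^ D" using that by (intro power_mono) auto
    then have "B * (1 + norm z) ^ D \<le> B * (2 * norm z) ^ D" using B by (rule mult_left_mono)
    then show ?thesis using assms(2)[of z] by (simp add: power_mult_distrib)
  qed
  from Liouville_polynomial[OF assms(1) this]
  have "q z = poly (\<Sum>k\<le>D. Polynomial.monom ((deriv ^^ k) q 0 / fact k) k) z" for z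
    by (simp add: poly_sum poly_monom)
  moreover have "degree (\<Sum>k\<le>D. Polynomial.monom ((deriv ^^ k) q 0 / fact k) k) \<le> D"
    by (intro degree_sum_le) (auto intro: order_trans[OF degree_monom_le])
  ultimately show ?thesis by blast
qed

text \<open>A factorisation \<open>G (l + u) = \<Sum>\<^sub>k a\<^sub>k(l) G (l\<^sub>k + u)\<close> turns the matrices with entries
  \<open>G (\<alpha>\<^sub>i + t v + u\<^sub>j + cnj t v')\<close> into products, so that their determinants are
  \<open>\<Delta>(\<alpha> + t v)\<close> times a function \<open>w\<close> of \<open>cnj t\<close> alone. After replacing \<open>w\<close> by its conjugate the
  product is entire and polynomially bounded, hence a polynomial whose degree does not depend on
  \<open>\<alpha>\<close>. Finite differences then yield a linear recurrence for the \<open>a\<^sub>k\<close>.\<close>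
lemma shift_recurrence:
  fixes G :: "complex^'d::finite \<Rightarrow> complex"
  assumes L: "\<And>x y. x \<in> L \<Longrightarrow> y \<in> L \<Longrightarrow> x + y \<in> L" "\<And>c x. x \<in> L \<Longrightarrow> c *s x \<in> L"
    and U: "\<And>x y. x \<in> U \<Longrightarrow> y \<in> U \<Longrightarrow> x + y \<in> U" "\<And>c x. x \<in> U \<Longrightarrow> c *s x \<in> U"
    and v: "v \<in> L" "v' \<in> U"
    and hol: "\<And>k w. (\<lambda>t. G (k + t *s w)) holomorphic_on UNIV"
    and growth: "\<And>k. \<exists>C. \<forall>t. norm (G (k + (t *s v + cnj t *s v'))) \<le> C * (1 + norm t) ^ p"
    and rank: "\<And>l u. (\<And>i. i < Suc m \<Longrightarrow> l i \<in> L \<and> u i \<in> U) \<Longrightarrow> kdet (Suc m) (\<lambda>i j. G (l i + u j)) = 0"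
  shows "\<exists>s P Q. s \<noteq> 0 \<and> (\<exists>n\<le>Q. P n \<noteq> 0) \<and>
    (\<forall>l\<in>L. \<forall>u\<in>U. (\<Sum>n\<le>Q. P n * G (l + u + (of_nat n * s) *s v)) = 0)"
proof -
  obtain r l0 u0 a where l0: "\<And>i. i < r \<Longrightarrow> l0 i \<in> L" and u0: "\<And>i. i < r \<Longrightarrow> u0 i \<in> U"
    and d0: "kdet r (\<lambda>i j. G (l0 i + u0 j)) \<noteq> 0"
    and a: "\<And>l u. l \<in> L \<Longrightarrow> u \<in> U \<Longrightarrow> G (l + u) = (\<Sum>k<r. a k l * G (l0 k + u))"
    using finite_rank_kernel[of m L U "\<lambda>l u. G (l + u)", OF rank] by blast
  define d where "d = kdet r (\<lambda>i j. G (l0 i + u0 j))"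
  define \<Delta> where "\<Delta> \<alpha> = kdet r (\<lambda>i k. a k (\<alpha> i))" for \<alpha>
  have factor: "kdet r (\<lambda>i j. G (\<alpha> i + \<beta> j)) = \<Delta> \<alpha> * kdet r (\<lambda>i j. G (l0 i + \<beta> j))"
    if "\<And>i. i < r \<Longrightarrow> \<alpha> i \<in> L" "\<And>i. i < r \<Longrightarrow> \<beta> i \<in> U" for \<alpha> \<beta>
    unfolding \<Delta>_def kdet_mult[symmetric] using that by (intro kdet_cong a)
  \<comment> \<open>The coefficients at the base points form the identity matrix; below this turns
    all rows but one into unit vectors.\<close>
  have a_l0: "a k (l0 i) = of_bool (i = k)" if "i < r" "k < r" for i k
    by (rule kdet_inverse_unique[where M = "\<lambda>i j. G (l0 i + u0 j)", OF d0 _ that])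
      (simp add: a[symmetric] l0 u0)
  define w where "w t = kdet r (\<lambda>i j. G (l0 i + (u0 j + t *s v')))" for t
  have hol_w: "w holomorphic_on UNIV"
    unfolding w_def using hol by (intro holomorphic_on_kdet) (simp add: add.assoc[symmetric])
  \<comment> \<open>\<open>w\<close> occurs at \<open>cnj t\<close>. Conjugating inside and outside
    gives an entire function of \<open>t\<close> whose modulus is that of \<open>w (cnj t)\<close>,
    so the growth bound carries over to a holomorphic product.\<close>
  define w' where "w' = cnj \<circ> w \<circ> cnj"
  have hol_w': "w' holomorphic_on UNIV"
    unfolding w'_def by (intro holomorphic_on_compose_cnj_cnj holomorphic_on_subset[OF hol_w]) auto
  \<comment> \<open>A determinant with \<open>r\<close> rows and entries of growth \<open>p\<close>.
    As \<open>D\<close> does not depend on \<open>\<alpha>\<close>, one difference operator serves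
    for every \<open>\<alpha>\<close>.\<close>
  define D where "D = r * p"
  have poly: "\<exists>P. degree P \<le> D \<and> (\<forall>t. d * \<Delta> (\<lambda>i. \<alpha> i + t *s v) * w' t = poly P t)"
    if \<alpha>: "\<And>i. i < r \<Longrightarrow> \<alpha> i \<in> L" for \<alpha>
  proof -
    have \<alpha>v: "\<alpha> i + t *s v \<in> L" if "i < r" for i t
      using L v \<alpha>[OF that] by auto
    have "d * \<Delta> (\<lambda>i. \<alpha> i + t *s v) = kdet r (\<lambda>i j. G ((\<alpha> i + u0 j) + t *s v))" for t
    proof -
      have "kdet r (\<lambda>i j. G (\<alpha> i + t *s v + u0 j)) = \<Delta> (\<lambda>i. \<alpha> i + t *s v) * d"
        unfolding d_def by (rule factor) (auto intro: \<alpha>v u0)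
      then show ?thesis by (simp add: add_ac mult.commute)
    qed
    then have hol_q: "(\<lambda>t. d * \<Delta> (\<lambda>i. \<alpha> i + t *s v) * w' t) holomorphic_on UNIV"
      by (simp only:) (intro holomorphic_on_mult holomorphic_on_kdet hol hol_w')
    obtain C where C: "\<And>k t. norm (G (k + (t *s v + cnj t *s v'))) \<le> C k * (1 + norm t) ^ p"
      using growth by metis
    define C' where "C' = Max (insert 0 ((\<lambda>(i, j). C (\<alpha> i + u0 j)) ` ({..<r} \<times> {..<r})))"
    have C': "C (\<alpha> i + u0 j) \<le> C'" if "i < r" "j < r" for i j
      unfolding C'_def using that by (intro Max_ge) auto
    have bound: "norm (d * \<Delta> (\<lambda>i. \<alpha> i + t *s v) * w' t) \<le> (norm d * fact r * C' ^ r) * (1 + norm t) ^ D" for t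
    proof -
      have "norm (kdet r (\<lambda>i j. G (\<alpha> i + t *s v + (u0 j + cnj t *s v')))) \<le> fact r * (C' * (1 + norm t) ^ p) ^ r"
      proof (rule norm_kdet_le)
        fix i j assume ij: "i < r" "j < r"
        have "norm (G ((\<alpha> i + u0 j) + (t *s v + cnj t *s v'))) \<le> C (\<alpha> i + u0 j) * (1 + norm t) ^ p" by (rule C)
        also have "\<dots> \<le> C' * (1 + norm t) ^ p" using C'[OF ij] by (intro mult_right_mono) auto
        finally show "norm (G (\<alpha> i + t *s v + (u0 j + cnj t *s v'))) \<le> C' * (1 + norm t) ^ p"
          by (simp add: add_ac)
      qed
      also have "kdet r (\<lambda>i j. G (\<alpha> i + t *s v + (u0 j + cnj t *s v'))) = \<Delta> (\<lambda>i. \<alpha> i + t *s v) * w (cnj t)"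
        unfolding w_def using \<alpha>v U v u0 by (intro factor) auto
      finally have "norm (\<Delta> (\<lambda>i. \<alpha> i + t *s v)) * norm (w' t) \<le> fact r * (C' * (1 + norm t) ^ p) ^ r"
        by (simp add: w'_def norm_mult)
      then have "norm d * (norm (\<Delta> (\<lambda>i. \<alpha> i + t *s v)) * norm (w' t)) \<le> norm d * (fact r * (C' * (1 + norm t) ^ p) ^ r)"
        by (rule mult_left_mono) simp
      then show ?thesis
        by (simp add: norm_mult mult.assoc D_def power_mult_distrib power_mult[symmetric] mult.commute[of r p])
    qed
    show ?thesis by (rule polynomial_growth_imp_poly[OF hol_q bound])
  qed
  have "continuous_on UNIV w'" using hol_w' by (rule holomorphic_on_imp_continuous_on)
  moreover have "w' 0 \<noteq> 0" using d0 by (simp add: w'_def w_def)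
  ultimately obtain \<delta> where \<delta>: "\<delta> > 0" "\<And>t. dist t 0 < \<delta> \<Longrightarrow> dist (w' t) (w' 0) < dist (w' 0) 0"
    unfolding continuous_on_iff by (metis UNIV_I zero_less_dist_iff)
  \<comment> \<open>The step puts \<open>Suc D * s\<close> at \<open>\<delta> / 2\<close>, where
    \<open>w'\<close> is nonzero; the last coefficient \<open>\<gamma> (Suc D)\<close> of the
    recurrence is then nonzero.\<close>
  define s where "s = complex_of_real (\<delta> / (2 * real (Suc D)))"
  have s: "s \<noteq> 0" using \<delta>(1) unfolding s_def of_real_eq_0_iff by simp
  have "complex_of_real (real (Suc D) * (\<delta> / (2 * real (Suc D)))) = complex_of_real (\<delta> / 2)"
    by (simp del: of_nat_Suc)
  then have Ds: "of_nat (Suc D) * s = complex_of_real (\<delta> / 2)"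
    unfolding s_def by (simp only: of_real_mult of_real_of_nat_eq)
  have "dist (of_nat (Suc D) * s) 0 < \<delta>"
    unfolding Ds dist_norm diff_zero norm_of_real using \<delta>(1) by simp
  then have w'_s: "w' (of_nat (Suc D) * s) \<noteq> 0" using \<delta>(2) by (metis dist_commute less_irrefl)
  obtain c where c: "c (Suc D) = 1"
    "\<And>P. P = 0 \<or> degree P < Suc D \<Longrightarrow> (\<Sum>n\<le>Suc D. c n * poly P (of_nat n * s)) = 0"
    using finite_difference_annihilates[of "Suc D" s] by blast
  define \<gamma> where "\<gamma> n = c n * w' (of_nat n * s)" for n
  define sv where "sv n = (of_nat n * s) *s v" for n
  have sv: "sv n \<in> L" for n using L v by (simp add: sv_def)
  have sv_add: "sv (n + n') = sv n + sv n'" for n n'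
    by (simp add: sv_def algebra_simps vector_sadd_rdistrib)
  have \<gamma>: "(\<Sum>n\<le>Suc D. \<gamma> n * \<Delta> (\<lambda>i. \<alpha> i + sv n)) = 0"
    if \<alpha>: "\<And>i. i < r \<Longrightarrow> \<alpha> i \<in> L" for \<alpha>
  proof -
    obtain P where P: "degree P \<le> D" "\<And>t. d * \<Delta> (\<lambda>i. \<alpha> i + t *s v) * w' t = poly P t"
      using poly[of \<alpha>, OF \<alpha>] by blast
    have "d * (\<Sum>n\<le>Suc D. \<gamma> n * \<Delta> (\<lambda>i. \<alpha> i + sv n)) = (\<Sum>n\<le>Suc D. c n * poly P (of_nat n * s))"
      unfolding sum_distrib_left P(2)[symmetric] \<gamma>_def sv_def by (intro sum.cong) (auto simp: mult_ac)
    also have "\<dots> = 0" using P(1) by (intro c(2)) auto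
    finally show ?thesis using d0 by (simp add: d_def)
  qed
  have "\<exists>e. \<forall>l\<in>L. a k (l + sv (Suc D)) = (\<Sum>n\<le>D. \<Sum>j<r. e n j * a j (l + sv n))" if k: "k < r" for k
  proof -
    define R where "R n i j = a j (l0 i + (- 1) *s sv (Suc D) + sv n)" for n i j
    have "\<exists>b. \<forall>y. kdet r (\<lambda>i j. if i = k then y j else R n i j) = (\<Sum>j<r. y j * b j)" for n
      by (rule kdet_row_linear[OF k])
    then obtain b where b: "\<And>n y. kdet r (\<lambda>i j. if i = k then y j else R n i j) = (\<Sum>j<r. y j * b n j)" by metis
    have "a k (l + sv (Suc D)) = (\<Sum>n\<le>D. \<Sum>j<r. (- \<gamma> n * b n j / \<gamma> (Suc D)) * a j (l + sv n))" if l: "l \<in> L" for l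
    proof -
      \<comment> \<open>Shifting the base points back by \<open>sv (Suc D)\<close> makes every row
        except \<open>k\<close> a unit vector in the last term, whose determinant is thus
        \<open>a k (l + sv (Suc D))\<close>. In the earlier terms the determinant is linear in row
        \<open>k\<close>, that is in the values \<open>a j (l + sv n)\<close>.\<close>
      define \<alpha> where "\<alpha> i = (if i = k then l else l0 i + (- 1) *s sv (Suc D))" for i
      have \<alpha>: "\<alpha> i \<in> L" if "i < r" for i
        unfolding \<alpha>_def using l L(1)[OF l0[OF that] L(2)[OF sv[of "Suc D"], of "- 1"]] by (cases "i = k") simp_all
      have "\<Delta> (\<lambda>i. \<alpha> i + sv n) = (\<Sum>j<r. a j (l + sv n) * b n j)" for n
        unfolding \<Delta>_def b[symmetric] by (intro kdet_cong) (auto simp: \<alpha>_def R_def)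
      moreover have "\<Delta> (\<lambda>i. \<alpha> i + sv (Suc D)) = kdet r (\<lambda>i j. if i = k then a j (l + sv (Suc D)) else of_bool (i = j))"
        unfolding \<Delta>_def by (intro kdet_cong) (auto simp: \<alpha>_def a_l0)
      then have "\<Delta> (\<lambda>i. \<alpha> i + sv (Suc D)) = a k (l + sv (Suc D))"
        by (simp only: kdet_unit_rows[OF k])
      ultimately have "\<gamma> (Suc D) * a k (l + sv (Suc D)) = - (\<Sum>n\<le>D. \<gamma> n * (\<Sum>j<r. a j (l + sv n) * b n j))"
        using \<gamma>[of \<alpha>, OF \<alpha>] by (simp add: eq_neg_iff_add_eq_0 add.commute)
      moreover have "\<gamma> (Suc D) \<noteq> 0" using w'_s c(1) by (simp add: \<gamma>_def)
      ultimately have "a k (l + sv (Suc D)) = - (\<Sum>n\<le>D. \<gamma> n * (\<Sum>j<r. a j (l + sv n) * b n j)) / \<gamma> (Suc D)"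
        by (metis nonzero_mult_div_cancel_left)
      also have "\<dots> = (\<Sum>n\<le>D. \<Sum>j<r. (- \<gamma> n * b n j / \<gamma> (Suc D)) * a j (l + sv n))"
        by (simp add: sum_negf sum_divide_distrib sum_distrib_left mult_ac)
      finally show ?thesis .
    qed
    then show ?thesis by (intro exI[of _ "\<lambda>n j. - \<gamma> n * b n j / \<gamma> (Suc D)"] ballI)
  qed
  then have "\<forall>k. \<exists>e. k < r \<longrightarrow> (\<forall>l\<in>L. a k (l + sv (Suc D)) = (\<Sum>n\<le>D. \<Sum>j<r. e n j * a j (l + sv n)))" by auto
  from choice[OF this] obtain e where
    e: "\<And>k l. k < r \<Longrightarrow> l \<in> L \<Longrightarrow> a k (l + sv (Suc D)) = (\<Sum>n\<le>D. \<Sum>j<r. e k n j * a j (l + sv n))" by auto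
  \<comment> \<open>By the recurrence all shifts of all \<open>a k\<close> lie in the span of the
    finitely many functions \<open>y i\<close>. Hence some nontrivial combination of shifts, with
    coefficients independent of \<open>k\<close>, annihilates every \<open>a k\<close>.\<close>
  define I where "I = {..D} \<times> {..<r}"
  have fin_I: "finite I" by (simp add: I_def)
  define y where "y i l = a (snd i) (l + sv (fst i))" for i :: "nat \<times> nat" and l
  define inS where "inS f \<longleftrightarrow> (\<exists>C. \<forall>l\<in>L. f l = (\<Sum>i\<in>I. C i * y i l))" for f
  have inS_sum: "inS (\<lambda>l. \<Sum>j\<in>J. b j * f j l)" if "\<And>j. j \<in> J \<Longrightarrow> inS (f j)" for J b and f :: "nat \<times> nat \<Rightarrow> complex^'d \<Rightarrow> complex"
  proof -
    have "\<forall>j\<in>J. \<exists>C. \<forall>l\<in>L. f j l = (\<Sum>i\<in>I. C i * y i l)" using that by (simp add: inS_def)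
    from bchoice[OF this] obtain C where C: "\<And>j l. j \<in> J \<Longrightarrow> l \<in> L \<Longrightarrow> f j l = (\<Sum>i\<in>I. C j i * y i l)" by auto
    have "(\<Sum>j\<in>J. b j * f j l) = (\<Sum>i\<in>I. (\<Sum>j\<in>J. b j * C j i) * y i l)" if "l \<in> L" for l
    proof -
      have "(\<Sum>j\<in>J. b j * f j l) = (\<Sum>j\<in>J. \<Sum>i\<in>I. b j * C j i * y i l)"
        using C that by (simp add: sum_distrib_left mult.assoc)
      also have "\<dots> = (\<Sum>i\<in>I. \<Sum>j\<in>J. b j * C j i * y i l)" by (rule sum.swap)
      finally show ?thesis by (simp add: sum_distrib_right)
    qed
    then show ?thesis unfolding inS_def by (intro exI[of _ "\<lambda>i. \<Sum>j\<in>J. b j * C j i"] ballI)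
  qed
  have inS: "inS (\<lambda>l. a k (l + sv n))" if "k < r" for n k
    using that
  proof (induction n arbitrary: k rule: less_induct)
    case (less n)
    show ?case
    proof (cases "n \<le> D")
      case True
      then have "(n, k) \<in> I" using less.prems by (simp add: I_def)
      then have "a k (l + sv n) = (\<Sum>i\<in>I. of_bool (i = (n, k)) * y i l)" for l
        using fin_I by (simp add: y_def of_bool_def if_distrib[of "\<lambda>x. x * _"] sum.delta' cong: if_cong)
      then show ?thesis unfolding inS_def by (intro exI[of _ "\<lambda>i. of_bool (i = (n, k))"] ballI)
    next
      case False
      define n' where "n' = n - Suc D"
      have n: "n = n' + Suc D" using False by (simp add: n'_def)
      have "a k (l + sv n) = (\<Sum>i\<in>I. e k (fst i) (snd i) * a (snd i) (l + sv (n' + fst i)))" if l: "l \<in> L" for l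
      proof -
        have "a k (l + sv n) = a k ((l + sv n') + sv (Suc D))" by (simp only: n sv_add add.assoc)
        also have "\<dots> = (\<Sum>n\<le>D. \<Sum>j<r. e k n j * a j ((l + sv n') + sv n))"
          using L l sv less.prems by (intro e) auto
        finally show ?thesis by (simp add: I_def sum.cartesian_product sv_add add.assoc case_prod_unfold)
      qed
      moreover have "inS (\<lambda>l. \<Sum>i\<in>I. e k (fst i) (snd i) * a (snd i) (l + sv (n' + fst i)))"
        by (rule inS_sum, rule less.IH) (auto simp: I_def n)
      ultimately show ?thesis unfolding inS_def by simp
    qed
  qed
  then have "\<forall>n k. \<exists>C. k < r \<longrightarrow> (\<forall>l\<in>L. a k (l + sv n) = (\<Sum>i\<in>I. C i * y i l))"
    unfolding inS_def by auto
  then obtain C where C: "\<And>n k l. k < r \<Longrightarrow> l \<in> L \<Longrightarrow> a k (l + sv n) = (\<Sum>i\<in>I. C n k i * y i l)"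
    by metis
  define Q where "Q = card ({..<r} \<times> I)"
  obtain P where P: "\<exists>n\<le>Q. P n \<noteq> 0" "\<And>k i. k < r \<Longrightarrow> i \<in> I \<Longrightarrow> (\<Sum>n\<le>Q. P n * C n k i) = 0"
    using homogeneous_system_nontrivial[of "{..<r} \<times> I" "\<lambda>n (k, i). C n k i"] fin_I unfolding Q_def
    by (auto simp: Ball_def)
  have P_a: "(\<Sum>n\<le>Q. P n * a k (l + sv n)) = 0" if "k < r" "l \<in> L" for k l
  proof -
    have "(\<Sum>n\<le>Q. P n * a k (l + sv n)) = (\<Sum>n\<le>Q. \<Sum>i\<in>I. P n * C n k i * y i l)"
      using C that by (simp add: sum_distrib_left mult.assoc)
    also have "\<dots> = (\<Sum>i\<in>I. \<Sum>n\<le>Q. P n * C n k i * y i l)" by (rule sum.swap)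
    also have "\<dots> = 0" using P(2)[OF that(1)] by (simp add: sum_distrib_right[symmetric])
    finally show ?thesis .
  qed
  have "(\<Sum>n\<le>Q. P n * G (l + u + (of_nat n * s) *s v)) = 0" if "l \<in> L" "u \<in> U" for l u
  proof -
    have "G (l + u + (of_nat n * s) *s v) = (\<Sum>k<r. a k (l + sv n) * G (l0 k + u))" for n
      using a[of "l + sv n" u] that L sv by (simp add: sv_def add_ac)
    then have "(\<Sum>n\<le>Q. P n * G (l + u + (of_nat n * s) *s v)) = (\<Sum>n\<le>Q. \<Sum>k<r. P n * a k (l + sv n) * G (l0 k + u))"
      by (simp add: sum_distrib_left mult.assoc)
    also have "\<dots> = (\<Sum>k<r. \<Sum>n\<le>Q. P n * a k (l + sv n) * G (l0 k + u))" by (rule sum.swap)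
    also have "\<dots> = 0" using P_a that(1) by (simp add: sum_distrib_right[symmetric])
    finally show ?thesis .
  qed
  then show ?thesis using s P(1) by blast
qed

section \<open>Harmonic polynomials and compactly supported distributions\<close>

text \<open>Terms with equal exponents are collected, so any finite index set is allowed; sums and
  products of polynomials produce such repetitions.\<close>

lemma polynomial_funI:
  fixes f :: "real^'d::finite \<Rightarrow> complex"
  assumes "finite J" "\<And>x. f x = (\<Sum>j\<in>J. c j * (\<Prod>i\<in>UNIV. complex_of_real ((x $ i) ^ \<alpha> j i)))"
  shows "polynomial_fun f"
proof -
  define c' where "c' a = (\<Sum>j | j \<in> J \<and> \<alpha> j = a. c j)" for a
  have sub: "{a. c' a \<noteq> 0} \<subseteq> \<alpha> ` J"
    by (auto simp: c'_def intro!: sum.neutral)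
  have "f x = (\<Sum>a | c' a \<noteq> 0. c' a * (\<Prod>i\<in>UNIV. complex_of_real ((x $ i) ^ a i)))" for x
  proof -
    have "f x = (\<Sum>a\<in>\<alpha> ` J. \<Sum>j | j \<in> J \<and> \<alpha> j = a. c j * (\<Prod>i\<in>UNIV. complex_of_real ((x $ i) ^ \<alpha> j i)))"
      unfolding assms(2) by (rule sum.image_gen[OF assms(1)])
    also have "\<dots> = (\<Sum>a\<in>\<alpha> ` J. c' a * (\<Prod>i\<in>UNIV. complex_of_real ((x $ i) ^ a i)))"
      unfolding c'_def sum_distrib_right by (intro sum.cong) auto
    also have "\<dots> = (\<Sum>a | c' a \<noteq> 0. c' a * (\<Prod>i\<in>UNIV. complex_of_real ((x $ i) ^ a i)))"
      using assms(1) sub by (intro sum.mono_neutral_right) auto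
    finally show ?thesis .
  qed
  moreover have "finite {a. c' a \<noteq> 0}"
    using sub assms(1) finite_subset by blast
  ultimately show ?thesis unfolding polynomial_fun_def by blast
qed

lemma polynomial_funE:
  fixes f :: "real^'d::finite \<Rightarrow> complex"
  assumes "polynomial_fun f"
  shows "\<exists>(J :: ('d \<Rightarrow> nat) set) c. finite J \<and> (\<forall>x. f x = (\<Sum>a\<in>J. c a * (\<Prod>i\<in>UNIV. complex_of_real ((x $ i) ^ a i))))"
  using assms unfolding polynomial_fun_def by blast

lemma polynomial_fun_const: "polynomial_fun (\<lambda>x. c)"
  by (rule polynomial_funI[of "{()}" _ "\<lambda>_. c" "\<lambda>_ _. 0"]) auto

lemma polynomial_fun_add:
  assumes "polynomial_fun f" "polynomial_fun g"
  shows "polynomial_fun (\<lambda>x. f x + g x)"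
proof -
  obtain J c where f: "finite J" "\<And>x. f x = (\<Sum>a\<in>J. c a * (\<Prod>i\<in>UNIV. complex_of_real ((x $ i) ^ a i)))"
    using polynomial_funE[OF assms(1)] by blast
  obtain J' c' where g: "finite J'" "\<And>x. g x = (\<Sum>a\<in>J'. c' a * (\<Prod>i\<in>UNIV. complex_of_real ((x $ i) ^ a i)))"
    using polynomial_funE[OF assms(2)] by blast
  show ?thesis
  proof (rule polynomial_funI)
    show "finite (J <+> J')" using f(1) g(1) by simp
    show "f x + g x = (\<Sum>j\<in>J <+> J'. case_sum c c' j * (\<Prod>i\<in>UNIV. complex_of_real ((x $ i) ^ case_sum id id j i)))" for x
      using f g by (simp add: sum.Plus)
  qed
qed

lemma polynomial_fun_mult:
  assumes "polynomial_fun f" "polynomial_fun g"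
  shows "polynomial_fun (\<lambda>x. f x * g x)"
proof -
  obtain J c where f: "finite J" "\<And>x. f x = (\<Sum>a\<in>J. c a * (\<Prod>i\<in>UNIV. complex_of_real ((x $ i) ^ a i)))"
    using polynomial_funE[OF assms(1)] by blast
  obtain J' c' where g: "finite J'" "\<And>x. g x = (\<Sum>a\<in>J'. c' a * (\<Prod>i\<in>UNIV. complex_of_real ((x $ i) ^ a i)))"
    using polynomial_funE[OF assms(2)] by blast
  show ?thesis
  proof (rule polynomial_funI)
    show "finite (J \<times> J')" using f(1) g(1) by simp
    show "f x * g x = (\<Sum>j\<in>J \<times> J'. (c (fst j) * c' (snd j)) *
        (\<Prod>i\<in>UNIV. complex_of_real ((x $ i) ^ (fst j i + snd j i))))" for x
      unfolding f(2) g(2) sum_product sum.cartesian_product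
      by (intro sum.cong) (auto simp: power_add prod.distrib mult_ac)
  qed
qed

lemma polynomial_fun_sum:
  "(\<And>j. j \<in> J \<Longrightarrow> polynomial_fun (f j)) \<Longrightarrow> polynomial_fun (\<lambda>x. \<Sum>j\<in>J. f j x)"
  by (induction J rule: infinite_finite_induct) (auto intro: polynomial_fun_const polynomial_fun_add)

lemma polynomial_fun_lin: "polynomial_fun (lin k)"
proof -
  have "polynomial_fun (\<lambda>x. complex_of_real (x $ i))" for i :: 'a
  proof (rule polynomial_funI[of "{()}"])
    have "(\<Prod>j\<in>UNIV. complex_of_real ((x $ j) ^ of_bool (j = i))) = (\<Prod>j\<in>UNIV. if j = i then complex_of_real (x $ i) else 1)" for x
      by (intro prod.cong) auto
    then show "complex_of_real (x $ i) = (\<Sum>_\<in>{()}. 1 * (\<Prod>j\<in>UNIV. complex_of_real ((x $ j) ^ of_bool (j = i))))" for x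
      by simp
  qed simp
  then show ?thesis
    unfolding lin_def[abs_def] by (intro polynomial_fun_sum polynomial_fun_mult polynomial_fun_const)
qed

lemma smooth_polynomial_fun:
  assumes "polynomial_fun f"
  shows "smooth f"
proof -
  obtain J c where f: "f = (\<lambda>x. \<Sum>a\<in>J. c a * (\<Prod>i\<in>UNIV. complex_of_real ((x $ i) ^ a i)))"
    using polynomial_funE[OF assms] by blast
  have "smooth (\<lambda>x. complex_of_real (x $ i))" for i :: 'a
    using smooth_lin[of "axis i 1"] by (simp add: lin_axis[abs_def])
  then show ?thesis
    unfolding f of_real_power by (intro smooth_sum smooth_cmult smooth_prod smooth_power)
qed

text \<open>The sum of suprema becomes a single bound \<open>b\<close>, the form in which later
  estimates arrive; taking absolute values fixes the sign of the constant.\<close>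

lemma compact_distribution_bound:
  fixes F :: "(real^'d::finite \<Rightarrow> complex) \<Rightarrow> complex"
  assumes "compact_distribution F"
  obtains K C N where "compact K" "K \<noteq> {}" "0 \<le> C"
    "\<And>\<phi> b. smooth \<phi> \<Longrightarrow> (\<And>is x. length is \<le> N \<Longrightarrow> x \<in> K \<Longrightarrow> norm (pdiffs is \<phi> x) \<le> b) \<Longrightarrow> norm (F \<phi>) \<le> C * b"
proof -
  obtain K C N where K: "compact K" and
    bound: "\<And>\<phi>. smooth \<phi> \<Longrightarrow> norm (F \<phi>) \<le> C * (\<Sum>is\<in>{is::'d list. length is \<le> N}. SUP x\<in>K. norm (pdiffs is \<phi> x))"
    using assms unfolding compact_distribution_def by blast
  show ?thesis
  proof (cases "K = {}")
    case False
    define M where "M = \<bar>C\<bar> * real (card {is::'d list. length is \<le> N})"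
    have "norm (F \<phi>) \<le> M * b" if \<phi>: "smooth \<phi>"
      "\<And>is x. length is \<le> N \<Longrightarrow> x \<in> K \<Longrightarrow> norm (pdiffs is \<phi> x) \<le> b" for \<phi> b
    proof -
      have bdd: "bdd_above ((\<lambda>x. norm (pdiffs is \<phi> x)) ` K)" if "length is \<le> N" for "is"
        using \<phi>(2)[OF that] by (intro bdd_aboveI2)
      have "0 \<le> (SUP x\<in>K. norm (pdiffs is \<phi> x))" if "length is \<le> N" for "is"
      proof -
        obtain x where "x \<in> K" using False by auto
        then show ?thesis by (rule cSUP_upper2[OF bdd[OF that]]) simp
      qed
      then have "C * (\<Sum>is\<in>{is::'d list. length is \<le> N}. SUP x\<in>K. norm (pdiffs is \<phi> x))
          \<le> \<bar>C\<bar> * (\<Sum>is\<in>{is::'d list. length is \<le> N}. SUP x\<in>K. norm (pdiffs is \<phi> x))"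
        by (intro mult_right_mono sum_nonneg) auto
      also have "\<dots> \<le> \<bar>C\<bar> * (\<Sum>is\<in>{is::'d list. length is \<le> N}. b)"
        using \<phi>(2) False by (intro mult_left_mono sum_mono cSUP_least) auto
      also have "\<dots> = M * b" by (simp add: M_def)
      finally show ?thesis using bound[OF \<phi>(1)] by linarith
    qed
    then show ?thesis using that[of K M N] K False by (simp add: M_def)
  next
    case True
    \<comment> \<open>For empty \<open>K\<close> the suprema have a fixed value, so one constant
      bounds \<open>F\<close> on all smooth functions. Scaling then forces \<open>F = 0\<close>, and
      \<open>{0}\<close> can serve as the compact set.\<close>
    define B where "B = C * (\<Sum>is\<in>{is::'d list. length is \<le> N}. Sup {})"
    have B: "norm (F \<phi>) \<le> B" if "smooth \<phi>" for \<phi>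
      using bound[OF that] True by (simp add: B_def)
    have "F \<phi> = 0" if "smooth \<phi>" for \<phi>
    proof (rule ccontr)
      assume nz: "F \<phi> \<noteq> 0"
      obtain n where n: "B < real n * norm (F \<phi>)" using nz ex_less_of_nat_mult[of "norm (F \<phi>)" B] by auto
      have "F (\<lambda>x. of_nat n * \<phi> x + 0 * \<phi> x) = of_nat n * F \<phi> + 0 * F \<phi>"
        using assms that unfolding compact_distribution_def by blast
      then have "norm (F (\<lambda>x. of_nat n * \<phi> x)) = real n * norm (F \<phi>)" by (simp add: norm_mult)
      then show False using B[OF smooth_cmult[OF that, of "of_nat n"]] n by simp
    qed
    then show ?thesis using that[of "{0}" 0 0] by simp
  qed
qed

lemma compact_distribution_linear:
  assumes "compact_distribution F"
  shows compact_distribution_add: "smooth \<phi> \<Longrightarrow> smooth \<psi> \<Longrightarrow> F (\<lambda>x. \<phi> x + \<psi> x) = F \<phi> + F \<psi>"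
    and compact_distribution_cmult: "smooth \<phi> \<Longrightarrow> F (\<lambda>x. c * \<phi> x) = c * F \<phi>"
proof -
  have lin: "F (\<lambda>x. a * \<phi> x + b * \<psi> x) = a * F \<phi> + b * F \<psi>" if "smooth \<phi>" "smooth \<psi>" for \<phi> \<psi> a b
    using assms that unfolding compact_distribution_def by blast
  show "smooth \<phi> \<Longrightarrow> smooth \<psi> \<Longrightarrow> F (\<lambda>x. \<phi> x + \<psi> x) = F \<phi> + F \<psi>"
    using lin[of \<phi> \<psi> 1 1] by simp
  show "smooth \<phi> \<Longrightarrow> F (\<lambda>x. c * \<phi> x) = c * F \<phi>"
    using lin[of \<phi> \<phi> c 0] by simp
qed

lemma cont_functionalI_bound:
  fixes F :: "(real^'d::finite \<Rightarrow> complex) \<Rightarrow> complex"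
  assumes add: "\<And>\<phi> \<psi>. smooth \<phi> \<Longrightarrow> smooth \<psi> \<Longrightarrow> F (\<lambda>x. \<phi> x + \<psi> x) = F \<phi> + F \<psi>"
    and cmult: "\<And>c \<phi>. smooth \<phi> \<Longrightarrow> F (\<lambda>x. c * \<phi> x) = c * F \<phi>"
    and C: "0 \<le> C" and bound: "\<And>\<phi> b. smooth \<phi> \<Longrightarrow>
      (\<And>is x. length is \<le> N \<Longrightarrow> x \<in> K \<Longrightarrow> norm (pdiffs is \<phi> x) \<le> b) \<Longrightarrow> norm (F \<phi>) \<le> C * b"
  shows "cont_functional K F"
  unfolding cont_functional_def
proof (intro conjI allI impI)
  fix \<phi>s \<phi> assume conv: "Cconv K \<phi>s \<phi>"
  note s = Cconv_smooth[OF conv]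
  have diff: "F (\<phi>s k) - F \<phi> = F (\<lambda>x. \<phi>s k x - \<phi> x)" for k
    using add[OF s(1)[of k] smooth_cmult[OF s(2), of "-1"]] cmult[OF s(2), of "-1"] by simp
  show "(\<lambda>k. F (\<phi>s k)) \<longlonglongrightarrow> F \<phi>"
  proof (rule tendstoI)
    fix e :: real assume e: "0 < e"
    define e' where "e' = e / (2 * (C + 1))"
    have "e' * (2 * (C + 1)) = e" using C by (simp add: e'_def)
    then have "2 * (C * e') + 2 * e' = e" by (simp add: algebra_simps)
    moreover have "0 < e'" using e C by (simp add: e'_def)
    ultimately have e': "0 < e'" "C * e' < e" using e by linarith+
    have fin: "finite {is :: 'd list. length is \<le> N}"
      using finite_lists_length_le[of "UNIV :: 'd set" N] by simp
    have "\<forall>\<^sub>F k in sequentially. \<forall>is\<in>{is. length is \<le> N}. \<forall>x\<in>K. dist (pdiffs is (\<phi>s k) x) (pdiffs is \<phi> x) < e'"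
      by (rule eventually_ball_finite[OF fin], rule ballI, rule uniform_limitD[OF Cconv_uniform_limit[OF conv] e'(1)])
    then show "\<forall>\<^sub>F k in sequentially. dist (F (\<phi>s k)) (F \<phi>) < e"
    proof eventually_elim
      case (elim k)
      have "norm (F (\<lambda>x. \<phi>s k x - \<phi> x)) \<le> C * e'"
      proof (rule bound)
        fix "is" :: "'d list" and x assume "length is \<le> N" "x \<in> K"
        then show "norm (pdiffs is (\<lambda>x. \<phi>s k x - \<phi> x) x) \<le> e'"
          using elim by (simp add: pdiffs_diff s dist_norm less_imp_le)
      qed (intro smooth_diff s)
      then show ?case using e'(2) by (simp add: dist_norm diff)
    qed
  qed
qed (use add cmult in auto)

text \<open>The truncations of \<open>E (t *s w)\<close> converge in the smooth topology, so
  applying \<open>F\<close> to them gives a power series in \<open>t\<close> that converges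
  everywhere.\<close>

lemma holomorphic_functional_E:
  assumes "compact K" "cont_functional K F"
  shows "(\<lambda>t. F (E (k + t *s w))) holomorphic_on UNIV"
proof -
  define c where "c n = F (\<lambda>x. E k x * lin w x ^ n) / fact n" for n
  have "(\<lambda>n. c n * t ^ n) sums F (E (k + t *s w))" for t
  proof -
    have "Cconv K (\<lambda>n x. E k x * exp_upto n (lin (t *s w) x)) (\<lambda>x. E k x * E (t *s w) x)"
      by (intro Cconv_mult Cconv_const Cconv_exp_upto smooth_E assms)
    from cont_functional_lim[OF assms(2) this]
    have "(\<lambda>n. F (\<lambda>x. E k x * exp_upto n (lin (t *s w) x))) \<longlonglongrightarrow> F (E (k + t *s w))"
      by (simp add: E_add[symmetric])
    moreover have "F (\<lambda>x. E k x * exp_upto n (lin (t *s w) x)) = (\<Sum>j<n. c j * t ^ j)" for n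
    proof -
      have "(\<lambda>x. E k x * exp_upto n (lin (t *s w) x)) = (\<lambda>x. \<Sum>j<n. (t ^ j / fact j) * (E k x * lin w x ^ j))"
        by (simp add: exp_upto_def lin_smult power_mult_distrib sum_distrib_left mult_ac)
      then have "F (\<lambda>x. E k x * exp_upto n (lin (t *s w) x)) = (\<Sum>j<n. (t ^ j / fact j) * F (\<lambda>x. E k x * lin w x ^ j))"
        by (simp only:) (intro cont_functional_sum[OF assms(2)] smooth_mult smooth_E smooth_power smooth_lin)
      then show ?thesis by (simp add: c_def mult_ac)
    qed
    ultimately show ?thesis by (simp add: sums_def)
  qed
  then have "(\<lambda>t. F (E (k + t *s w))) holomorphic_on ball 0 r" for r
    using power_series_holomorphic[of 0 r c "\<lambda>t. F (E (k + t *s w))"] by simp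
  then have "(\<lambda>t. F (E (k + t *s w))) field_differentiable at t" for t
    using holomorphic_on_imp_differentiable_at[of _ "ball 0 (norm t + 1)" t] by simp
  then show ?thesis by (simp add: holomorphic_on_def field_differentiable_at_within)
qed

section \<open>Vanishing minors of the harmonic matrix\<close>

lemma H_rank_minor_zero:
  assumes "H_rank F f = enat m"
  shows "kdet (Suc m) (\<lambda>i j. F (\<lambda>x. f (r i) x * cnj (f (c j) x))) = 0"
proof (rule ccontr)
  assume nz: "\<not> ?thesis"
  define rs cs where "rs = map r [0..<Suc m]" and "cs = map c [0..<Suc m]"
  have len: "length rs = Suc m" "length cs = Suc m" by (simp_all add: rs_def cs_def)
  have H: "H_sub F f rs cs = Matrix.mat (Suc m) (Suc m) (\<lambda>(i, j). F (\<lambda>x. f (r i) x * cnj (f (c j) x)))"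
    unfolding H_sub_def len by (intro eq_matI) (auto simp: rs_def cs_def simp del: upt_Suc)
  have "vec_space.rank (Suc m) (H_sub F f rs cs) = Suc m"
    using nz unfolding H kdet_def by (intro vec_space.low_rank_det_zero) auto
  moreover have "enat (vec_space.rank (length rs) (H_sub F f rs cs)) \<le> H_rank F f"
    unfolding H_rank_def by (rule SUP_upper2[of "(rs, cs)"]) auto
  ultimately show False using assms len by simp
qed

text \<open>Rows are expanded in the spanning system first, then columns after transposition;
  conjugation turns the column coefficients into \<open>cnj (e a)\<close>.\<close>

lemma spans_harmonic_minor_zero:
  fixes F :: "(real^'d::finite \<Rightarrow> complex) \<Rightarrow> complex" and f :: "'i \<Rightarrow> real^'d \<Rightarrow> complex"
  assumes F: "cont_functional K F" and f: "spans_harmonic f" and m: "H_rank F f = enat m"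
    and pg: "\<And>i. i < Suc m \<Longrightarrow> harmonic_poly (p i)" "\<And>i. i < Suc m \<Longrightarrow> harmonic_poly (g i)"
  shows "kdet (Suc m) (\<lambda>i j. F (\<lambda>x. p i x * cnj (g j x))) = 0"
proof -
  have smooth_f: "smooth (f a)" for a
    using f smooth_polynomial_fun unfolding spans_harmonic_def harmonic_poly_def by blast
  have expand: "\<exists>S c. q = (\<lambda>x. \<Sum>a\<in>S. c a * f a x)" if "harmonic_poly q" for q
    using f that unfolding spans_harmonic_def by blast
  have rows: "kdet (Suc m) (\<lambda>i j. F (\<lambda>x. p i x * cnj (f (c j) x))) = 0" for c
  proof (rule kdet_span_rows[where X = "range f" and X' = "{q. harmonic_poly q}" and B = "\<lambda>p j. F (\<lambda>x. p x * cnj (f (c j) x))"])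
    fix q :: "nat \<Rightarrow> real^'d \<Rightarrow> complex" assume "\<And>i. i < Suc m \<Longrightarrow> q i \<in> range f"
    then have "\<forall>i. \<exists>r. i < Suc m \<longrightarrow> q i = f r" by (auto simp: image_iff)
    then obtain r where "\<And>i. i < Suc m \<Longrightarrow> q i = f (r i)" by metis
    then have "kdet (Suc m) (\<lambda>i j. F (\<lambda>x. q i x * cnj (f (c j) x)))
        = kdet (Suc m) (\<lambda>i j. F (\<lambda>x. f (r i) x * cnj (f (c j) x)))"
      by (intro kdet_cong) simp
    then show "kdet (Suc m) (\<lambda>i j. F (\<lambda>x. q i x * cnj (f (c j) x))) = 0"
      by (simp add: H_rank_minor_zero[OF m])
  next
    fix q :: "real^'d \<Rightarrow> complex" assume "q \<in> {q. harmonic_poly q}"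
    then obtain S e where q: "q = (\<lambda>x. \<Sum>a\<in>S. e a * f a x)" using expand by blast
    have "F (\<lambda>x. q x * cnj (f (c j) x)) = (\<Sum>a\<in>S. e a * F (\<lambda>x. f a x * cnj (f (c j) x)))" for j
      unfolding q sum_distrib_right mult.assoc
      by (intro cont_functional_sum[OF F] smooth_mult smooth_cnj smooth_f)
    then show "\<exists>(S :: 'i set) e' d. e' ` S \<subseteq> range f \<and> (\<forall>j<Suc m. F (\<lambda>x. q x * cnj (f (c j) x)) =
        (\<Sum>a\<in>S. d a * F (\<lambda>x. e' a x * cnj (f (c j) x))))"
      by (intro exI[of _ S] exI[of _ f] exI[of _ e]) auto
  qed (use pg in auto)
  have smooth_p: "smooth (p i)" if "i < Suc m" for i
    using pg(1)[OF that] smooth_polynomial_fun unfolding harmonic_poly_def by blast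
  have "kdet (Suc m) (\<lambda>j i. F (\<lambda>x. p i x * cnj (g j x))) = 0"
  proof (rule kdet_span_rows[where X = "range f" and X' = "{q. harmonic_poly q}" and B = "\<lambda>g i. F (\<lambda>x. p i x * cnj (g x))"])
    fix q :: "nat \<Rightarrow> real^'d \<Rightarrow> complex" assume "\<And>i. i < Suc m \<Longrightarrow> q i \<in> range f"
    then have "\<forall>i. \<exists>r. i < Suc m \<longrightarrow> q i = f r" by (auto simp: image_iff)
    then obtain r where "\<And>i. i < Suc m \<Longrightarrow> q i = f (r i)" by metis
    then have "kdet (Suc m) (\<lambda>j i. F (\<lambda>x. p i x * cnj (q j x)))
        = kdet (Suc m) (\<lambda>j i. F (\<lambda>x. p i x * cnj (f (r j) x)))"
      by (intro kdet_cong) simp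
    then show "kdet (Suc m) (\<lambda>j i. F (\<lambda>x. p i x * cnj (q j x))) = 0"
      using rows[of r] kdet_transpose[of "Suc m" "\<lambda>i j. F (\<lambda>x. p i x * cnj (f (r j) x))"] by simp
  next
    fix q :: "real^'d \<Rightarrow> complex" assume "q \<in> {q. harmonic_poly q}"
    then obtain S e where q: "q = (\<lambda>x. \<Sum>a\<in>S. e a * f a x)" using expand by blast
    have "F (\<lambda>x. p i x * cnj (q x)) = (\<Sum>a\<in>S. cnj (e a) * F (\<lambda>x. p i x * cnj (f a x)))" if "i < Suc m" for i
    proof -
      have "(\<lambda>x. p i x * cnj (q x)) = (\<lambda>x. \<Sum>a\<in>S. cnj (e a) * (p i x * cnj (f a x)))"
        by (simp add: q sum_distrib_left mult_ac)
      then show ?thesis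
        by (simp only:) (intro cont_functional_sum[OF F] smooth_mult smooth_cnj smooth_f smooth_p that)
    qed
    then show "\<exists>(S :: 'i set) e' d. e' ` S \<subseteq> range f \<and> (\<forall>i<Suc m. F (\<lambda>x. p i x * cnj (q x)) =
        (\<Sum>a\<in>S. d a * F (\<lambda>x. p i x * cnj (e' a x))))"
      by (intro exI[of _ S] exI[of _ f] exI[of _ "\<lambda>a. cnj (e a)"]) auto
  qed (use pg in auto)
  then show ?thesis
    using kdet_transpose[of "Suc m" "\<lambda>i j. F (\<lambda>x. p i x * cnj (g j x))"] by simp
qed

lemma tendsto_kdet:
  fixes A :: "'b \<Rightarrow> nat \<Rightarrow> nat \<Rightarrow> complex"
  assumes "\<And>i j. i < n \<Longrightarrow> j < n \<Longrightarrow> ((\<lambda>t. A t i j) \<longlongrightarrow> B i j) G"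
  shows "((\<lambda>t. kdet n (A t)) \<longlongrightarrow> kdet n B) G"
  unfolding kdet_eq_sum
  by (intro tendsto_sum tendsto_mult tendsto_const tendsto_prod assms) (auto simp: permutes_in_image)

text \<open>A bijection \<open>h\<close> from \<open>A\<close> onto its complement identifies \<open>\<real>\<^sup>d\<close> with \<open>\<complex>\<^sup>A\<close>, with
  coordinates \<open>x\<^sub>a + i x\<^bsub>h a\<^esub>\<close>. Then \<open>lin l\<close> is holomorphic for \<open>l \<in> L\<close>
  and antiholomorphic for \<open>l \<in> U\<close>.\<close>
locale pairing =
  fixes A :: "'d::finite set" and h :: "'d \<Rightarrow> 'd"
  assumes bij: "bij_betw h A (- A)"
begin

definition L :: "(complex^'d) set" where "L = {l. \<forall>a\<in>A. l $ h a = \<i> * l $ a}"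
definition U :: "(complex^'d) set" where "U = {l. \<forall>a\<in>A. l $ h a = - \<i> * l $ a}"
definition vz :: "'d \<Rightarrow> complex^'d" where "vz a = axis a 1 + axis (h a) \<i>"
definition vw :: "'d \<Rightarrow> complex^'d" where "vw a = axis a 1 + axis (h a) (- \<i>)"
definition zc :: "'d \<Rightarrow> real^'d \<Rightarrow> complex" where "zc a x = Complex (x $ a) (x $ h a)"

text \<open>Polynomials holomorphic in the coordinates \<open>zc a\<close>, encoded by the
  Cauchy-Riemann equations of each pair: closure under products is then the product rule, and
  harmonicity needs no normal form.\<close>

definition CR_poly :: "(real^'d \<Rightarrow> complex) \<Rightarrow> bool" where
  "CR_poly f \<longleftrightarrow> polynomial_fun f \<and> (\<forall>a\<in>A. pdiff (h a) f = (\<lambda>x. \<i> * pdiff a f x))"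

lemma h_notin: "a \<in> A \<Longrightarrow> h a \<notin> A"
  using bij by (auto simp: bij_betw_def)

lemma h_inj: "a \<in> A \<Longrightarrow> b \<in> A \<Longrightarrow> h a = h b \<longleftrightarrow> a = b"
  using bij by (auto simp: bij_betw_def inj_on_def)

lemma index_cases:
  obtains "i \<in> A" | a where "a \<in> A" "i = h a"
  using bij by (auto simp: bij_betw_def)

lemma sum_pair: "(\<Sum>i\<in>UNIV. g i) = (\<Sum>a\<in>A. g a + g (h a))"
proof -
  have "(\<Sum>i\<in>UNIV. g i) = (\<Sum>i\<in>A \<union> - A. g i)" by simp
  also have "\<dots> = (\<Sum>i\<in>A. g i) + (\<Sum>i\<in>- A. g i)" by (rule sum.union_disjoint) auto
  also have "(\<Sum>i\<in>- A. g i) = (\<Sum>a\<in>A. g (h a))" by (rule sum.reindex_bij_betw[OF bij, symmetric])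
  finally show ?thesis by (simp add: sum.distrib)
qed

lemma L_add: "x \<in> L \<Longrightarrow> y \<in> L \<Longrightarrow> x + y \<in> L"
  and L_smult: "x \<in> L \<Longrightarrow> c *s x \<in> L"
  and U_add: "x \<in> U \<Longrightarrow> y \<in> U \<Longrightarrow> x + y \<in> U"
  and U_smult: "x \<in> U \<Longrightarrow> c *s x \<in> U"
  by (auto simp: L_def U_def algebra_simps)

lemma vz_in_L: "a \<in> A \<Longrightarrow> vz a \<in> L"
  and vw_in_U: "a \<in> A \<Longrightarrow> vw a \<in> U"
  using h_notin h_inj by (auto simp: L_def U_def vz_def vw_def axis_def)

lemma lin_vz: "lin (vz a) x = zc a x"
  and lin_vw: "lin (vw a) x = cnj (zc a x)"
  by (simp_all add: vz_def vw_def lin_add lin_axis zc_def complex_eq_iff)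

lemma zc_inj:
  assumes "\<And>a. a \<in> A \<Longrightarrow> zc a x = zc a y"
  shows "x = y"
proof -
  have "x $ i = y $ i" for i
    by (cases i rule: index_cases) (use assms in \<open>force simp: zc_def\<close>)+
  then show ?thesis by (simp add: Finite_Cartesian_Product.vec_eq_iff)
qed

text \<open>The splitting into holomorphic and antiholomorphic parts turns relations on
  \<open>L + U\<close> into relations for all \<open>E k\<close>.\<close>

lemma L_U_decomp: "\<exists>l\<in>L. \<exists>u\<in>U. k = l + u"
proof -
  define g where "g i = (SOME a. a \<in> A \<and> h a = i)" for i
  have g: "g (h a) = a" if "a \<in> A" for a
    unfolding g_def using that h_inj by (intro some_equality) auto
  define l where "l = (\<chi> i. if i \<in> A then (k $ i - \<i> * k $ h i) / 2 else \<i> * (k $ g i - \<i> * k $ i) / 2)"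
  define u where "u = (\<chi> i. if i \<in> A then (k $ i + \<i> * k $ h i) / 2 else - \<i> * (k $ g i + \<i> * k $ i) / 2)"
  have "l \<in> L" "u \<in> U" by (auto simp: L_def U_def l_def u_def h_notin g)
  moreover have "k = l + u"
    by (auto simp: Finite_Cartesian_Product.vec_eq_iff l_def u_def algebra_simps add_divide_distrib[symmetric])
  ultimately show ?thesis by blast
qed

lemma cnj_U: "u \<in> U \<Longrightarrow> (\<chi> i. cnj (u $ i)) \<in> L"
  by (auto simp: L_def U_def)

lemma cnj_lin: "cnj (lin (\<chi> i. cnj (u $ i)) x) = lin u x"
  by (simp add: lin_def)

lemma CR_poly_smooth: "CR_poly f \<Longrightarrow> smooth f"
  by (simp add: CR_poly_def smooth_polynomial_fun)

text \<open>Applying the Cauchy-Riemann equation twice gives the factor \<open>\<i> * \<i>\<close>,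
  so the two second derivatives of each pair cancel.\<close>

lemma CR_poly_harmonic:
  assumes "CR_poly f"
  shows "harmonic_poly f"
proof -
  have s: "smooth f" using assms by (rule CR_poly_smooth)
  have CR: "pdiff (h a) f = (\<lambda>x. \<i> * pdiff a f x)" if "a \<in> A" for a
    using assms that by (simp add: CR_poly_def)
  have "pdiff (h a) (pdiff (h a) f) = (\<lambda>x. - pdiff a (pdiff a f) x)" if a: "a \<in> A" for a
  proof -
    have "pdiff (h a) (pdiff (h a) f) = (\<lambda>x. \<i> * pdiff (h a) (pdiff a f) x)"
      unfolding CR[OF a] by (rule pdiff_cmult[OF smooth_pdiff[OF s]])
    also have "pdiff (h a) (pdiff a f) = pdiff a (\<lambda>x. \<i> * pdiff a f x)"
      unfolding pdiff_commute[OF s, of "h a"] CR[OF a] ..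
    also have "\<dots> = (\<lambda>x. \<i> * pdiff a (pdiff a f) x)"
      by (rule pdiff_cmult[OF smooth_pdiff[OF s]])
    finally show ?thesis by (simp add: mult.assoc[symmetric])
  qed
  then show ?thesis
    using assms by (simp add: harmonic_poly_def CR_poly_def sum_pair)
qed

lemma CR_poly_const: "CR_poly (\<lambda>x. c)"
  by (simp add: CR_poly_def polynomial_fun_const pdiff_const)

lemma CR_poly_lin: "l \<in> L \<Longrightarrow> CR_poly (lin l)"
  by (simp add: CR_poly_def polynomial_fun_lin pdiff_lin L_def)

lemma CR_poly_add: "CR_poly f \<Longrightarrow> CR_poly g \<Longrightarrow> CR_poly (\<lambda>x. f x + g x)"
  using CR_poly_smooth[of f] CR_poly_smooth[of g]
  by (auto simp: CR_poly_def polynomial_fun_add pdiff_add distrib_left)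

lemma CR_poly_mult: "CR_poly f \<Longrightarrow> CR_poly g \<Longrightarrow> CR_poly (\<lambda>x. f x * g x)"
  using CR_poly_smooth[of f] CR_poly_smooth[of g]
  by (auto simp: CR_poly_def polynomial_fun_mult pdiff_mult algebra_simps)

lemma CR_poly_power: "CR_poly f \<Longrightarrow> CR_poly (\<lambda>x. f x ^ n)"
  by (induction n) (auto intro: CR_poly_const CR_poly_mult)

lemma CR_poly_sum: "(\<And>j. j \<in> J \<Longrightarrow> CR_poly (f j)) \<Longrightarrow> CR_poly (\<lambda>x. \<Sum>j\<in>J. f j x)"
  by (induction J rule: infinite_finite_induct) (auto intro: CR_poly_const CR_poly_add)

lemma CR_poly_prod: "(\<And>j. j \<in> J \<Longrightarrow> CR_poly (f j)) \<Longrightarrow> CR_poly (\<lambda>x. \<Prod>j\<in>J. f j x)"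
  by (induction J rule: infinite_finite_induct) (auto intro: CR_poly_const CR_poly_mult)

lemma CR_poly_exp_upto: "l \<in> L \<Longrightarrow> CR_poly (\<lambda>x. exp_upto n (lin l x))"
  unfolding exp_upto_def divide_inverse
  by (intro CR_poly_sum CR_poly_mult CR_poly_power CR_poly_lin CR_poly_const)

text \<open>The bridge from polynomials to exponentials: for \<open>l\<close> in \<open>L\<close>
  and \<open>u\<close> in \<open>U\<close> each approximant is a holomorphic polynomial times the
  conjugate of another, a product to which the rank hypothesis applies.\<close>

lemma Cconv_exp_upto_pair:
  assumes "compact K"
  shows "Cconv K (\<lambda>n x. exp_upto n (lin l x) * cnj (exp_upto n (lin (\<chi> i. cnj (u $ i)) x))) (E (l + u))"
proof -
  have cnj_exp: "cnj (exp_upto n z) = exp_upto n (cnj z)" for n z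
    by (simp add: exp_upto_def)
  have "Cconv K (\<lambda>n x. exp_upto n (lin l x) * exp_upto n (lin u x)) (\<lambda>x. E l x * E u x)"
    by (intro Cconv_mult Cconv_exp_upto assms)
  then show ?thesis by (simp add: cnj_exp cnj_lin E_add[abs_def])
qed

lemma exponential_minor_zero:
  assumes "compact K" "cont_functional K F" "spans_harmonic f" "H_rank F f = enat m"
    and lu: "\<And>i. i < Suc m \<Longrightarrow> l i \<in> L \<and> u i \<in> U"
  shows "kdet (Suc m) (\<lambda>i j. F (E (l i + u j))) = 0"
proof -
  have "(\<lambda>n. kdet (Suc m) (\<lambda>i j. F (\<lambda>x. exp_upto n (lin (l i) x) * cnj (exp_upto n (lin (\<chi> k. cnj (u j $ k)) x)))))
    \<longlonglongrightarrow> kdet (Suc m) (\<lambda>i j. F (E (l i + u j)))"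
    by (intro tendsto_kdet cont_functional_lim[OF assms(2)] Cconv_exp_upto_pair assms(1))
  moreover have "kdet (Suc m) (\<lambda>i j. F (\<lambda>x. exp_upto n (lin (l i) x) * cnj (exp_upto n (lin (\<chi> k. cnj (u j $ k)) x)))) = 0" for n
    using lu by (intro spans_harmonic_minor_zero[OF assms(2-4)] CR_poly_harmonic CR_poly_exp_upto cnj_U) auto
  ultimately show ?thesis by (simp add: LIMSEQ_const_iff)
qed

text \<open>The exponent is increased by \<open>t * zc a x - cnj (t * zc a x)\<close>, which is
  imaginary; this is why \<open>vz a\<close> is paired with the negative of \<open>vw a\<close>. The
  exponential stays bounded on \<open>K\<close>, and only the at most \<open>N\<close> derivatives
  grow, each by a factor linear in \<open>norm t\<close>.\<close>

lemma exponential_growth: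
  assumes "compact K" "K \<noteq> {}" "0 \<le> C"
    and bound: "\<And>\<phi> b. smooth \<phi> \<Longrightarrow>
      (\<And>is x. length is \<le> N \<Longrightarrow> x \<in> K \<Longrightarrow> norm (pdiffs is \<phi> x) \<le> b) \<Longrightarrow> norm (F \<phi>) \<le> C * b"
  shows "\<exists>B. \<forall>t. norm (F (E (k + (t *s vz a + cnj t *s ((-1) *s vw a))))) \<le> B * (1 + norm t) ^ N"
proof -
  obtain R where R: "\<And>x. x \<in> K \<Longrightarrow> norm (lin k x) \<le> R"
    using bounded_lin[OF assms(1)] by blast
  define M where "M = 1 + norm k + norm (vz a) + norm (vw a)"
  have M: "1 \<le> M" by (simp add: M_def)
  have "norm (F (E (k + (t *s vz a + cnj t *s ((-1) *s vw a))))) \<le> C * ((M * (1 + norm t)) ^ N * exp R)" for t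
  proof (rule bound[OF smooth_E])
    fix "is" :: "'d list" and x assume is_x: "length is \<le> N" "x \<in> K"
    define k' where "k' = k + (t *s vz a + cnj t *s ((-1) *s vw a))"
    have "lin k' x = lin k x + (t * zc a x - cnj (t * zc a x))"
      by (simp only: k'_def lin_add lin_smult lin_vz lin_vw) simp
    then have "Re (lin k' x) = Re (lin k x)" by simp
    also have "\<dots> \<le> R" using R[OF is_x(2)] complex_Re_le_cmod order_trans by blast
    finally have E: "norm (E k' x) \<le> exp R" by (simp add: E_def)
    have comp: "norm (k' $ i) \<le> M * (1 + norm t)" for i
    proof -
      have "norm (k' $ i) \<le> norm (k $ i) + (norm t * norm (vz a $ i) + norm t * norm (vw a $ i))"
        unfolding k'_def
        by (simp add: norm_mult[symmetric]) (smt (verit) complex_mod_cnj norm_mult norm_triangle_ineq norm_triangle_ineq4)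
      also have "\<dots> \<le> norm k + (norm t * norm (vz a) + norm t * norm (vw a))"
        by (intro add_mono mult_left_mono Finite_Cartesian_Product.norm_nth_le) auto
      also have "\<dots> \<le> M * (1 + norm t)"
        by (simp add: M_def algebra_simps add_nonneg_nonneg)
      finally show ?thesis .
    qed
    have 1: "1 \<le> M * (1 + norm t)" using M mult_mono[of 1 M 1 "1 + norm t"] by simp
    have "norm (prod_list (map (($) k') js)) \<le> (M * (1 + norm t)) ^ length js" for js
      by (induction js) (use comp 1 in \<open>auto simp: norm_mult intro!: mult_mono\<close>)
    also have "(M * (1 + norm t)) ^ length is \<le> (M * (1 + norm t)) ^ N"
      using 1 is_x(1) by (rule power_increasing[rotated])
    finally show "norm (pdiffs is (E k') x) \<le> (M * (1 + norm t)) ^ N * exp R"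
      unfolding pdiffs_E norm_mult using E 1 by (intro mult_mono) auto
  qed
  then show ?thesis
    by (intro exI[of _ "C * M ^ N * exp R"]) (simp add: power_mult_distrib mult_ac)
qed

text \<open>Since \<open>L + U\<close> is everything, the recurrence says that \<open>F\<close>
  vanishes on \<open>q\<close> times every exponential; uniqueness of the transform then replaces
  the exponential by any smooth function.\<close>

lemma annihilating_exponential_polynomial:
  fixes F :: "(real^'d \<Rightarrow> complex) \<Rightarrow> complex"
  assumes K: "compact K" "K \<noteq> {}" and C: "0 \<le> C" and F: "cont_functional K F"
    and bound: "\<And>\<phi> b. smooth \<phi> \<Longrightarrow>
      (\<And>is x. length is \<le> N \<Longrightarrow> x \<in> K \<Longrightarrow> norm (pdiffs is \<phi> x) \<le> b) \<Longrightarrow> norm (F \<phi>) \<le> C * b"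
    and f: "spans_harmonic f" "H_rank F f = enat m" and a: "a \<in> A"
  shows "\<exists>s P Q. s \<noteq> 0 \<and> (\<exists>n\<le>Q. P n \<noteq> 0) \<and>
    (\<forall>\<phi>. smooth \<phi> \<longrightarrow> F (\<lambda>x. (\<Sum>n\<le>Q. P n * E ((of_nat n * s) *s vz a) x) * \<phi> x) = 0)"
proof -
  have "\<exists>s P Q. s \<noteq> 0 \<and> (\<exists>n\<le>Q. P n \<noteq> 0) \<and>
    (\<forall>l\<in>L. \<forall>u\<in>U. (\<Sum>n\<le>Q. P n * F (E (l + u + (of_nat n * s) *s vz a))) = 0)"
  proof (rule shift_recurrence[where v' = "(-1) *s vw a" and p = N and m = m and G = "\<lambda>k. F (E k)"])
    show "vz a \<in> L" "(-1) *s vw a \<in> U" by (intro vz_in_L U_smult vw_in_U a)+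
    show "(\<lambda>t. F (E (k + t *s w))) holomorphic_on UNIV" for k w
      by (rule holomorphic_functional_E[OF K(1) F])
    show "\<exists>B. \<forall>t. norm (F (E (k + (t *s vz a + cnj t *s ((-1) *s vw a))))) \<le> B * (1 + norm t) ^ N" for k
      by (rule exponential_growth[OF K C bound])
    show "kdet (Suc m) (\<lambda>i j. F (E (l i + u j))) = 0" if "\<And>i. i < Suc m \<Longrightarrow> l i \<in> L \<and> u i \<in> U" for l u
      by (rule exponential_minor_zero[OF K(1) F f that])
  qed (auto intro: L_add L_smult U_add U_smult)
  then obtain s P Q where sP: "s \<noteq> 0" "\<exists>n\<le>Q. P n \<noteq> 0"
    and rec: "\<And>l u. l \<in> L \<Longrightarrow> u \<in> U \<Longrightarrow> (\<Sum>n\<le>Q. P n * F (E (l + u + (of_nat n * s) *s vz a))) = 0" by blast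
  define q where "q x = (\<Sum>n\<le>Q. P n * E ((of_nat n * s) *s vz a) x)" for x
  have smooth_q: "smooth q" unfolding q_def by (intro smooth_sum smooth_cmult smooth_E)
  have "F (\<lambda>x. q x * E k x) = 0" for k
  proof -
    obtain l u where lu: "l \<in> L" "u \<in> U" "k = l + u" using L_U_decomp by blast
    have "(\<lambda>x. q x * E k x) = (\<lambda>x. \<Sum>n\<le>Q. P n * E (l + u + (of_nat n * s) *s vz a) x)"
      by (simp add: q_def sum_distrib_left E_add lu(3) mult_ac)
    then have "F (\<lambda>x. q x * E k x) = (\<Sum>n\<le>Q. P n * F (E (l + u + (of_nat n * s) *s vz a)))"
      by (simp only:) (intro cont_functional_sum[OF F] smooth_E)
    then show ?thesis using rec lu by simp
  qed
  then have "F (\<lambda>x. q x * \<phi> x) = 0" if "smooth \<phi>" for \<phi>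
    by (rule cont_functional_eq_0[OF K(1) cont_functional_mult[OF K(1) F smooth_q] _ that])
  then show ?thesis using sP unfolding q_def by blast
qed

end

section \<open>Functionals annihilated by a nonnegative function\<close>

definition l1dist :: "real^'d::finite \<Rightarrow> real^'d \<Rightarrow> real" where
  "l1dist y x = (\<Sum>j\<in>UNIV. \<bar>x $ j - y $ j\<bar>)"

lemma l1dist_nonneg: "0 \<le> l1dist y x"
  by (simp add: l1dist_def sum_nonneg)

lemma open_box: "open {x :: real^'d::finite. \<forall>j. \<bar>x $ j - y $ j\<bar> < \<delta>}"
proof -
  have "{x :: real^'d. \<forall>j. \<bar>x $ j - y $ j\<bar> < \<delta>} = (\<Inter>j. {x. \<bar>x $ j - y $ j\<bar> < \<delta>})" by auto
  moreover have "open {x :: real^'d. \<bar>x $ j - y $ j\<bar> < \<delta>}" for j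
    by (intro open_Collect_less continuous_intros)
  ultimately show ?thesis by (simp add: open_INT)
qed

text \<open>Near a zero, \<open>S\<close> dominates a power of the distance, so a sufficiently flat
  \<open>\<phi>\<close> is small against \<open>S ^ R\<close>; elsewhere \<open>S\<close> is locally
  bounded below. Compactness joins the local bounds, and finiteness of the zero set gives one
  \<open>M\<close> for all \<open>\<phi>\<close>.\<close>

lemma flat_control:
  fixes S :: "real^'d::finite \<Rightarrow> real"
  assumes K: "compact K" and S: "continuous_on UNIV S" "\<And>x. 0 \<le> S x"
    and fin: "finite {x \<in> K. S x = 0}"
    and local: "\<And>y. y \<in> K \<Longrightarrow> S y = 0 \<Longrightarrow>
      \<exists>M c \<delta>. 0 < c \<and> 0 < \<delta> \<and> (\<forall>x. (\<forall>j. \<bar>x $ j - y $ j\<bar> < \<delta>) \<longrightarrow> c * l1dist y x ^ M \<le> S x)"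
  shows "\<exists>M. \<forall>\<phi>. smooth \<phi> \<longrightarrow> (\<forall>y\<in>{x \<in> K. S x = 0}. flat M y \<phi>) \<longrightarrow> (\<exists>C. \<forall>x\<in>K. norm (\<phi> x) \<le> C * S x ^ R)"
proof -
  define Z where "Z = {x \<in> K. S x = 0}"
  have "\<forall>y\<in>Z. \<exists>M c \<delta>. 0 < c \<and> 0 < \<delta> \<and> (\<forall>x. (\<forall>j. \<bar>x $ j - y $ j\<bar> < \<delta>) \<longrightarrow> c * l1dist y x ^ M \<le> S x)"
    using local by (auto simp: Z_def)
  then obtain M c \<delta> where loc: "\<And>y. y \<in> Z \<Longrightarrow> 0 < c y" "\<And>y. y \<in> Z \<Longrightarrow> 0 < \<delta> y"
    "\<And>y x. y \<in> Z \<Longrightarrow> (\<forall>j. \<bar>x $ j - y $ j\<bar> < \<delta> y) \<Longrightarrow> c y * l1dist y x ^ M y \<le> S x"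
    by metis
  define M' where "M' = Max (insert 0 ((\<lambda>y. M y * R) ` Z))"
  have M': "M y * R \<le> M'" if "y \<in> Z" for y
    unfolding M'_def using fin that by (intro Max_ge) (auto simp: Z_def)
  have "\<exists>C. \<forall>x\<in>K. norm (\<phi> x) \<le> C * S x ^ R" if \<phi>: "smooth \<phi>" "\<And>y. y \<in> Z \<Longrightarrow> flat M' y \<phi>" for \<phi>
  proof -
    have "\<exists>V C. open V \<and> y \<in> V \<and> 0 \<le> C \<and> (\<forall>x\<in>V. norm (\<phi> x) \<le> C * S x ^ R)" if y: "y \<in> K" for y
    proof (cases "y \<in> Z")
      case True
      obtain C where C: "0 \<le> C" "\<And>x. (\<forall>j. \<bar>x $ j - y $ j\<bar> \<le> 1) \<Longrightarrow> norm (\<phi> x) \<le> C * l1dist y x ^ (M y * R)"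
        using flat_bound[OF \<phi>(1) flat_mono[OF \<phi>(2)[OF True] M'[OF True]]] unfolding l1dist_def by blast
      let ?V = "{x. \<forall>j. \<bar>x $ j - y $ j\<bar> < min 1 (\<delta> y)}"
      have "norm (\<phi> x) \<le> (C / c y ^ R) * S x ^ R" if x: "x \<in> ?V" for x
      proof -
        have "norm (\<phi> x) \<le> C * l1dist y x ^ (M y * R)" using x by (intro C) (auto intro: less_imp_le)
        also have "\<dots> = (C / c y ^ R) * (c y * l1dist y x ^ M y) ^ R"
          using loc(1)[OF True] by (simp add: power_mult power_mult_distrib)
        also have "\<dots> \<le> (C / c y ^ R) * S x ^ R"
          using loc(1)[OF True] C(1) x l1dist_nonneg[of y x] by (intro mult_left_mono power_mono loc(3)[OF True]) auto
        finally show ?thesis .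
      qed
      moreover have "y \<in> ?V" using loc(2)[OF True] by simp
      ultimately show ?thesis using C(1) loc(1)[OF True] open_box[of y "min 1 (\<delta> y)"]
        by (intro exI[of _ ?V] exI[of _ "C / c y ^ R"]) auto
    next
      case False
      then have Sy: "0 < S y" using S(2)[of y] y by (auto simp: Z_def less_le)
      obtain C where C: "0 \<le> C" "\<And>x. (\<forall>j. \<bar>x $ j - y $ j\<bar> \<le> 1) \<Longrightarrow> norm (\<phi> x) \<le> C"
        using flat_bound[OF \<phi>(1) flat_0[of y]] by auto
      let ?V = "{x. \<forall>j. \<bar>x $ j - y $ j\<bar> < 1} \<inter> {x. S y / 2 < S x}"
      have "open ?V" by (intro open_Int open_box open_Collect_less continuous_intros S)
      moreover have "norm (\<phi> x) \<le> (C / (S y / 2) ^ R) * S x ^ R" if x: "x \<in> ?V" for x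
      proof -
        have "norm (\<phi> x) \<le> C" using x by (intro C) (auto intro: less_imp_le)
        also have "\<dots> = (C / (S y / 2) ^ R) * (S y / 2) ^ R" using Sy by simp
        also have "\<dots> \<le> (C / (S y / 2) ^ R) * S x ^ R"
          using Sy C(1) x by (intro mult_left_mono power_mono) auto
        finally show ?thesis .
      qed
      ultimately show ?thesis using C(1) Sy
        by (intro exI[of _ ?V] exI[of _ "C / (S y / 2) ^ R"]) auto
    qed
    then obtain V C where V: "\<And>y. y \<in> K \<Longrightarrow> open (V y)" "\<And>y. y \<in> K \<Longrightarrow> y \<in> V y" "\<And>y. y \<in> K \<Longrightarrow> 0 \<le> C y"
      "\<And>y x. y \<in> K \<Longrightarrow> x \<in> V y \<Longrightarrow> norm (\<phi> x) \<le> C y * S x ^ R" by metis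
    obtain D where D: "D \<subseteq> K" "finite D" "K \<subseteq> (\<Union>y\<in>D. V y)"
    proof (rule compactE_image[OF K, of K V])
      show "K \<subseteq> (\<Union>y\<in>K. V y)" using V(2) by auto
    qed (use V(1) in auto)
    have "norm (\<phi> x) \<le> (\<Sum>y\<in>D. C y) * S x ^ R" if x: "x \<in> K" for x
    proof -
      obtain y where y: "y \<in> D" "x \<in> V y" using D(3) x by blast
      then have "norm (\<phi> x) \<le> C y * S x ^ R" using D(1) by (intro V) auto
      also have "\<dots> \<le> (\<Sum>y\<in>D. C y) * S x ^ R"
        using D y V(3) S(2) by (intro mult_right_mono member_le_sum) auto
      finally show ?thesis .
    qed
    then show ?thesis by blast
  qed
  then show ?thesis unfolding Z_def by blast
qed

section \<open>Functions dominated by a power of the annihilator, and their decay under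
  multiplication by powers\<close>

definition dominated :: "(real^'d::finite) set \<Rightarrow> (real^'d \<Rightarrow> real) \<Rightarrow> nat \<Rightarrow> (real^'d \<Rightarrow> complex) \<Rightarrow> bool" where
  "dominated K w n \<phi> \<longleftrightarrow> (\<forall>is. length is \<le> n \<longrightarrow> (\<exists>C. \<forall>x\<in>K. norm (pdiffs is \<phi> x) \<le> C * w x))"

lemma dominated_pdiff: "dominated K w (Suc n) \<phi> \<Longrightarrow> dominated K w n (pdiff i \<phi>)"
  unfolding dominated_def
proof (intro allI impI)
  fix "is" :: "'a list" assume *: "\<forall>is. length is \<le> Suc n \<longrightarrow> (\<exists>C. \<forall>x\<in>K. norm (pdiffs is \<phi> x) \<le> C * w x)" "length is \<le> n"
  from *(1)[rule_format, of "is @ [i]"] *(2)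
  show "\<exists>C. \<forall>x\<in>K. norm (pdiffs is (pdiff i \<phi>) x) \<le> C * w x" by (simp add: pdiffs_append)
qed

lemma dominated_mono: "dominated K w n \<phi> \<Longrightarrow> k \<le> n \<Longrightarrow> dominated K w k \<phi>"
  by (auto simp: dominated_def)

lemma dominated_mult:
  assumes "compact K" "\<And>x. x \<in> K \<Longrightarrow> 0 \<le> w x"
  shows "smooth \<phi> \<Longrightarrow> smooth \<psi> \<Longrightarrow> dominated K w n \<phi> \<Longrightarrow> dominated K w n (\<lambda>x. \<phi> x * \<psi> x)"
proof -
  have "\<exists>C. \<forall>x\<in>K. norm (pdiffs is (\<lambda>x. \<phi> x * \<psi> x) x) \<le> C * w x"
    if "smooth \<phi>" "smooth \<psi>" "dominated K w n \<phi>" "length is \<le> n" for \<phi> \<psi> n "is"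
    using that
  proof (induction "is" arbitrary: \<phi> \<psi> n rule: rev_induct)
    case Nil
    obtain C where C: "\<And>x. x \<in> K \<Longrightarrow> norm (\<phi> x) \<le> C * w x"
      using Nil(3)[unfolded dominated_def, rule_format, of "[]"] by auto
    have "compact (\<psi> ` K)" by (intro compact_continuous_image smooth_continuous_on Nil assms)
    then obtain B where B: "\<And>x. x \<in> K \<Longrightarrow> norm (\<psi> x) \<le> B"
      using compact_imp_bounded bounded_iff by (metis imageI)
    have "norm (\<phi> x * \<psi> x) \<le> (C * \<bar>B\<bar>) * w x" if "x \<in> K" for x
    proof -
      have "norm (\<phi> x * \<psi> x) \<le> (C * w x) * \<bar>B\<bar>"
        unfolding norm_mult using C[OF that] B[OF that] order_trans[OF norm_ge_zero C[OF that]]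
        by (intro mult_mono) auto
      then show ?thesis by (simp add: mult_ac)
    qed
    then show ?case by auto
  next
    case (snoc i "is")
    then obtain n' where n: "n = Suc n'" by (cases n) auto
    have len: "length is \<le> n'" using snoc.prems(4) n by simp
    have dom: "dominated K w n' \<phi>" using snoc.prems(3) n by (auto intro: dominated_mono)
    obtain C1 where C1: "\<forall>x\<in>K. norm (pdiffs is (\<lambda>x. pdiff i \<phi> x * \<psi> x) x) \<le> C1 * w x"
      using snoc.IH[of "pdiff i \<phi>" \<psi> n'] snoc.prems n len by (auto intro: smooth_pdiff dominated_pdiff)
    obtain C2 where C2: "\<forall>x\<in>K. norm (pdiffs is (\<lambda>x. \<phi> x * pdiff i \<psi> x) x) \<le> C2 * w x"
      using snoc.IH[of \<phi> "pdiff i \<psi>" n'] snoc.prems(1,2) dom len by (auto intro: smooth_pdiff)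
    have "norm (pdiffs is (\<lambda>x. pdiff i \<phi> x * \<psi> x) x + pdiffs is (\<lambda>x. \<phi> x * pdiff i \<psi> x) x) \<le> (C1 + C2) * w x"
      if "x \<in> K" for x
      using C1 C2 that by (auto simp: distrib_right intro!: norm_triangle_le add_mono)
    then show ?case
      using snoc.prems by (simp add: pdiffs_append pdiff_mult pdiffs_add smooth_mult smooth_pdiff) blast
  qed
  then show "smooth \<phi> \<Longrightarrow> smooth \<psi> \<Longrightarrow> dominated K w n \<phi> \<Longrightarrow> dominated K w n (\<lambda>x. \<phi> x * \<psi> x)"
    unfolding dominated_def[of K w n "\<lambda>x. \<phi> x * \<psi> x"] by blast
qed

lemma pdiff_power:
  assumes "smooth \<phi>"
  shows "pdiff i (\<lambda>x. \<phi> x ^ n) = (\<lambda>x. of_nat n * (pdiff i \<phi> x * \<phi> x ^ (n - 1)))"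
proof (induction n)
  case (Suc n)
  have "pdiff i (\<lambda>x. \<phi> x * \<phi> x ^ n) = (\<lambda>x. pdiff i \<phi> x * \<phi> x ^ n + \<phi> x * (of_nat n * (pdiff i \<phi> x * \<phi> x ^ (n - 1))))"
    using pdiff_mult[OF assms smooth_power[OF assms], of i n] Suc by simp
  also have "\<dots> = (\<lambda>x. of_nat (Suc n) * (pdiff i \<phi> x * \<phi> x ^ n))"
    by (cases n) (auto simp: algebra_simps)
  finally show ?case by simp
qed (simp add: pdiff_const)

text \<open>Combine \<open>1 - u \<le> exp (- u)\<close> with the single term
  \<open>(l * u) ^ R / fact R\<close> of the series of \<open>exp (l * u)\<close>.\<close>

lemma power_times_power_le:
  fixes u :: real
  assumes "0 \<le> u" "u \<le> 1" "0 < l"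
  shows "u ^ R * (1 - u) ^ l \<le> fact R / real l ^ R"
proof -
  have "(1 - u) ^ l \<le> exp (- u) ^ l"
    using assms exp_ge_add_one_self[of "- u"] by (intro power_mono) auto
  also have "\<dots> = exp (- (real l * u))" by (simp add: exp_of_nat_mult[symmetric])
  finally have 1: "(1 - u) ^ l \<le> exp (- (real l * u))" .
  have "(real l * u) ^ R / fact R \<le> exp (real l * u)"
  proof -
    have "(\<Sum>j\<in>{R}. (real l * u) ^ j /\<^sub>R fact j) \<le> (\<Sum>j. (real l * u) ^ j /\<^sub>R fact j)"
      using assms by (intro sum_le_suminf summable_exp_generic) auto
    then show ?thesis by (simp add: exp_def divide_inverse mult.commute)
  qed
  then have "u ^ R \<le> fact R / real l ^ R * exp (real l * u)"
    using assms(3) by (simp add: field_simps power_mult_distrib)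
  then have "u ^ R * (1 - u) ^ l \<le> (fact R / real l ^ R * exp (real l * u)) * exp (- (real l * u))"
    using 1 assms by (intro mult_mono) auto
  also have "\<dots> = fact R / real l ^ R" by (simp add: exp_minus)
  finally show ?thesis .
qed

text \<open>Here \<open>k - j\<close> is at least \<open>k / 2\<close>, and \<open>a < R\<close>
  leaves one power of \<open>k\<close> in the denominator.\<close>

lemma power_ratio_le:
  assumes "2 * j < k" "a < R"
  shows "real k ^ a * (fact R / real (k - j) ^ R) \<le> fact R * 2 ^ R / real k"
proof -
  have k: "1 \<le> real k" using assms by simp
  have "real k / 2 \<le> real (k - j)" using assms by simp
  then have "(real k / 2) ^ R \<le> real (k - j) ^ R" by (intro power_mono) auto
  then have "real k ^ R \<le> 2 ^ R * real (k - j) ^ R" by (simp add: power_divide field_simps)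
  moreover have "real k ^ a * real k \<le> real k ^ R"
    using power_increasing[of "Suc a" R "real k"] assms k by (simp add: mult.commute)
  ultimately have "real k ^ a * real k \<le> 2 ^ R * real (k - j) ^ R" by linarith
  then have "fact R * (real k ^ a * real k) \<le> fact R * (2 ^ R * real (k - j) ^ R)" by (intro mult_left_mono) auto
  then show ?thesis using k assms by (simp add: field_simps)
qed

text \<open>Each derivative of \<open>T ^ k\<close> costs a factor \<open>k\<close>, while \<open>w ^ R * T ^ k\<close> is of order
  \<open>k ^ - R\<close>.\<close>
lemma dominated_times_power_limit:
  fixes T :: "real^'d::finite \<Rightarrow> complex"
  assumes K: "compact K" and T: "smooth T" "\<And>x. x \<in> K \<Longrightarrow> T x = of_real (1 - w x)"
    and w: "\<And>x. x \<in> K \<Longrightarrow> 0 \<le> w x" "\<And>x. x \<in> K \<Longrightarrow> w x \<le> 1"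
    and "smooth \<phi>" "dominated K (\<lambda>x. w x ^ R) (length is) \<phi>" "a + length is < R"
    and "\<And>k. norm (b k) \<le> real k ^ a"
  shows "uniform_limit K (\<lambda>k. pdiffs is (\<lambda>x. b k * (\<phi> x * T x ^ (k - j)))) (\<lambda>_. 0) sequentially"
  using assms(6-)
proof (induction "is" arbitrary: \<phi> a b j rule: rev_induct)
  case Nil
  obtain C where C: "\<And>x. x \<in> K \<Longrightarrow> norm (\<phi> x) \<le> C * w x ^ R"
    using Nil(2)[unfolded dominated_def, rule_format, of "[]"] by auto
  show ?case
  proof (rule uniform_limitI)
    fix e :: real assume e: "0 < e"
    define B where "B = \<bar>C\<bar> * (fact R * 2 ^ R)"
    have "((\<lambda>k. B / real k) \<longlongrightarrow> 0) sequentially" by (rule lim_const_over_n)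
    from order_tendstoD(2)[OF this e] eventually_gt_at_top[of "2 * j"]
    show "\<forall>\<^sub>F k in sequentially. \<forall>x\<in>K. dist (pdiffs [] (\<lambda>x. b k * (\<phi> x * T x ^ (k - j))) x) 0 < e"
    proof eventually_elim
      case (elim k)
      show ?case
      proof
        fix x assume x: "x \<in> K"
        have "norm (T x) = 1 - w x" using T(2)[OF x] w[OF x] by (simp only: norm_of_real abs_of_nonneg)
        then have "norm (b k * (\<phi> x * T x ^ (k - j))) = norm (b k) * (norm (\<phi> x) * (1 - w x) ^ (k - j))"
          by (simp add: norm_mult norm_power)
        also have "\<dots> \<le> real k ^ a * ((\<bar>C\<bar> * w x ^ R) * (1 - w x) ^ (k - j))"
        proof -
          have "C * w x ^ R \<le> \<bar>C\<bar> * w x ^ R" using w[OF x] by (intro mult_right_mono) auto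
          then have "norm (\<phi> x) \<le> \<bar>C\<bar> * w x ^ R" using C[OF x] by linarith
          then show ?thesis using Nil(4)[of k] w[OF x] by (intro mult_mono mult_nonneg_nonneg) auto
        qed
        also have "\<dots> = \<bar>C\<bar> * (real k ^ a * (w x ^ R * (1 - w x) ^ (k - j)))" by (simp add: mult_ac)
        also have "\<dots> \<le> \<bar>C\<bar> * (real k ^ a * (fact R / real (k - j) ^ R))"
          using w[OF x] elim by (intro mult_left_mono power_times_power_le) auto
        also have "\<dots> \<le> \<bar>C\<bar> * (fact R * 2 ^ R / real k)"
          using elim Nil(3) by (intro mult_left_mono power_ratio_le) auto
        also have "\<dots> < e" using elim by (simp add: B_def mult.assoc)
        finally show "dist (pdiffs [] (\<lambda>x. b k * (\<phi> x * T x ^ (k - j))) x) 0 < e" by simp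
      qed
    qed
  qed
next
  case (snoc i "is")
  have dom: "dominated K (\<lambda>x. w x ^ R) (Suc (length is)) \<phi>" using snoc.prems(2) by simp
  have eq: "pdiffs (is @ [i]) (\<lambda>x. b k * (\<phi> x * T x ^ (k - j))) =
    (\<lambda>x. pdiffs is (\<lambda>x. b k * (pdiff i \<phi> x * T x ^ (k - j))) x +
      pdiffs is (\<lambda>x. (b k * of_nat (k - j)) * ((\<phi> x * pdiff i T x) * T x ^ (k - Suc j))) x)" for k
  proof -
    have "pdiff i (\<lambda>x. b k * (\<phi> x * T x ^ (k - j))) = (\<lambda>x. b k * (pdiff i \<phi> x * T x ^ (k - j)) +
        (b k * of_nat (k - j)) * ((\<phi> x * pdiff i T x) * T x ^ (k - Suc j)))"
      using snoc.prems(1) T(1)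
      by (subst pdiff_cmult) (simp_all add: pdiff_mult pdiff_power smooth_mult smooth_power algebra_simps)
    then show ?thesis
      using snoc.prems(1) T(1) by (simp add: pdiffs_append pdiffs_add smooth_mult smooth_cmult smooth_power smooth_pdiff)
  qed
  have "uniform_limit K (\<lambda>k. pdiffs is (\<lambda>x. b k * (pdiff i \<phi> x * T x ^ (k - j)))) (\<lambda>_. 0) sequentially"
    using snoc.prems by (intro snoc.IH[of _ a] smooth_pdiff dominated_pdiff[OF dom]) auto
  moreover have "uniform_limit K (\<lambda>k. pdiffs is (\<lambda>x. (b k * of_nat (k - j)) * ((\<phi> x * pdiff i T x) * T x ^ (k - Suc j)))) (\<lambda>_. 0) sequentially"
  \<comment> \<open>When the derivative falls on the power of \<open>T\<close>, \<open>a\<close>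
    grows by one while the list loses an entry, so \<open>a + length is < R\<close>
    persists.\<close>
  proof (rule snoc.IH[of _ "Suc a"])
    show "dominated K (\<lambda>x. w x ^ R) (length is) (\<lambda>x. \<phi> x * pdiff i T x)"
      using w(1) snoc.prems(1) T(1) by (intro dominated_mult K smooth_pdiff dominated_mono[OF dom]) auto
    show "norm (b k * of_nat (k - j)) \<le> real k ^ Suc a" for k
    proof -
      have "norm (b k) * real (k - j) \<le> real k ^ a * real k"
        using snoc.prems(4)[of k] by (intro mult_mono) auto
      then show ?thesis by (simp add: norm_mult mult.commute)
    qed
  qed (use snoc.prems T(1) in \<open>auto intro: smooth_mult smooth_pdiff\<close>)
  ultimately have "uniform_limit K (\<lambda>k x. pdiffs is (\<lambda>x. b k * (pdiff i \<phi> x * T x ^ (k - j))) x +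
      pdiffs is (\<lambda>x. (b k * of_nat (k - j)) * ((\<phi> x * pdiff i T x) * T x ^ (k - Suc j))) x) (\<lambda>x. 0 + 0) sequentially"
    by (rule uniform_limit_add)
  then show ?case by (simp add: eq)
qed

text \<open>A substitute for cutoff functions. As \<open>1 - T ^ k\<close> is a multiple of
  \<open>S\<close>, \<open>F\<close> takes the same value on \<open>\<phi>\<close> and on
  \<open>\<phi> * T ^ k\<close>, and the latter tends to zero on \<open>K\<close> with
  \<open>N\<close> derivatives. The exponent \<open>Suc N\<close> exceeds the number of factors
  \<open>k\<close> that \<open>N\<close> derivatives can produce.\<close>

lemma functional_vanishes_on_dominated:
  fixes F :: "(real^'d::finite \<Rightarrow> complex) \<Rightarrow> complex"
  assumes K: "compact K" and C: "0 \<le> C" and F: "cont_functional K F"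
    and bound: "\<And>\<phi> b. smooth \<phi> \<Longrightarrow>
      (\<And>is x. length is \<le> N \<Longrightarrow> x \<in> K \<Longrightarrow> norm (pdiffs is \<phi> x) \<le> b) \<Longrightarrow> norm (F \<phi>) \<le> C * b"
    and S: "smooth S" "\<And>x. S x = of_real (S' x)" "\<And>x. 0 \<le> S' x"
    and FS: "\<And>\<phi>. smooth \<phi> \<Longrightarrow> F (\<lambda>x. S x * \<phi> x) = 0"
    and \<phi>: "smooth \<phi>" "dominated K (\<lambda>x. S' x ^ Suc N) N \<phi>"
  shows "F \<phi> = 0"
proof -
  have "compact (S ` K)" by (intro compact_continuous_image smooth_continuous_on S K)
  then obtain B where B: "\<And>x. x \<in> K \<Longrightarrow> norm (S x) \<le> B"
    using compact_imp_bounded bounded_iff by (metis imageI)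
  \<comment> \<open>Large enough that \<open>w\<close> lies between 0 and 1 on \<open>K\<close>; the
    summand 1 makes \<open>c\<close> positive.\<close>
  define c where "c = \<bar>B\<bar> + 1"
  have c: "0 < c" by (simp add: c_def)
  define w where "w x = S' x / c" for x
  define T where "T x = 1 - of_real (1 / c) * S x" for x
  have T: "smooth T" unfolding T_def by (intro smooth_diff smooth_const smooth_cmult S)
  have T': "T x = of_real (1 - w x)" for x by (simp add: T_def w_def S(2))
  have w: "0 \<le> w x" for x using S(3) c by (simp add: w_def)
  have w': "w x \<le> 1" if "x \<in> K" for x
    using B[OF that] S(3)[of x] c by (simp add: S(2) w_def c_def)
  have dom: "dominated K (\<lambda>x. w x ^ Suc N) n \<phi>" if "n \<le> N" for n
    unfolding dominated_def
  proof (intro allI impI)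
    fix "is" :: "'d list" assume "length is \<le> n"
    then have "length is \<le> N" using that by simp
    then obtain D where D: "\<forall>x\<in>K. norm (pdiffs is \<phi> x) \<le> D * S' x ^ Suc N"
      using \<phi>(2)[unfolded dominated_def, rule_format, of "is"] by auto
    have "S' x ^ Suc N = c ^ Suc N * w x ^ Suc N" for x
      using c by (simp add: w_def power_divide)
    then show "\<exists>C. \<forall>x\<in>K. norm (pdiffs is \<phi> x) \<le> C * w x ^ Suc N"
      using D by (intro exI[of _ "D * c ^ Suc N"]) (simp only: mult.assoc)
  qed
  have F_eq: "F (\<lambda>x. \<phi> x * T x ^ k) = F \<phi>" for k
  proof -
    define \<psi> where "\<psi> x = of_real (1 / c) * ((\<Sum>i<k. T x ^ i) * \<phi> x)" for x
    have \<psi>: "smooth \<psi>" unfolding \<psi>_def by (intro smooth_cmult smooth_mult smooth_sum smooth_power T \<phi>)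
    have "\<phi> x = \<phi> x * T x ^ k + S x * \<psi> x" for x
    proof -
      have "1 - T x ^ k = (1 - T x) * (\<Sum>i<k. T x ^ i)" by (rule one_diff_power_eq)
      also have "1 - T x = of_real (1 / c) * S x" by (simp add: T_def)
      finally have "T x ^ k = 1 - of_real (1 / c) * S x * (\<Sum>i<k. T x ^ i)" by (simp add: algebra_simps)
      then have "\<phi> x * T x ^ k = \<phi> x * (1 - of_real (1 / c) * S x * (\<Sum>i<k. T x ^ i))" by (rule arg_cong)
      also have "\<dots> = \<phi> x - S x * \<psi> x"
      proof -
        have "p * (1 - r * s * t) = p - s * (r * (t * p))" for p r s t :: complex
          by (simp add: algebra_simps)
        then show ?thesis unfolding \<psi>_def .
      qed
      finally show ?thesis by simp
    qed
    then have "\<phi> = (\<lambda>x. \<phi> x * T x ^ k + S x * \<psi> x)" by (rule ext)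
    then have "F \<phi> = F (\<lambda>x. \<phi> x * T x ^ k + S x * \<psi> x)" by (rule arg_cong)
    also have "\<dots> = F (\<lambda>x. \<phi> x * T x ^ k) + F (\<lambda>x. S x * \<psi> x)"
      by (intro cont_functional_add[OF F] smooth_mult smooth_power \<phi> \<psi> T S)
    finally show ?thesis using FS[OF \<psi>] by simp
  qed
  have lim: "uniform_limit K (\<lambda>k. pdiffs is (\<lambda>x. 1 * (\<phi> x * T x ^ (k - 0)))) (\<lambda>_. 0) sequentially" if "length is \<le> N" for "is"
    by (rule dominated_times_power_limit[OF K T T' w w' \<phi>(1) dom[OF that], where a = 0]) (use that in auto)
  have F_le: "norm (F \<phi>) \<le> C * e" if e: "0 < e" for e
  proof -
    have fin: "finite {is :: 'd list. length is \<le> N}"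
      using finite_lists_length_le[of "UNIV :: 'd set" N] by simp
    have "\<forall>\<^sub>F k in sequentially. \<forall>is\<in>{is. length is \<le> N}. \<forall>x\<in>K. dist (pdiffs is (\<lambda>x. 1 * (\<phi> x * T x ^ (k - 0))) x) 0 < e"
      by (rule eventually_ball_finite[OF fin], rule ballI, rule uniform_limitD[OF lim e]) simp
    then obtain k where k: "\<forall>is\<in>{is. length is \<le> N}. \<forall>x\<in>K. dist (pdiffs is (\<lambda>x. 1 * (\<phi> x * T x ^ (k - 0))) x) 0 < e"
      using eventually_happens'[OF sequentially_bot] by blast
    have "norm (F (\<lambda>x. \<phi> x * T x ^ k)) \<le> C * e"
      by (rule bound) (use k in \<open>auto intro!: smooth_mult smooth_power \<phi> T less_imp_le\<close>)
    then show ?thesis by (simp add: F_eq)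
  qed
  have "norm (F \<phi>) \<le> e" if "0 < e" for e
  proof -
    have "norm (F \<phi>) \<le> C * (e / (C + 1))" using C that by (intro F_le) simp
    also have "\<dots> \<le> e" using C that by (simp add: field_simps)
    finally show ?thesis .
  qed
  then have "norm (F \<phi>) \<le> 0" by (rule field_le_epsilon[where y = 0, simplified])
  then show ?thesis by simp
qed

section \<open>Point supports\<close>

text \<open>As \<open>exp (s * z)\<close> takes every nonzero value, an identically vanishing sum
  would give a polynomial with infinitely many zeros.\<close>

lemma exponential_polynomial_nonzero:
  fixes s :: complex
  assumes "s \<noteq> 0" "\<exists>n\<le>Q. P n \<noteq> 0"
  shows "\<exists>z. (\<Sum>n\<le>Q. P n * exp (of_nat n * s * z)) \<noteq> 0"
proof (rule ccontr)
  assume "\<not> ?thesis"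
  then have zero: "(\<Sum>n\<le>Q. P n * exp (of_nat n * s * z)) = 0" for z by blast
  define p where "p = (\<Sum>n\<le>Q. Polynomial.monom (P n) n)"
  have "poly p y = 0" if "y \<noteq> 0" for y
  proof -
    have "exp (of_nat n * s * (Ln y / s)) = y ^ n" for n
      using assms(1) that by (simp add: exp_of_nat_mult)
    then show ?thesis using zero[of "Ln y / s"] by (simp add: p_def poly_sum poly_monom)
  qed
  then have "UNIV - {0} \<subseteq> {y. poly p y = 0}" by auto
  then have "infinite {y. poly p y = 0}"
    using infinite_UNIV_char_0[where 'a = complex] by (metis finite_subset infinite_remove)
  then have "p = 0" using poly_roots_finite by blast
  moreover have "coeff p n = P n" if "n \<le> Q" for n
    using that by (simp add: p_def coeff_sum coeff_monom)
  ultimately show False using assms(2) by auto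
qed

lemma holomorphic_finite_zeros:
  assumes "g holomorphic_on UNIV" "\<exists>z. g z \<noteq> 0" "compact X"
  shows "finite {z \<in> X. g z = 0}"
proof (cases "g constant_on UNIV")
  case True
  then have "{z \<in> X. g z = 0} = {}" using assms(2) unfolding constant_on_def by auto
  then show ?thesis by (simp only: finite.emptyI)
next
  case False
  then show ?thesis
    using holomorphic_compact_finite_zeros[OF assms(1) open_UNIV connected_UNIV assms(3)] by simp
qed

text \<open>Factor out \<open>(z - \<xi>) ^ n\<close>, with \<open>n = 0\<close> away from zeros;
  near \<open>\<xi>\<close> the remaining factor is at least half its value there.\<close>

lemma holomorphic_order_bound:
  assumes "g holomorphic_on UNIV" "\<exists>z. g z \<noteq> 0"
  shows "\<exists>n c \<delta>. 0 < c \<and> 0 < \<delta> \<and> (\<forall>z. norm (z - \<xi>) < \<delta> \<longrightarrow> c * norm (z - \<xi>) ^ n \<le> norm (g z))"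
proof -
  have "\<exists>n k r. 0 < r \<and> isCont k \<xi> \<and> k \<xi> \<noteq> 0 \<and> (\<forall>z\<in>ball \<xi> r. g z = (z - \<xi>) ^ n * k z)"
  proof (cases "g \<xi> = 0")
    case False
    have "isCont g \<xi>"
      using holomorphic_on_imp_continuous_on[OF assms(1)] by (simp add: continuous_on_eq_continuous_at)
    then show ?thesis using False by (intro exI[of _ 0] exI[of _ g] exI[of _ 1]) auto
  next
    case True
    then have "\<not> g constant_on UNIV" using assms(2) unfolding constant_on_def by force
    then obtain k r n where k: "0 < r" "k holomorphic_on ball \<xi> r"
      "\<And>w. w \<in> ball \<xi> r \<Longrightarrow> g w = (w - \<xi>) ^ n * k w" "\<And>w. w \<in> ball \<xi> r \<Longrightarrow> k w \<noteq> 0"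
      using holomorphic_factor_zero_nonconstant[OF assms(1) open_UNIV connected_UNIV UNIV_I True] by metis
    then have "isCont k \<xi>"
      using holomorphic_on_imp_continuous_on[OF k(2)] by (simp add: continuous_on_eq_continuous_at)
    then show ?thesis using k by (intro exI[of _ n] exI[of _ k] exI[of _ r]) auto
  qed
  then obtain n k r where k: "0 < r" "isCont k \<xi>" "k \<xi> \<noteq> 0" "\<And>z. z \<in> ball \<xi> r \<Longrightarrow> g z = (z - \<xi>) ^ n * k z"
    by blast
  obtain d where d: "0 < d" "\<And>z. dist z \<xi> < d \<Longrightarrow> dist (k z) (k \<xi>) < norm (k \<xi>) / 2"
    using k(2,3) unfolding continuous_at_eps_delta by (metis half_gt_zero zero_less_norm_iff)
  have "norm (k \<xi>) / 2 * norm (z - \<xi>) ^ n \<le> norm (g z)" if "norm (z - \<xi>) < min r d" for z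
  proof -
    have "norm (k \<xi>) \<le> norm (k z) + dist (k z) (k \<xi>)"
      by (metis dist_commute dist_norm norm_triangle_sub)
    then have "norm (k \<xi>) / 2 \<le> norm (k z)"
      using d(2)[of z] that by (simp add: dist_norm)
    then have "norm (k \<xi>) / 2 * norm (z - \<xi>) ^ n \<le> norm (k z) * norm (z - \<xi>) ^ n"
      by (rule mult_right_mono) simp
    also have "\<dots> = norm (g z)" using k(4)[of z] that by (simp add: norm_mult norm_power dist_norm norm_minus_commute mult.commute)
    finally show ?thesis .
  qed
  then show ?thesis using k(1,3) d(1) by (intro exI[of _ n] exI[of _ "norm (k \<xi>) / 2"] exI[of _ "min r d"]) auto
qed

text \<open>Induction on the index set. If some \<open>\<theta>\<close> is seen by
  \<open>ev j\<close> but by no functional in \<open>I\<close>, correcting \<open>F\<close> by a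
  multiple of \<open>ev j\<close>, and test functions by multiples of \<open>\<theta>\<close>,
  reduces the claim to \<open>I\<close>; otherwise \<open>ev j\<close> is redundant.\<close>

lemma linear_functional_in_span:
  fixes F :: "(real^'d::finite \<Rightarrow> complex) \<Rightarrow> complex" and ev :: "'i \<Rightarrow> (real^'d \<Rightarrow> complex) \<Rightarrow> complex"
  assumes "finite I"
    and "\<And>i \<phi> \<psi>. i \<in> I \<Longrightarrow> smooth \<phi> \<Longrightarrow> smooth \<psi> \<Longrightarrow> ev i (\<lambda>x. \<phi> x + \<psi> x) = ev i \<phi> + ev i \<psi>"
    and "\<And>i c \<phi>. i \<in> I \<Longrightarrow> smooth \<phi> \<Longrightarrow> ev i (\<lambda>x. c * \<phi> x) = c * ev i \<phi>"
    and "\<And>\<phi> \<psi>. smooth \<phi> \<Longrightarrow> smooth \<psi> \<Longrightarrow> F (\<lambda>x. \<phi> x + \<psi> x) = F \<phi> + F \<psi>"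
    and "\<And>c \<phi>. smooth \<phi> \<Longrightarrow> F (\<lambda>x. c * \<phi> x) = c * F \<phi>"
    and "\<And>\<phi>. smooth \<phi> \<Longrightarrow> (\<And>i. i \<in> I \<Longrightarrow> ev i \<phi> = 0) \<Longrightarrow> F \<phi> = 0"
  shows "\<exists>c. \<forall>\<phi>. smooth \<phi> \<longrightarrow> F \<phi> = (\<Sum>i\<in>I. c i * ev i \<phi>)"
  using assms
proof (induction I arbitrary: F rule: finite_induct)
  case empty
  then show ?case by auto
next
  case (insert j I)
  note ev = insert.prems(1,2) and F = insert.prems(3,4)
  show ?case
  proof (cases "\<exists>\<phi>. smooth \<phi> \<and> (\<forall>i\<in>I. ev i \<phi> = 0) \<and> ev j \<phi> \<noteq> 0")
    case False
    have "\<exists>c. \<forall>\<phi>. smooth \<phi> \<longrightarrow> F \<phi> = (\<Sum>i\<in>I. c i * ev i \<phi>)"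
    proof (rule insert.IH)
      fix \<phi> assume "smooth \<phi>" "\<And>i. i \<in> I \<Longrightarrow> ev i \<phi> = 0"
      then show "F \<phi> = 0" using False by (intro insert.prems(5)) auto
    qed (use ev F in auto)
    then obtain c where c: "\<forall>\<phi>. smooth \<phi> \<longrightarrow> F \<phi> = (\<Sum>i\<in>I. c i * ev i \<phi>)" by blast
    have "(\<Sum>i\<in>insert j I. (c(j := 0)) i * ev i \<phi>) = (\<Sum>i\<in>I. c i * ev i \<phi>)" for \<phi>
      using insert.hyps by (auto intro!: sum.cong)
    then show ?thesis using c by (intro exI[of _ "c(j := 0)"]) simp
  next
    case True
    then obtain \<theta> where \<theta>: "smooth \<theta>" "\<And>i. i \<in> I \<Longrightarrow> ev i \<theta> = 0" "ev j \<theta> \<noteq> 0" by blast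
    define b where "b = F \<theta> / ev j \<theta>"
    define F' where "F' \<phi> = F \<phi> - b * ev j \<phi>" for \<phi>
    have "\<exists>c. \<forall>\<phi>. smooth \<phi> \<longrightarrow> F' \<phi> = (\<Sum>i\<in>I. c i * ev i \<phi>)"
    proof (rule insert.IH)
      fix \<phi> assume \<phi>: "smooth \<phi>" "\<And>i. i \<in> I \<Longrightarrow> ev i \<phi> = 0"
      define e where "e = - (ev j \<phi> / ev j \<theta>)"
      have s: "smooth (\<lambda>x. e * \<theta> x)" by (intro smooth_cmult \<theta>)
      have "ev i (\<lambda>x. \<phi> x + e * \<theta> x) = ev i \<phi> + e * ev i \<theta>" if "i \<in> insert j I" for i
        using ev(1)[OF that \<phi>(1) s] ev(2)[OF that \<theta>(1)] by simp
      then have "ev i (\<lambda>x. \<phi> x + e * \<theta> x) = 0" if "i \<in> insert j I" for i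
        using that \<phi>(2) \<theta>(2,3) by (auto simp: e_def)
      then have "F (\<lambda>x. \<phi> x + e * \<theta> x) = 0"
        using \<phi>(1) s by (intro insert.prems(5) smooth_add) auto
      then have "F \<phi> + e * F \<theta> = 0" using F(1)[OF \<phi>(1) s] F(2)[OF \<theta>(1)] by simp
      then show "F' \<phi> = 0" by (simp add: F'_def b_def e_def)
    qed (use ev F in \<open>auto simp: F'_def algebra_simps\<close>)
    then obtain c where c: "\<forall>\<phi>. smooth \<phi> \<longrightarrow> F' \<phi> = (\<Sum>i\<in>I. c i * ev i \<phi>)" by blast
    have "F \<phi> = (\<Sum>i\<in>insert j I. (c(j := b)) i * ev i \<phi>)" if "smooth \<phi>" for \<phi>
    proof -
      have "(\<Sum>i\<in>insert j I. (c(j := b)) i * ev i \<phi>) = b * ev j \<phi> + (\<Sum>i\<in>I. (c(j := b)) i * ev i \<phi>)"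
        using insert.hyps by simp
      also have "(\<Sum>i\<in>I. (c(j := b)) i * ev i \<phi>) = (\<Sum>i\<in>I. c i * ev i \<phi>)"
        using insert.hyps by (intro sum.cong) auto
      finally show ?thesis using c[rule_format, OF that] by (simp add: F'_def diff_eq_eq add.commute)
    qed
    then show ?thesis by blast
  qed
qed

text \<open>A distribution of order below \<open>M\<close> supported at \<open>y\<close>; the signs
  of a differentiated delta are absorbed in \<open>c\<close>.\<close>

definition jet :: "nat \<Rightarrow> ('d::finite list \<Rightarrow> complex) \<Rightarrow> real^'d \<Rightarrow> (real^'d \<Rightarrow> complex) \<Rightarrow> complex" where
  "jet M c y \<phi> = (\<Sum>is\<in>{is. length is < M}. c is * pdiffs is \<phi> y)"

lemma finite_lists_length_less: "finite {is :: 'd::finite list. length is < M}"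
  using finite_lists_length_le[of "UNIV :: 'd set" M] by (rule finite_subset[rotated]) auto

lemma jet_flat: "flat M y \<phi> \<Longrightarrow> jet M c y \<phi> = 0"
  by (auto simp: jet_def flat_def intro!: sum.neutral)

lemma jet_add: "smooth \<phi> \<Longrightarrow> smooth \<psi> \<Longrightarrow> jet M c y (\<lambda>x. \<phi> x + \<psi> x) = jet M c y \<phi> + jet M c y \<psi>"
  by (simp add: jet_def pdiffs_add algebra_simps sum.distrib)

text \<open>Makes the density of exponentials available for one point: a nonzero jet is nonzero on
  some \<open>E k\<close>.\<close>

lemma cont_functional_jet: "cont_functional {y} (jet M c y)"
  unfolding cont_functional_def
proof (intro conjI allI impI)
  show "smooth \<phi> \<Longrightarrow> jet M c y (\<lambda>x. b * \<phi> x) = b * jet M c y \<phi>" for b \<phi>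
    by (simp add: jet_def pdiffs_cmult sum_distrib_left mult_ac)
  fix \<phi>s \<phi> assume "Cconv {y} \<phi>s \<phi>"
  then have "(\<lambda>k. pdiffs is (\<phi>s k) y) \<longlonglongrightarrow> pdiffs is \<phi> y" for "is"
    using tendsto_uniform_limitI[OF Cconv_uniform_limit] by blast
  then show "(\<lambda>k. jet M c y (\<phi>s k)) \<longlonglongrightarrow> jet M c y \<phi>"
    unfolding jet_def by (intro tendsto_intros)
qed (rule jet_add)

context pairing
begin

lemma A_nonempty: "A \<noteq> {}"
  using bij by (auto simp: bij_betw_def)

text \<open>Take \<open>a\<close> maximising \<open>norm (zc a x - zc a y)\<close>. It varies with
  \<open>x\<close>, so a lower bound on the distance scale needs an annihilator for every
  coordinate.\<close>

lemma l1dist_le_zc: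
  obtains a where "a \<in> A" "l1dist y x \<le> 2 * real (card A) * norm (zc a x - zc a y)"
proof -
  have "finite ((\<lambda>a. norm (zc a x - zc a y)) ` A)" "(\<lambda>a. norm (zc a x - zc a y)) ` A \<noteq> {}"
    using A_nonempty by auto
  note Max_in[OF this] Max_ge[OF this(1)]
  then obtain a where a: "a \<in> A" "\<And>b. b \<in> A \<Longrightarrow> norm (zc b x - zc b y) \<le> norm (zc a x - zc a y)"
    by force
  have "l1dist y x = (\<Sum>b\<in>A. \<bar>Re (zc b x - zc b y)\<bar> + \<bar>Im (zc b x - zc b y)\<bar>)"
    unfolding l1dist_def sum_pair by (simp add: zc_def)
  also have "\<dots> \<le> (\<Sum>b\<in>A. 2 * norm (zc a x - zc a y))"
  proof (rule sum_mono)
    fix b assume b: "b \<in> A"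
    show "\<bar>Re (zc b x - zc b y)\<bar> + \<bar>Im (zc b x - zc b y)\<bar> \<le> 2 * norm (zc a x - zc a y)"
      using a(2)[OF b] abs_Re_le_cmod[of "zc b x - zc b y"] abs_Im_le_cmod[of "zc b x - zc b y"] by linarith
  qed
  finally show ?thesis using that a(1) by (simp add: mult_ac)
qed

lemma norm_zc_le:
  fixes x y :: "real^'d"
  assumes "\<And>j. \<bar>x $ j - y $ j\<bar> < \<delta> / 2"
  shows "norm (zc a x - zc a y) < \<delta>"
proof -
  have "norm (zc a x - zc a y) \<le> \<bar>x $ a - y $ a\<bar> + \<bar>x $ h a - y $ h a\<bar>"
    using cmod_le[of "zc a x - zc a y"] by (simp add: zc_def)
  then show ?thesis using assms[of a] assms[of "h a"] by linarith
qed

text \<open>Each \<open>g a\<close> sees only the coordinate \<open>zc a\<close>; the coordinate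
  that dominates the distance supplies the bound, and the other terms are nonnegative. Squares are
  taken because \<open>norm\<close> itself is not smooth at zeros.\<close>

lemma sum_of_squares_order_bound:
  assumes g: "\<And>a. a \<in> A \<Longrightarrow> g a holomorphic_on UNIV" "\<And>a. a \<in> A \<Longrightarrow> \<exists>z. g a z \<noteq> 0"
  shows "\<exists>M c \<delta>. 0 < c \<and> 0 < \<delta> \<and> (\<forall>x. (\<forall>j. \<bar>x $ j - y $ j\<bar> < \<delta>) \<longrightarrow>
    c * l1dist y x ^ M \<le> (\<Sum>a\<in>A. (norm (g a (zc a x)))\<^sup>2))"
proof -
  have "\<forall>a\<in>A. \<exists>n c \<delta>. 0 < c \<and> 0 < \<delta> \<and>
      (\<forall>z. norm (z - zc a y) < \<delta> \<longrightarrow> c * norm (z - zc a y) ^ n \<le> norm (g a z))"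
    using holomorphic_order_bound g by blast
  then obtain n c \<delta> where b: "\<And>a. a \<in> A \<Longrightarrow> 0 < c a" "\<And>a. a \<in> A \<Longrightarrow> 0 < \<delta> a"
    "\<And>a z. a \<in> A \<Longrightarrow> norm (z - zc a y) < \<delta> a \<Longrightarrow> c a * norm (z - zc a y) ^ n a \<le> norm (g a z)"
    by metis
  define n' where "n' = Max (n ` A)"
  define c' where "c' = Min (c ` A)"
  \<comment> \<open>The cap 1 allows every order \<open>n a\<close> to be replaced by the maximum
    \<open>n'\<close>; the half passes from real coordinates to \<open>zc\<close>.\<close>
  define \<delta>' where "\<delta>' = min 1 (Min (\<delta> ` A)) / 2"
  have c': "0 < c'" and \<delta>': "0 < \<delta>'"
    using b(1,2) A_nonempty by (auto simp: c'_def \<delta>'_def)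
  define D where "D = (2 * real (card A)) ^ (2 * n')"
  have D: "0 < D" using A_nonempty by (simp add: D_def card_gt_0_iff)
  have "(c'\<^sup>2 / D) * l1dist y x ^ (2 * n') \<le> (\<Sum>a\<in>A. (norm (g a (zc a x)))\<^sup>2)"
    if x: "\<forall>j. \<bar>x $ j - y $ j\<bar> < \<delta>'" for x
  proof -
    obtain a where a: "a \<in> A" "l1dist y x \<le> 2 * real (card A) * norm (zc a x - zc a y)"
      by (rule l1dist_le_zc)
    define t where "t = norm (zc a x - zc a y)"
    have "t < min 1 (Min (\<delta> ` A))"
      unfolding t_def by (rule norm_zc_le) (use x in \<open>auto simp: \<delta>'_def\<close>)
    moreover have "Min (\<delta> ` A) \<le> \<delta> a" using a(1) by simp
    ultimately have t: "t < 1" "t < \<delta> a" "0 \<le> t" by (auto simp: t_def)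
    have "c' * t ^ n' \<le> c a * t ^ n a"
      using a(1) t b(1)[OF a(1)] c' by (intro mult_mono power_decreasing) (auto simp: c'_def n'_def)
    also have "\<dots> \<le> norm (g a (zc a x))" using b(3)[OF a(1)] t unfolding t_def by blast
    finally have "(c' * t ^ n')\<^sup>2 \<le> (norm (g a (zc a x)))\<^sup>2"
      using c' t by (intro power_mono) auto
    also have "\<dots> \<le> (\<Sum>a\<in>A. (norm (g a (zc a x)))\<^sup>2)"
      using a(1) by (intro member_le_sum) auto
    finally have 1: "c'\<^sup>2 * t ^ (2 * n') \<le> (\<Sum>a\<in>A. (norm (g a (zc a x)))\<^sup>2)"
      by (simp add: power_mult_distrib power_mult mult.commute[of 2] flip: power_mult)
    have "l1dist y x ^ (2 * n') \<le> (2 * real (card A) * t) ^ (2 * n')"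
      using a(2) l1dist_nonneg by (intro power_mono) (auto simp: t_def)
    also have "\<dots> = D * t ^ (2 * n')" by (simp add: D_def power_mult_distrib)
    finally have "(c'\<^sup>2 / D) * l1dist y x ^ (2 * n') \<le> (c'\<^sup>2 / D) * (D * t ^ (2 * n'))"
      using D by (intro mult_left_mono) auto
    then show ?thesis using 1 D by simp
  qed
  then show ?thesis using c' \<delta>' D by (intro exI[of _ "2 * n'"] exI[of _ "c'\<^sup>2 / D"] exI[of _ \<delta>']) auto
qed

lemma finite_common_zeros:
  assumes "compact K"
    and g: "\<And>a. a \<in> A \<Longrightarrow> g a holomorphic_on UNIV" "\<And>a. a \<in> A \<Longrightarrow> \<exists>z. g a z \<noteq> 0"
  shows "finite {x \<in> K. \<forall>a\<in>A. g a (zc a x) = 0}"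
proof -
  let ?Z = "{x \<in> K. \<forall>a\<in>A. g a (zc a x) = 0}" and ?f = "\<lambda>x. \<lambda>a\<in>A. zc a x"
  have "compact (zc a ` K)" for a
    unfolding lin_vz[abs_def, symmetric] by (intro compact_continuous_image continuous_on_lin assms)
  then have "finite {z \<in> zc a ` K. g a z = 0}" if "a \<in> A" for a
    using g that by (intro holomorphic_finite_zeros) auto
  then have "finite (PiE A (\<lambda>a. {z \<in> zc a ` K. g a z = 0}))" by (intro finite_PiE) auto
  moreover have "?f ` ?Z \<subseteq> PiE A (\<lambda>a. {z \<in> zc a ` K. g a z = 0})" by auto
  ultimately have "finite (?f ` ?Z)" by (rule finite_subset[rotated])
  moreover have "inj_on ?f ?Z"
    by (intro inj_onI zc_inj) (metis restrict_apply')
  ultimately show ?thesis by (rule finite_imageD)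
qed

text \<open>The annihilators \<open>q a\<close> of the single coordinates combine into the
  nonnegative smooth function \<open>S\<close>, which also annihilates \<open>F\<close> and has
  finitely many zeros in \<open>K\<close>. Functions flat enough at these zeros are killed by
  \<open>F\<close>, so \<open>F\<close> is a combination of finitely many derivatives there.\<close>

lemma finite_jets:
  fixes F :: "(real^'d \<Rightarrow> complex) \<Rightarrow> complex"
  assumes F: "compact_distribution F" and f: "spans_harmonic f" "H_rank F f = enat m"
  obtains K Z M c where "compact K" "cont_functional K F" "finite Z"
    "\<And>\<phi>. smooth \<phi> \<Longrightarrow> F \<phi> = (\<Sum>y\<in>Z. jet M (c y) y \<phi>)"
proof -
  obtain K C N where K: "compact K" "K \<noteq> {}" and C: "0 \<le> C" and
    bound: "\<And>\<phi> b. smooth \<phi> \<Longrightarrow> (\<And>is x. length is \<le> N \<Longrightarrow> x \<in> K \<Longrightarrow> norm (pdiffs is \<phi> x) \<le> b) \<Longrightarrow> norm (F \<phi>) \<le> C * b"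
    using compact_distribution_bound[OF F] by blast
  have cont: "cont_functional K F"
    by (rule cont_functionalI_bound[OF compact_distribution_add[OF F] compact_distribution_cmult[OF F] C bound])
  define ann where "ann a s P Q \<longleftrightarrow> s \<noteq> 0 \<and> (\<exists>n\<le>Q. P n \<noteq> 0) \<and>
    (\<forall>\<phi>. smooth \<phi> \<longrightarrow> F (\<lambda>x. (\<Sum>n\<le>Q. P n * E ((of_nat n * s) *s vz a) x) * \<phi> x) = 0)" for a s P Q
  have "\<forall>a\<in>A. \<exists>s P Q. ann a s P Q"
    using annihilating_exponential_polynomial[where N = N, OF K C cont bound f] unfolding ann_def by simp
  then obtain s P Q where "\<And>a. a \<in> A \<Longrightarrow> ann a (s a) (P a) (Q a)" by metis
  then have sPQ: "\<And>a. a \<in> A \<Longrightarrow> s a \<noteq> 0" "\<And>a. a \<in> A \<Longrightarrow> \<exists>n\<le>Q a. P a n \<noteq> 0"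
    "\<And>a \<phi>. a \<in> A \<Longrightarrow> smooth \<phi> \<Longrightarrow> F (\<lambda>x. (\<Sum>n\<le>Q a. P a n * E ((of_nat n * s a) *s vz a) x) * \<phi> x) = 0"
    unfolding ann_def by simp_all
  define g where "g a z = (\<Sum>n\<le>Q a. P a n * exp (of_nat n * s a * z))" for a z
  define q where "q a x = (\<Sum>n\<le>Q a. P a n * E ((of_nat n * s a) *s vz a) x)" for a x
  have q: "q a x = g a (zc a x)" for a x
    by (simp add: q_def g_def E_def lin_smult lin_vz)
  have smooth_q: "smooth (q a)" for a
    unfolding q_def by (intro smooth_sum smooth_cmult smooth_E)
  have g: "g a holomorphic_on UNIV" "a \<in> A \<Longrightarrow> \<exists>z. g a z \<noteq> 0" for a
    using exponential_polynomial_nonzero[OF sPQ(1,2)] unfolding g_def by (auto intro!: holomorphic_intros)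
  define S' where "S' x = (\<Sum>a\<in>A. (norm (g a (zc a x)))\<^sup>2)" for x
  define S where "S x = (\<Sum>a\<in>A. q a x * cnj (q a x))" for x
  have S: "smooth S" unfolding S_def by (intro smooth_sum smooth_mult smooth_cnj smooth_q)
  have S_S': "S x = of_real (S' x)" for x
    unfolding S_def S'_def q of_real_sum complex_norm_square ..
  have S'_nonneg: "0 \<le> S' x" for x by (simp add: S'_def sum_nonneg)
  have S'_cont: "continuous_on UNIV S'"
  proof -
    have "continuous_on UNIV (\<lambda>x. Re (S x))" by (intro continuous_on_Re smooth_continuous_on S)
    then show ?thesis by (simp add: S_S')
  qed
  have FS: "F (\<lambda>x. S x * \<phi> x) = 0" if "smooth \<phi>" for \<phi>
  proof -
    have "(\<lambda>x. S x * \<phi> x) = (\<lambda>x. \<Sum>a\<in>A. 1 * (q a x * (cnj (q a x) * \<phi> x)))"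
      by (simp add: S_def sum_distrib_right mult.assoc)
    then have "F (\<lambda>x. S x * \<phi> x) = (\<Sum>a\<in>A. 1 * F (\<lambda>x. q a x * (cnj (q a x) * \<phi> x)))"
      by (simp only:) (intro cont_functional_sum[OF cont] smooth_mult smooth_cnj smooth_q that)
    moreover have "F (\<lambda>x. q a x * (cnj (q a x) * \<phi> x)) = 0" if "a \<in> A" for a
      unfolding q_def using that
      by (intro sPQ(3)) (auto intro!: smooth_mult smooth_cnj smooth_sum smooth_cmult smooth_E \<open>smooth \<phi>\<close>)
    ultimately show ?thesis by simp
  qed
  define Z where "Z = {x \<in> K. S' x = 0}"
  have "Z = {x \<in> K. \<forall>a\<in>A. g a (zc a x) = 0}"
    by (auto simp: Z_def S'_def sum_nonneg_eq_0_iff)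
  then have fin_Z: "finite Z" using finite_common_zeros[OF K(1) g] by simp
  obtain M where M: "\<And>\<phi>. smooth \<phi> \<Longrightarrow> (\<And>y. y \<in> Z \<Longrightarrow> flat M y \<phi>) \<Longrightarrow> \<exists>C. \<forall>x\<in>K. norm (\<phi> x) \<le> C * S' x ^ Suc N"
  proof -
    have "\<exists>M. \<forall>\<phi>. smooth \<phi> \<longrightarrow> (\<forall>y\<in>{x \<in> K. S' x = 0}. flat M y \<phi>) \<longrightarrow> (\<exists>C. \<forall>x\<in>K. norm (\<phi> x) \<le> C * S' x ^ Suc N)"
    proof (rule flat_control[OF K(1) S'_cont S'_nonneg])
      show "finite {x \<in> K. S' x = 0}" using fin_Z by (simp add: Z_def)
      show "\<exists>M c \<delta>. 0 < c \<and> 0 < \<delta> \<and> (\<forall>x. (\<forall>j. \<bar>x $ j - y $ j\<bar> < \<delta>) \<longrightarrow> c * l1dist y x ^ M \<le> S' x)" for y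
        unfolding S'_def by (rule sum_of_squares_order_bound[OF g])
    qed
    then show ?thesis using that unfolding Z_def by blast
  qed
  \<comment> \<open>Up to \<open>N\<close> derivatives are taken before the estimate that needs
    order \<open>M\<close>; hence \<open>M + N\<close>.\<close>
  have vanish: "F \<phi> = 0" if \<phi>: "smooth \<phi>" "\<And>y. y \<in> Z \<Longrightarrow> flat (M + N) y \<phi>" for \<phi>
  proof (rule functional_vanishes_on_dominated[where N = N, OF K(1) C cont bound S S_S' S'_nonneg FS \<phi>(1)])
    show "dominated K (\<lambda>x. S' x ^ Suc N) N \<phi>"
      unfolding dominated_def
    proof (intro allI impI M smooth_pdiffs \<phi>(1))
      fix "is" :: "'d list" and y assume "length is \<le> N" "y \<in> Z"
      then have "length (js @ is) < M + N" if "length js < M" for js :: "'d list" using that by simp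
      then show "flat M y (pdiffs is \<phi>)"
        using \<phi>(2)[OF \<open>y \<in> Z\<close>] unfolding flat_def by (metis pdiffs_append)
    qed
  qed
  define I where "I = Z \<times> {is :: 'd list. length is < M + N}"
  have "\<exists>c. \<forall>\<phi>. smooth \<phi> \<longrightarrow> F \<phi> = (\<Sum>i\<in>I. c i * pdiffs (snd i) \<phi> (fst i))"
  proof (rule linear_functional_in_span)
    show "finite I" unfolding I_def by (intro finite_cartesian_product fin_Z finite_lists_length_less)
    fix \<phi> :: "real^'d \<Rightarrow> complex" assume "smooth \<phi>" "\<And>i. i \<in> I \<Longrightarrow> pdiffs (snd i) \<phi> (fst i) = 0"
    then show "F \<phi> = 0" by (intro vanish) (auto simp: flat_def I_def)
  qed (auto simp: pdiffs_add pdiffs_cmult compact_distribution_add[OF F] compact_distribution_cmult[OF F])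
  then obtain c where c: "\<And>\<phi>. smooth \<phi> \<Longrightarrow> F \<phi> = (\<Sum>i\<in>I. c i * pdiffs (snd i) \<phi> (fst i))" by blast
  have "F \<phi> = (\<Sum>y\<in>Z. jet (M + N) (\<lambda>is. c (y, is)) y \<phi>)" if "smooth \<phi>" for \<phi>
    unfolding c[OF that] I_def jet_def sum.cartesian_product by (intro sum.cong) auto
  then show ?thesis using that[of K Z "M + N" "\<lambda>y is. c (y, is)"] K(1) cont fin_Z by blast
qed

text \<open>\<open>u\<close> is a Lagrange product, 1 at \<open>y\<close> and 0 at the other points,
  each factor using a coordinate \<open>zc\<close> that tells the two points apart. For positive
  \<open>M\<close> the polynomial \<open>1 - (1 - X ^ M) ^ M\<close> is 0 to order \<open>M\<close>
  at 0 and 1 to order \<open>M\<close> at 1, so composing it with \<open>u\<close> prescribes jets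
  instead of values.\<close>

lemma CR_poly_interpolation:
  assumes "finite Z" "y \<in> Z"
  obtains p where "CR_poly p" "flat M y (\<lambda>x. 1 - p x)" "\<And>y'. y' \<in> Z \<Longrightarrow> y' \<noteq> y \<Longrightarrow> flat M y' p"
proof -
  have "\<forall>y'. \<exists>a. y' \<noteq> y \<longrightarrow> a \<in> A \<and> zc a y \<noteq> zc a y'" using zc_inj by metis
  then obtain a where a: "\<And>y'. y' \<noteq> y \<Longrightarrow> a y' \<in> A" "\<And>y'. y' \<noteq> y \<Longrightarrow> zc (a y') y \<noteq> zc (a y') y'" by metis
  define u where "u x = (\<Prod>y'\<in>Z - {y}. inverse (zc (a y') y - zc (a y') y') * (zc (a y') x + - zc (a y') y'))" for x
  have CR_zc: "CR_poly (zc b)" if "b \<in> A" for b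
    using CR_poly_lin[OF vz_in_L[OF that]] by (simp add: lin_vz[abs_def])
  have u: "CR_poly u" unfolding u_def
    by (intro CR_poly_prod CR_poly_mult CR_poly_const CR_poly_add CR_zc a(1)) auto
  have u_y: "u y = 1" unfolding u_def using a(2) by (intro prod.neutral) auto
  have u_y': "u y' = 0" if "y' \<in> Z" "y' \<noteq> y" for y'
    unfolding u_def using assms(1) that by (intro prod_zero) auto
  define w where "w x = 1 + (-1) * u x ^ M" for x
  have w: "CR_poly w" unfolding w_def
    by (intro CR_poly_add CR_poly_mult CR_poly_power CR_poly_const u)
  define p where "p x = 1 + (-1) * w x ^ M" for x
  have p: "CR_poly p" unfolding p_def
    by (intro CR_poly_add CR_poly_mult CR_poly_power CR_poly_const w)
  show ?thesis
  proof (rule that[OF p])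
    show "flat M y (\<lambda>x. 1 - p x)"
    proof (cases "M = 0")
      case False
      then have "w y = 0" by (simp add: w_def u_y)
      then show ?thesis using flat_power[OF CR_poly_smooth[OF w], of y M] by (simp add: p_def)
    qed simp
    fix y' assume y': "y' \<in> Z" "y' \<noteq> y"
    have "p x = u x ^ M * (\<Sum>i<M. w x ^ i)" for x
      using one_diff_power_eq[of "w x" M] by (simp add: p_def w_def)
    moreover have "flat M y' (\<lambda>x. u x ^ M * (\<Sum>i<M. w x ^ i))"
      by (intro flat_mult flat_power smooth_power smooth_sum CR_poly_smooth u w u_y' y')
    ultimately show "flat M y' p" by presburger
  qed
qed

text \<open>With more than \<open>m\<close> points, interpolants that isolate the jets would produce
  a diagonal minor of size \<open>Suc m\<close> with nonzero diagonal entries.\<close>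

lemma card_support_le:
  fixes F :: "(real^'d \<Rightarrow> complex) \<Rightarrow> complex"
  assumes K: "compact K" and F: "cont_functional K F" and f: "spans_harmonic f" "H_rank F f = enat m"
    and Z: "finite Z" and jets: "\<And>\<phi>. smooth \<phi> \<Longrightarrow> F \<phi> = (\<Sum>y\<in>Z. jet M (c y) y \<phi>)"
    and nz: "\<And>y. y \<in> Z \<Longrightarrow> \<exists>\<phi>. smooth \<phi> \<and> jet M (c y) y \<phi> \<noteq> 0"
  shows "card Z \<le> m"
proof (rule ccontr)
  assume "\<not> card Z \<le> m"
  then obtain Z' where Z': "Z' \<subseteq> Z" "card Z' = Suc m" "finite Z'"
    using obtain_subset_with_card_n[of "Suc m" Z] by (metis Suc_leI not_le_imp_less)
  obtain y where y: "bij_betw y {0..<Suc m} Z'"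
    using ex_bij_betw_nat_finite[OF Z'(3)] Z'(2) by auto
  have yZ: "y i \<in> Z" if "i < Suc m" for i
    using y Z'(1) that by (auto simp: bij_betw_def)
  have y_inj: "y i = y j \<longleftrightarrow> i = j" if "i < Suc m" "j < Suc m" for i j
    using y that by (auto simp: bij_betw_def inj_on_def)
  \<comment> \<open>By density the jet is nonzero on some exponential; its exponent splits over
    \<open>L\<close> and \<open>U\<close>, and a long enough truncation of both factors still gives
    a nonzero value.\<close>
  have pair: "\<exists>p g. CR_poly p \<and> CR_poly g \<and> jet M (c z) z (\<lambda>x. p x * cnj (g x)) \<noteq> 0" if z: "z \<in> Z" for z
  proof -
    have "\<exists>k. jet M (c z) z (E k) \<noteq> 0"
    proof (rule ccontr)
      assume "\<nexists>k. jet M (c z) z (E k) \<noteq> 0"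
      then have "jet M (c z) z \<phi> = 0" if "smooth \<phi>" for \<phi>
        using cont_functional_eq_0[OF compact_sing cont_functional_jet _ that] by blast
      then show False using nz[OF z] by blast
    qed
    then obtain l u where lu: "l \<in> L" "u \<in> U" "jet M (c z) z (E (l + u)) \<noteq> 0"
      using L_U_decomp by metis
    have "(\<lambda>n. jet M (c z) z (\<lambda>x. exp_upto n (lin l x) * cnj (exp_upto n (lin (\<chi> i. cnj (u $ i)) x))))
      \<longlonglongrightarrow> jet M (c z) z (E (l + u))"
      by (intro cont_functional_lim[OF cont_functional_jet] Cconv_exp_upto_pair compact_sing)
    then have "\<exists>n. jet M (c z) z (\<lambda>x. exp_upto n (lin l x) * cnj (exp_upto n (lin (\<chi> i. cnj (u $ i)) x))) \<noteq> 0"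
      using lu(3) LIMSEQ_unique[OF _ tendsto_const] by (metis (no_types, lifting) ext)
    then show ?thesis using CR_poly_exp_upto[OF lu(1)] CR_poly_exp_upto[OF cnj_U[OF lu(2)]] by blast
  qed
  have "\<forall>z\<in>Z. \<exists>p g. CR_poly p \<and> CR_poly g \<and> jet M (c z) z (\<lambda>x. p x * cnj (g x)) \<noteq> 0"
    using pair by blast
  then obtain p g where pg: "\<And>z. z \<in> Z \<Longrightarrow> CR_poly (p z)" "\<And>z. z \<in> Z \<Longrightarrow> CR_poly (g z)"
    "\<And>z. z \<in> Z \<Longrightarrow> jet M (c z) z (\<lambda>x. p z x * cnj (g z x)) \<noteq> 0" by metis
  have "\<forall>z\<in>Z. \<exists>r. CR_poly r \<and> flat M z (\<lambda>x. 1 - r x) \<and> (\<forall>y'\<in>Z. y' \<noteq> z \<longrightarrow> flat M y' r)"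
    using CR_poly_interpolation[OF Z] by metis
  then obtain r where r: "\<And>z. z \<in> Z \<Longrightarrow> CR_poly (r z)" "\<And>z. z \<in> Z \<Longrightarrow> flat M z (\<lambda>x. 1 - r z x)"
    "\<And>z y'. z \<in> Z \<Longrightarrow> y' \<in> Z \<Longrightarrow> y' \<noteq> z \<Longrightarrow> flat M y' (r z)" by metis
  note s = CR_poly_smooth[OF pg(1)] CR_poly_smooth[OF pg(2)] CR_poly_smooth[OF r(1)]
  define G where "G z z' = (\<lambda>x. (r z x * p z x) * cnj (r z' x * g z' x))" for z z'
  have smooth_G: "smooth (G z z')" if "z \<in> Z" "z' \<in> Z" for z z'
    unfolding G_def using that by (intro smooth_mult smooth_cnj s)
  have jet_G: "jet M (c y') y' (G z z') = (if z = z' \<and> y' = z then jet M (c z) z (\<lambda>x. p z x * cnj (g z x)) else 0)"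
    if zz: "z \<in> Z" "z' \<in> Z" "y' \<in> Z" for z z' y'
  proof -
    consider "y' \<noteq> z" | "y' \<noteq> z'" | "y' = z" "y' = z'" by blast
    then show ?thesis
    proof cases
      case 1
      then have "flat M y' (G z z')"
        unfolding G_def using zz by (intro flat_mult smooth_mult smooth_cnj s r(3))
      then show ?thesis using 1 by (auto simp: jet_flat)
    next
      case 2
      then have "flat M y' (G z z')"
        unfolding G_def using zz by (intro flat_mult2 flat_cnj flat_mult smooth_mult smooth_cnj s r(3))
      then show ?thesis using 2 by (auto simp: jet_flat)
    next
      case 3
      \<comment> \<open>Replacing the interpolant by 1 changes the product only by terms containing
        \<open>e\<close> or \<open>cnj e\<close>, which are flat at \<open>z\<close>.\<close>
      define e where "e x = 1 - r z x" for x
      have e: "smooth e" "flat M z e"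
        unfolding e_def using zz r(2) by (auto intro: smooth_diff smooth_const s)
      have "(\<lambda>x. p z x * cnj (g z x)) = (\<lambda>x. G z z x + (e x * (p z x * cnj (g z x)) + cnj (e x) * (r z x * p z x * cnj (g z x))))"
        by (simp add: G_def e_def algebra_simps)
      moreover have sm: "smooth (\<lambda>x. e x * (p z x * cnj (g z x)))" "smooth (\<lambda>x. cnj (e x) * (r z x * p z x * cnj (g z x)))"
        using zz by (intro smooth_mult smooth_cnj e s; simp)+
      moreover have "flat M z (\<lambda>x. e x * (p z x * cnj (g z x)) + cnj (e x) * (r z x * p z x * cnj (g z x)))"
        using zz by (intro flat_add sm flat_mult flat_cnj e smooth_mult smooth_cnj s; simp)
      ultimately have "jet M (c z) z (\<lambda>x. p z x * cnj (g z x)) = jet M (c z) z (G z z)"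
        using jet_add[OF smooth_G[OF zz(1,1)] smooth_add[OF sm], of M "c z" z] by (simp only: jet_flat) simp
      then show ?thesis using 3 by simp
    qed
  qed
  have F_G: "F (G z z') = (if z = z' then jet M (c z) z (\<lambda>x. p z x * cnj (g z x)) else 0)"
    if "z \<in> Z" "z' \<in> Z" for z z'
  proof -
    have "F (G z z') = (\<Sum>y'\<in>Z. if y' = z then (if z = z' then jet M (c z) z (\<lambda>x. p z x * cnj (g z x)) else 0) else 0)"
      unfolding jets[OF smooth_G[OF that]] using that by (intro sum.cong) (auto simp: jet_G)
    then show ?thesis using Z that by simp
  qed
  have "kdet (Suc m) (\<lambda>i j. F (G (y i) (y j))) = 0"
    unfolding G_def using yZ
    by (intro spans_harmonic_minor_zero[OF F f] CR_poly_harmonic CR_poly_mult r(1) pg) auto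
  moreover have "kdet (Suc m) (\<lambda>i j. F (G (y i) (y j))) = (\<Prod>i<Suc m. F (G (y i) (y i)))"
    using yZ y_inj by (intro kdet_diagonal) (simp add: F_G)
  moreover have "F (G (y i) (y i)) \<noteq> 0" if "i < Suc m" for i
    using pg(3)[OF yZ[OF that]] yZ[OF that] by (simp add: F_G)
  ultimately show False by simp
qed

end

lemma exists_pairing:
  assumes "even CARD('d::finite)"
  obtains A :: "'d::finite set" and h where "pairing A h"
proof -
  obtain A :: "'d set" where A: "card A = CARD('d) div 2" "finite A"
    using obtain_subset_with_card_n[of "CARD('d) div 2" "UNIV :: 'd set"] by auto
  have "card (- A) = CARD('d) - card A" by (simp add: Compl_eq_Diff_UNIV card_Diff_subset A(2))
  then have "card A = card (- A)" using A(1) assms by presburger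
  then obtain h where "bij_betw h A (- A)"
    using finite_same_card_bij[of A "- A"] by auto
  then show ?thesis using that by (auto simp: pairing_def)
qed

theorem theorem5p1:
  fixes F :: "(real^'d::finite \<Rightarrow> complex) \<Rightarrow> complex"
    and f :: "'i \<Rightarrow> (real^'d \<Rightarrow> complex)"
    and m :: nat
  assumes "even CARD('d)"
    and "compact_distribution F"
    and "spans_harmonic f"
    and "H_rank F f = enat m"
  shows "\<exists>m0 x c. m0 \<le> m \<and> (\<forall>q. finite {is::'d list. c q is \<noteq> 0}) \<and>
     (\<forall>\<phi>. smooth \<phi> \<longrightarrow>
        F \<phi> = (\<Sum>q<m0. \<Sum>is\<in>{is. c q is \<noteq> 0}. c q is * (-1) ^ length is * pdiffs is \<phi> (x q)))"
proof -
  obtain A :: "'d set" and h where "pairing A h"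
    using exists_pairing[OF assms(1)] by blast
  then interpret pairing A h .
  obtain K Z M c where K: "compact K" "cont_functional K F" and Z: "finite Z"
    and jets: "\<And>\<phi>. smooth \<phi> \<Longrightarrow> F \<phi> = (\<Sum>y\<in>Z. jet M (c y) y \<phi>)"
    using finite_jets[OF assms(2-4)] by blast
  \<comment> \<open>Points with zero jet contribute nothing, and the bound by the rank counts only
    the others.\<close>
  define Z' where "Z' = {y \<in> Z. \<exists>\<phi>. smooth \<phi> \<and> jet M (c y) y \<phi> \<noteq> 0}"
  have fin: "finite Z'" using Z by (simp add: Z'_def)
  have jets': "F \<phi> = (\<Sum>y\<in>Z'. jet M (c y) y \<phi>)" if "smooth \<phi>" for \<phi>
    unfolding jets[OF that] using Z that by (intro sum.mono_neutral_right) (auto simp: Z'_def)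
  have le: "card Z' \<le> m"
    by (rule card_support_le[OF K assms(3,4) fin jets']) (auto simp: Z'_def)
  obtain x where x: "bij_betw x {..<card Z'} Z'"
    using ex_bij_betw_nat_finite[OF fin] by (auto simp: atLeast0LessThan)
  \<comment> \<open>The sign offsets the one that arises when derivatives of the delta are moved to
    the test function; the cut at \<open>M\<close> makes the support finite.\<close>
  define d where "d q is = (if length is < M then (-1) ^ length is * c (x q) is else 0)" for q and "is" :: "'d list"
  have sub: "{is. d q is \<noteq> 0} \<subseteq> {is. length is < M}" for q by (auto simp: d_def)
  have fin_d: "finite {is. d q is \<noteq> 0}" for q
    using sub finite_lists_length_less by (rule finite_subset)
  have "F \<phi> = (\<Sum>q<card Z'. \<Sum>is\<in>{is. d q is \<noteq> 0}. d q is * (-1) ^ length is * pdiffs is \<phi> (x q))"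
    if "smooth \<phi>" for \<phi>
  proof -
    have "jet M (c (x q)) (x q) \<phi> = (\<Sum>is\<in>{is. d q is \<noteq> 0}. d q is * (-1) ^ length is * pdiffs is \<phi> (x q))" for q
    proof -
      have sq: "(-1) ^ n * b * (-1) ^ n = (b :: complex)" for n b
        by (metis (no_types, lifting) mult.commute mult.left_commute mult_1 left_minus_one_mult_self)
      have "jet M (c (x q)) (x q) \<phi> = (\<Sum>is\<in>{is. length is < M}. d q is * (-1) ^ length is * pdiffs is \<phi> (x q))"
        unfolding jet_def by (intro sum.cong) (auto simp: d_def sq)
      also have "\<dots> = (\<Sum>is\<in>{is. d q is \<noteq> 0}. d q is * (-1) ^ length is * pdiffs is \<phi> (x q))"
        using sub finite_lists_length_less by (intro sum.mono_neutral_right) auto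
      finally show ?thesis .
    qed
    then show ?thesis
      using sum.reindex_bij_betw[OF x, of "\<lambda>y. jet M (c y) y \<phi>"] jets'[OF that] by simp
  qed
  then show ?thesis using le fin_d by blast
qed

end
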